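(* Let $A\subseteq B$ be a non-degenerate inclusion of $C^*$-algebras and let $I$ be a closed two-sided ideal of $A$. The following are equivalent: (1) any virtual commutant $\varphi\colon I\to B$ has range in $A$; (2) $\mathcal M(IBI)\cap I'=Z\mathcal M(I)$; (3) if a slice $M\subseteq B$ is isomorphic to $I$ as a Hilbert $A$-bimodule, then $M=I$; (4) if a slice $M\subseteq B$ satisfies $M^*M=I$ and $M\otimes_AM\cong M$ as a Hilbert $A$-bimodule, then already $M\cdot M=M$.
   Context: Products of subspaces denote closed linear spans of products. The inclusion is non-degenerate if $AB=B$. $\mathcal M(D)$ is the multiplier algebra of $D$ and $Z$ the centre; $\mathcal M(IBI)\cap I'$ is the set of multipliers of $IBI$ commuting with $I$; since $I\subseteq IBI$ is non-degenerate, $\mathcal M(I)\subseteq\mathcal M(IBI)$. A virtual commutant $\varphi\colon I\to B$ is an $A$-bimodule map from the ideal $I$ to $B$. A slice is a closed linear subspace $M\subseteq N(A,B)=\{b\in B:bAb^*\subseteq A,\ b^*Ab\subseteq A\}$ with $AM\subseteq M$ and $MA\subseteq M$; it is a Hilbert $A$-bimodule with right inner product $x^*y$ and left inner product $xy^*$, where a Hilbert $A$-bimodule is an $A$-bimodule that is a right and a left Hilbert $A$-module with inner products satisfying $\langle\langle x|y\rangle\rangle z=x\langle y|z\rangle$. The ideal $I$ is a Hilbert $A$-bimodule with the same formulas. *)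

theory Defs
  imports "HOL-Analysis.Analysis" "HOL-Library.Poly_Mapping"
begin

section \<open>C*-algebras\<close>

text \<open>C*-algebras are complex, not necessarily unital, and possibly zero. The real scalar
  multiplication of the normed algebra is the restriction of the complex one.\<close>

class cstar_algebra = real_normed_algebra + banach +
  fixes scaleC :: "complex \<Rightarrow> 'a \<Rightarrow> 'a" (infixr "*\<^sub>C" 75)
    and star :: "'a \<Rightarrow> 'a"
  assumes scaleC_add_right: "c *\<^sub>C (x + y) = c *\<^sub>C x + c *\<^sub>C y"
    and scaleC_add_left: "(c + d) *\<^sub>C x = c *\<^sub>C x + d *\<^sub>C x"
    and scaleC_scaleC: "c *\<^sub>C (d *\<^sub>C x) = (c * d) *\<^sub>C x"
    and scaleC_of_real: "complex_of_real r *\<^sub>C x = r *\<^sub>R x"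
    and mult_scaleC_left: "(c *\<^sub>C x) * y = c *\<^sub>C (x * y)"
    and mult_scaleC_right: "x * (c *\<^sub>C y) = c *\<^sub>C (x * y)"
    and norm_scaleC: "norm (c *\<^sub>C x) = cmod c * norm x"
    and star_add: "star (x + y) = star x + star y"
    and star_scaleC: "star (c *\<^sub>C x) = cnj c *\<^sub>C star x"
    and star_mult: "star (x * y) = star y * star x"
    and star_star: "star (star x) = x"
    and cstar_identity: "norm (star x * x) = (norm x)\<^sup>2"

global_interpretation complex_vector:
  vector_space "scaleC :: complex \<Rightarrow> 'a \<Rightarrow> 'a::cstar_algebra"
  defines csubspace = complex_vector.subspace
    and cspan = complex_vector.span
proof
  fix x :: 'a
  show "1 *\<^sub>C x = x"
    using scaleC_of_real[of 1 x] by simp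
qed (simp_all add: scaleC_add_right scaleC_add_left scaleC_scaleC)

definition closed_csubspace :: "'a::cstar_algebra set \<Rightarrow> bool" where
  "closed_csubspace X \<longleftrightarrow> csubspace X \<and> closed X"

definition cstar_subalgebra :: "'a::cstar_algebra set \<Rightarrow> bool" where
  "cstar_subalgebra A \<longleftrightarrow> closed_csubspace A \<and>
     (\<forall>x\<in>A. \<forall>y\<in>A. x * y \<in> A) \<and> (\<forall>x\<in>A. star x \<in> A)"

definition closed_ideal :: "'a::cstar_algebra set \<Rightarrow> 'a set \<Rightarrow> bool" where
  "closed_ideal A I \<longleftrightarrow> closed_csubspace I \<and> I \<subseteq> A \<and>
     (\<forall>a\<in>A. \<forall>x\<in>I. a * x \<in> I \<and> x * a \<in> I)"

definition subspace_prod :: "'a::cstar_algebra set \<Rightarrow> 'a set \<Rightarrow> 'a set" (infixl "\<cdot>" 70) where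
  "X \<cdot> Y = closure (cspan {x * y |x y. x \<in> X \<and> y \<in> Y})"

text \<open>The ambient algebra B is the whole type.\<close>

definition nondegenerate_inclusion :: "'b::cstar_algebra set \<Rightarrow> bool" where
  "nondegenerate_inclusion A \<longleftrightarrow> cstar_subalgebra A \<and> A \<cdot> UNIV = UNIV"


section \<open>Virtual commutants\<close>

definition clinear_on :: "'a::cstar_algebra set \<Rightarrow> ('a \<Rightarrow> 'a) \<Rightarrow> bool" where
  "clinear_on X f \<longleftrightarrow> (\<forall>x\<in>X. \<forall>y\<in>X. f (x + y) = f x + f y) \<and>
     (\<forall>c. \<forall>x\<in>X. f (c *\<^sub>C x) = c *\<^sub>C f x)"

text \<open>Only the values of the map on the ideal are relevant.\<close>

definition virtual_commutant :: "'b::cstar_algebra set \<Rightarrow> 'b set \<Rightarrow> ('b \<Rightarrow> 'b) \<Rightarrow> bool" where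
  "virtual_commutant A I \<phi> \<longleftrightarrow> clinear_on I \<phi> \<and>
     (\<forall>a\<in>A. \<forall>x\<in>I. \<phi> (a * x) = a * \<phi> x \<and> \<phi> (x * a) = \<phi> x * a)"


section \<open>Multiplier algebras\<close>

text \<open>Multipliers are double centralizers \<open>(L, R)\<close>; \<open>L\<close> is left and \<open>R\<close> is right multiplication
  by the multiplier. The maps are \<open>extensional\<close>, so that equal multipliers are equal pairs.\<close>

type_synonym 'a multiplier = "('a \<Rightarrow> 'a) \<times> ('a \<Rightarrow> 'a)"

definition bounded_clinear_on :: "'a::cstar_algebra set \<Rightarrow> ('a \<Rightarrow> 'a) \<Rightarrow> bool" where
  "bounded_clinear_on D f \<longleftrightarrow> clinear_on D f \<and> (\<exists>K. \<forall>x\<in>D. norm (f x) \<le> K * norm x)"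

definition multipliers :: "'a::cstar_algebra set \<Rightarrow> 'a multiplier set" where
  "multipliers D = {(L, R).
     L \<in> D \<rightarrow>\<^sub>E D \<and> R \<in> D \<rightarrow>\<^sub>E D \<and> bounded_clinear_on D L \<and> bounded_clinear_on D R \<and>
     (\<forall>x\<in>D. \<forall>y\<in>D. L (x * y) = L x * y \<and> R (x * y) = x * R y \<and> R x * y = x * L y)}"

definition mult_comp :: "'a::cstar_algebra set \<Rightarrow> 'a multiplier \<Rightarrow> 'a multiplier \<Rightarrow> 'a multiplier" where
  "mult_comp D S T = (compose D (fst S) (fst T), compose D (snd T) (snd S))"

definition mult_of :: "'a::cstar_algebra set \<Rightarrow> 'a \<Rightarrow> 'a multiplier" where
  "mult_of D x = (restrict (\<lambda>y. x * y) D, restrict (\<lambda>y. y * x) D)"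

definition mult_centre :: "'a::cstar_algebra set \<Rightarrow> 'a multiplier set" where
  "mult_centre D = {S \<in> multipliers D. \<forall>T\<in>multipliers D. mult_comp D S T = mult_comp D T S}"

definition mult_commutant :: "'a::cstar_algebra set \<Rightarrow> 'a set \<Rightarrow> 'a multiplier set" where
  "mult_commutant D X = {T \<in> multipliers D.
     \<forall>x\<in>X. mult_comp D T (mult_of D x) = mult_comp D (mult_of D x) T}"

text \<open>The inclusion of the multipliers of \<open>I\<close> into those of \<open>D\<close>, for a non-degenerate inclusion
  \<open>I \<subseteq> D\<close>: the image \<open>T\<close> of \<open>S\<close> is determined by \<open>T (x d) = (S x) d\<close> and \<open>(d x) T = d (x S)\<close>.\<close>

definition mult_incl :: "'a::cstar_algebra set \<Rightarrow> 'a set \<Rightarrow> 'a multiplier \<Rightarrow> 'a multiplier" where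
  "mult_incl I D S = (THE T. T \<in> multipliers D \<and>
     (\<forall>x\<in>I. \<forall>d\<in>D. fst T (x * d) = fst S x * d \<and> snd T (d * x) = d * snd S x))"


section \<open>Hilbert bimodules\<close>

text \<open>The operations of a Hilbert bimodule with underlying set \<open>hcarrier\<close>; the left inner product
  \<open>lip\<close> is linear in the first variable, the right inner product \<open>rip\<close> in the second one.\<close>

record ('a, 'e) hilbert_bimod =
  hcarrier :: "'e set"
  hadd :: "'e \<Rightarrow> 'e \<Rightarrow> 'e"
  hscale :: "complex \<Rightarrow> 'e \<Rightarrow> 'e"
  lact :: "'a \<Rightarrow> 'e \<Rightarrow> 'e"
  ract :: "'e \<Rightarrow> 'a \<Rightarrow> 'e"
  lip :: "'e \<Rightarrow> 'e \<Rightarrow> 'a"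
  rip :: "'e \<Rightarrow> 'e \<Rightarrow> 'a"

definition hilbert_bimod_iso ::
    "'a set \<Rightarrow> ('a, 'e) hilbert_bimod \<Rightarrow> ('a, 'f) hilbert_bimod \<Rightarrow> bool" where
  "hilbert_bimod_iso A E F \<longleftrightarrow> (\<exists>U. bij_betw U (hcarrier E) (hcarrier F) \<and>
     (\<forall>x\<in>hcarrier E. \<forall>y\<in>hcarrier E. U (hadd E x y) = hadd F (U x) (U y)) \<and>
     (\<forall>c. \<forall>x\<in>hcarrier E. U (hscale E c x) = hscale F c (U x)) \<and>
     (\<forall>a\<in>A. \<forall>x\<in>hcarrier E. U (lact E a x) = lact F a (U x) \<and> U (ract E x a) = ract F (U x) a) \<and>
     (\<forall>x\<in>hcarrier E. \<forall>y\<in>hcarrier E.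
        lip F (U x) (U y) = lip E x y \<and> rip F (U x) (U y) = rip E x y))"

subsection \<open>Slices\<close>

definition normalisers :: "'b::cstar_algebra set \<Rightarrow> 'b set" where
  "normalisers A = {b. \<forall>a\<in>A. b * a * star b \<in> A \<and> star b * a * b \<in> A}"

definition slice :: "'b::cstar_algebra set \<Rightarrow> 'b set \<Rightarrow> bool" where
  "slice A M \<longleftrightarrow> closed_csubspace M \<and> M \<subseteq> normalisers A \<and> A \<cdot> M \<subseteq> M \<and> M \<cdot> A \<subseteq> M"

definition slice_bimod :: "'b::cstar_algebra set \<Rightarrow> ('b, 'b) hilbert_bimod" where
  "slice_bimod M = \<lparr>hcarrier = M, hadd = (+), hscale = scaleC, lact = (*), ract = (*),
     lip = (\<lambda>x y. x * star y), rip = (\<lambda>x y. star x * y)\<rparr>"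

subsection \<open>Tensor products\<close>

text \<open>The interior tensor product of \<open>E\<close> and \<open>F\<close> is the Hausdorff completion of the space of formal
  linear combinations of pairs \<open>(x, y)\<close>, standing for the elementary tensors, for the semi-inner
  products

    \<open>\<langle>x \<otimes> y | x' \<otimes> y'\<rangle> = \<langle>y | \<langle>x | x'\<rangle> y'\<rangle>\<close> and \<open>\<langle>\<langle>x \<otimes> y | x' \<otimes> y'\<rangle>\<rangle> = \<langle>\<langle>x \<langle>\<langle>y | y'\<rangle>\<rangle> | x'\<rangle>\<rangle>\<close>.

  The relations of bilinearity and \<open>A\<close>-balancedness, \<open>x a \<otimes> y = x \<otimes> a y\<close>, need not be divided out
  separately, because they hold up to vectors of length 0; this is also why \<open>A\<close> is not a
  parameter. The completion consists of classes of Cauchy sequences.\<close>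

type_synonym ('e, 'f) formal_tensor = "('e \<times> 'f) \<Rightarrow>\<^sub>0 complex"

definition formal_tensors ::
    "('a, 'e) hilbert_bimod \<Rightarrow> ('a, 'f) hilbert_bimod \<Rightarrow> ('e, 'f) formal_tensor set" where
  "formal_tensors E F = {s. Poly_Mapping.keys s \<subseteq> hcarrier E \<times> hcarrier F}"

definition formal_rip :: "('a::cstar_algebra, 'e) hilbert_bimod \<Rightarrow> ('a, 'f) hilbert_bimod \<Rightarrow>
    ('e, 'f) formal_tensor \<Rightarrow> ('e, 'f) formal_tensor \<Rightarrow> 'a" where
  "formal_rip E F s t = (\<Sum>(x, y)\<in>Poly_Mapping.keys s. \<Sum>(x', y')\<in>Poly_Mapping.keys t.
     (cnj (Poly_Mapping.lookup s (x, y)) * Poly_Mapping.lookup t (x', y')) *\<^sub>C rip F y (lact F (rip E x x') y'))"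

definition formal_lip :: "('a::cstar_algebra, 'e) hilbert_bimod \<Rightarrow> ('a, 'f) hilbert_bimod \<Rightarrow>
    ('e, 'f) formal_tensor \<Rightarrow> ('e, 'f) formal_tensor \<Rightarrow> 'a" where
  "formal_lip E F s t = (\<Sum>(x, y)\<in>Poly_Mapping.keys s. \<Sum>(x', y')\<in>Poly_Mapping.keys t.
     (Poly_Mapping.lookup s (x, y) * cnj (Poly_Mapping.lookup t (x', y'))) *\<^sub>C lip E (ract E x (lip F y y')) x')"

definition formal_scale :: "complex \<Rightarrow> ('e, 'f) formal_tensor \<Rightarrow> ('e, 'f) formal_tensor" where
  "formal_scale c s = Poly_Mapping.map ((*) c) s"

definition formal_lact ::
    "('a, 'e) hilbert_bimod \<Rightarrow> 'a \<Rightarrow> ('e, 'f) formal_tensor \<Rightarrow> ('e, 'f) formal_tensor" where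
  "formal_lact E a s = (\<Sum>(x, y)\<in>Poly_Mapping.keys s. Poly_Mapping.single (lact E a x, y) (Poly_Mapping.lookup s (x, y)))"

definition formal_ract ::
    "('a, 'f) hilbert_bimod \<Rightarrow> ('e, 'f) formal_tensor \<Rightarrow> 'a \<Rightarrow> ('e, 'f) formal_tensor" where
  "formal_ract F s a = (\<Sum>(x, y)\<in>Poly_Mapping.keys s. Poly_Mapping.single (x, ract F y a) (Poly_Mapping.lookup s (x, y)))"

definition formal_seminorm :: "('a::cstar_algebra, 'e) hilbert_bimod \<Rightarrow> ('a, 'f) hilbert_bimod \<Rightarrow>
    ('e, 'f) formal_tensor \<Rightarrow> real" where
  "formal_seminorm E F s = sqrt (norm (formal_rip E F s s))"

definition tensor_Cauchy :: "('a::cstar_algebra, 'e) hilbert_bimod \<Rightarrow> ('a, 'f) hilbert_bimod \<Rightarrow>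
    (nat \<Rightarrow> ('e, 'f) formal_tensor) set" where
  "tensor_Cauchy E F = {s. (\<forall>n. s n \<in> formal_tensors E F) \<and>
     (\<forall>e>0. \<exists>N. \<forall>m\<ge>N. \<forall>n\<ge>N. formal_seminorm E F (s m - s n) < e)}"

definition tensor_rel :: "('a::cstar_algebra, 'e) hilbert_bimod \<Rightarrow> ('a, 'f) hilbert_bimod \<Rightarrow>
    ((nat \<Rightarrow> ('e, 'f) formal_tensor) \<times> (nat \<Rightarrow> ('e, 'f) formal_tensor)) set" where
  "tensor_rel E F = {(s, t). s \<in> tensor_Cauchy E F \<and> t \<in> tensor_Cauchy E F \<and>
     (\<lambda>n. formal_seminorm E F (s n - t n)) \<longlonglongrightarrow> 0}"

definition tensor_rep :: "(nat \<Rightarrow> ('e, 'f) formal_tensor) set \<Rightarrow> nat \<Rightarrow> ('e, 'f) formal_tensor" where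
  "tensor_rep X = (SOME s. s \<in> X)"

definition tensor_bimod :: "('a::cstar_algebra, 'e) hilbert_bimod \<Rightarrow> ('a, 'f) hilbert_bimod \<Rightarrow>
    ('a, (nat \<Rightarrow> ('e, 'f) formal_tensor) set) hilbert_bimod" where
  "tensor_bimod E F = \<lparr>
     hcarrier = tensor_Cauchy E F // tensor_rel E F,
     hadd = (\<lambda>X Y. tensor_rel E F `` {\<lambda>n. tensor_rep X n + tensor_rep Y n}),
     hscale = (\<lambda>c X. tensor_rel E F `` {\<lambda>n. formal_scale c (tensor_rep X n)}),
     lact = (\<lambda>a X. tensor_rel E F `` {\<lambda>n. formal_lact E a (tensor_rep X n)}),
     ract = (\<lambda>X a. tensor_rel E F `` {\<lambda>n. formal_ract F (tensor_rep X n) a}),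
     lip = (\<lambda>X Y. lim (\<lambda>n. formal_lip E F (tensor_rep X n) (tensor_rep Y n))),
     rip = (\<lambda>X Y. lim (\<lambda>n. formal_rip E F (tensor_rep X n) (tensor_rep Y n)))\<rparr>"

end

(*
  For slices the bimodules are concrete subspaces of B, and an isomorphism of I onto a slice M is in
  particular a virtual commutant. By Cohen factorisation a virtual commutant is bounded and maps I
  into D = IBI, and it extends to a multiplier of D that commutes with I; this is (1) <-> (2).

  If (1) holds, then an isomorphism of I onto a slice M maps into A, which forces M = I. Conversely, it
  suffices to treat a self-adjoint virtual commutant of small norm. The Cayley transform u of its
  multiplier is a unitary multiplier commuting with I, so u I is a slice isomorphic to I. If u I = I,
  then inverting the Cayley transform inside I shows that the virtual commutant maps I into I.

  If M is isomorphic to I, then the tensor square of M is isomorphic to M and M* M = I, so that M M = M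
  gives M = I M = M* M M = M* M = I. Conversely, the tensor square of any slice M is
  isomorphic to M M; under the hypothesis of (4) so is M, and tensoring with M* on the left yields an
  isomorphism of I = M* M with the slice M* M M. By (3) this slice is I, and then M = M I = M M* M M = M M.
*)
theory Submission
  imports Defs
begin

section \<open>Preliminaries\<close>

text \<open>The argument avoids spectral theory and rests on the C*-identity and Banach's fixed
  point theorem. This is why the Cayley transform occurs twice: once for an element of norm less
  than 1, to obtain approximate units as ergodic means of unitaries, and once for a self-adjoint
  multiplier. Approximate units found in this way have norm at most 2 instead of 1. Hence the bound
  \<open>2 * K\<close> for the extension of a virtual commutant with bound \<open>K\<close>, and
  hence the constant 1/6 for the maps whose Cayley transform is taken: the multiplier then has norm
  at most 1/3, and its resolvent differs from the identity by at most 1/2. The tensor products in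
  (4) are formal completions and are never handled directly. A map \<open>m\<close> into B for which
  \<open>star (m x y) * m x' y'\<close> and \<open>m x y * star (m x' y')\<close> are the inner
  products of elementary tensors identifies the completion with the closed span of the values of
  \<open>m\<close>. Two such maps on the same pair of bimodules have isomorphic ranges, and this
  takes the place of tensoring an isomorphism with an identity map.\<close>

lemma star_zero [simp]: "star (0::'a::cstar_algebra) = 0"
  using star_add[of "0::'a" 0] by simp

lemma star_minus [simp]: "star (- x) = - star (x::'a::cstar_algebra)"
  using star_add[of x "- x"] by (simp add: eq_neg_iff_add_eq_0 add.commute)

lemma star_diff: "star (x - y) = star x - star (y::'a::cstar_algebra)"
  using star_add[of x "- y"] by simp

lemma star_scaleR: "star (r *\<^sub>R x) = r *\<^sub>R star (x::'a::cstar_algebra)"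
  using star_scaleC[of "complex_of_real r" x] by (simp add: scaleC_of_real)

lemma star_sum: "star (sum f S) = (\<Sum>i\<in>S. star (f i :: 'a::cstar_algebra))"
  by (induction S rule: infinite_finite_induct) (auto simp: star_add)

lemma norm_star [simp]: "norm (star x) = norm (x::'a::cstar_algebra)"
proof -
  have *: "norm x \<le> norm (star x)" for x :: 'a
  proof (cases "x = 0")
    case False
    have "norm x * norm x \<le> norm (star x) * norm x"
      using cstar_identity[of x] norm_mult_ineq[of "star x" x] by (simp add: power2_eq_square)
    then show ?thesis
      using False by simp
  qed simp
  show ?thesis
    using *[of x] *[of "star x"] by (simp add: star_star)
qed

lemma cstar_identity': "norm (x * star x) = (norm (x::'a::cstar_algebra))\<^sup>2"
  using cstar_identity[of "star x"] by (simp add: star_star)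

lemma mult_star_self_eq_0 [simp]: "x * star x = 0 \<longleftrightarrow> (x::'a::cstar_algebra) = 0"
  using cstar_identity'[of x] by auto

lemma star_eq_iff: "star x = y \<longleftrightarrow> (x::'a::cstar_algebra) = star y"
  by (metis star_star)

lemma tendsto_star [tendsto_intros]:
  "(f \<longlongrightarrow> l) F \<Longrightarrow> ((\<lambda>x. star (f x :: 'a::cstar_algebra)) \<longlongrightarrow> star l) F"
  by (simp add: tendsto_iff dist_norm flip: star_diff)

lemma bounded_linear_scaleC: "bounded_linear (\<lambda>x::'a::cstar_algebra. c *\<^sub>C x)"
proof (rule bounded_linear_intro)
  fix r :: real and x y :: 'a
  show "c *\<^sub>C (x + y) = c *\<^sub>C x + c *\<^sub>C y"
    by (rule scaleC_add_right)
  show "c *\<^sub>C r *\<^sub>R x = r *\<^sub>R c *\<^sub>C x"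
    by (simp add: scaleC_scaleC mult.commute flip: scaleC_of_real)
  show "norm (c *\<^sub>C x) \<le> norm x * cmod c"
    by (simp add: norm_scaleC)
qed

lemmas tendsto_scaleC [tendsto_intros] = bounded_linear.tendsto[OF bounded_linear_scaleC]

section \<open>Closed subspaces, closed spans and products of subspaces\<close>

lemma closed_csubspaceD:
  assumes "closed_csubspace X"
  shows "0 \<in> X" "\<And>x y. x \<in> X \<Longrightarrow> y \<in> X \<Longrightarrow> x + y \<in> X" "\<And>c x. x \<in> X \<Longrightarrow> c *\<^sub>C x \<in> X"
    "\<And>x y. x \<in> X \<Longrightarrow> y \<in> X \<Longrightarrow> x - y \<in> X" "\<And>x. x \<in> X \<Longrightarrow> - x \<in> X"
    "\<And>r x. x \<in> X \<Longrightarrow> r *\<^sub>R x \<in> X" "\<And>f S. (\<And>i. i \<in> S \<Longrightarrow> f i \<in> X) \<Longrightarrow> sum f S \<in> X"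
    "closed X" "csubspace X"
  using assms unfolding closed_csubspace_def
  by (auto simp: complex_vector.subspace_def complex_vector.subspace_diff
      complex_vector.subspace_neg complex_vector.subspace_sum simp flip: scaleC_of_real)

lemma closed_csubspaceI:
  assumes "0 \<in> X" "\<And>x y. x \<in> X \<Longrightarrow> y \<in> X \<Longrightarrow> x + y \<in> X" "\<And>c x. x \<in> X \<Longrightarrow> c *\<^sub>C x \<in> X"
    and "\<And>s l. (\<And>n::nat. s n \<in> X) \<Longrightarrow> s \<longlonglongrightarrow> l \<Longrightarrow> l \<in> X"
  shows "closed_csubspace X"
proof -
  have "closed X"
    unfolding closed_sequential_limits using assms(4) by blast
  then show ?thesis
    using assms(1-3) by (simp add: closed_csubspace_def complex_vector.subspace_def)
qed

lemma closed_csubspace_lim: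
  assumes "closed_csubspace X" "(f \<longlongrightarrow> l) F" "F \<noteq> bot" "eventually (\<lambda>x. f x \<in> X) F"
  shows "l \<in> X"
  using assms Lim_in_closed_set[of X f F l] closed_csubspaceD(8) by blast

lemma csubspace_closure:
  assumes "csubspace (X :: 'a::cstar_algebra set)"
  shows "closed_csubspace (closure X)"
proof (rule closed_csubspaceI)
  show "0 \<in> closure X"
    using assms closure_subset complex_vector.subspace_0 by blast
next
  fix x y assume "x \<in> closure X" "y \<in> closure X"
  then obtain s t where "\<And>n. s n \<in> X" "s \<longlonglongrightarrow> x" "\<And>n. t n \<in> X" "t \<longlonglongrightarrow> y"
    unfolding closure_sequential by blast
  then have "\<And>n. s n + t n \<in> X" "(\<lambda>n. s n + t n) \<longlonglongrightarrow> x + y"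
    using assms by (auto intro: tendsto_add complex_vector.subspace_add)
  then show "x + y \<in> closure X"
    unfolding closure_sequential by (intro exI) auto
next
  fix c x assume "x \<in> closure X"
  then obtain s where "\<And>n. s n \<in> X" "s \<longlonglongrightarrow> x"
    unfolding closure_sequential by blast
  then have "\<And>n. c *\<^sub>C s n \<in> X" "(\<lambda>n. c *\<^sub>C s n) \<longlonglongrightarrow> c *\<^sub>C x"
    using assms by (auto intro: tendsto_scaleC complex_vector.subspace_scale)
  then show "c *\<^sub>C x \<in> closure X"
    unfolding closure_sequential by (intro exI) auto
next
  fix s l assume "\<And>n::nat. s n \<in> closure X" "s \<longlonglongrightarrow> l"
  then show "l \<in> closure X"
    using closed_closure closed_sequentially by blast
qed

definition closed_cspan :: "'a::cstar_algebra set \<Rightarrow> 'a set" where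
  "closed_cspan X = closure (cspan X)"

lemma closed_csubspace_closed_cspan [simp]: "closed_csubspace (closed_cspan X)"
  unfolding closed_cspan_def by (simp add: csubspace_closure complex_vector.subspace_span)

lemma closed_cspan_base: "x \<in> X \<Longrightarrow> x \<in> closed_cspan X"
  unfolding closed_cspan_def using closure_subset complex_vector.span_base by blast

lemma closed_cspan_least: "closed_csubspace S \<Longrightarrow> X \<subseteq> S \<Longrightarrow> closed_cspan X \<subseteq> S"
  unfolding closed_cspan_def closed_csubspace_def
  by (simp add: closure_minimal complex_vector.span_minimal)

lemma subspace_prod_eq: "X \<cdot> Y = closed_cspan {x * y |x y. x \<in> X \<and> y \<in> Y}"
  by (simp add: subspace_prod_def closed_cspan_def)

lemma closed_csubspace_prod [simp]: "closed_csubspace (X \<cdot> Y)"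
  by (simp add: subspace_prod_eq)

lemma subspace_prodI: "x \<in> X \<Longrightarrow> y \<in> Y \<Longrightarrow> x * y \<in> X \<cdot> Y"
  unfolding subspace_prod_eq by (rule closed_cspan_base) blast

lemma subspace_prod_least:
  assumes "closed_csubspace S" "\<And>x y. x \<in> X \<Longrightarrow> y \<in> Y \<Longrightarrow> x * y \<in> S"
  shows "X \<cdot> Y \<subseteq> S"
  unfolding subspace_prod_eq using assms by (intro closed_cspan_least) auto

lemma closed_csubspace_UNIV [simp]: "closed_csubspace (UNIV :: 'a::cstar_algebra set)"
  by (simp add: closed_csubspace_def)

text \<open>Applied to such preimages, \<open>subspace_prod_least\<close> reduces inclusions between
  closed spans of products to the generating products.\<close>

lemma closed_csubspace_vimage_mult_left:
  assumes "closed_csubspace S"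
  shows "closed_csubspace {z. a * z \<in> S}"
  by (rule closed_csubspaceI)
    (auto simp: closed_csubspaceD[OF assms] distrib_left mult_scaleC_right
      intro: closed_sequentially[OF closed_csubspaceD(8)[OF assms] _ tendsto_mult_left])

lemma closed_csubspace_vimage_mult_right:
  assumes "closed_csubspace S"
  shows "closed_csubspace {z. z * a \<in> S}"
  by (rule closed_csubspaceI)
    (auto simp: closed_csubspaceD[OF assms] distrib_right mult_scaleC_left
      intro: closed_sequentially[OF closed_csubspaceD(8)[OF assms] _ tendsto_mult_right])

lemma closed_csubspace_vimage_star:
  assumes "closed_csubspace S"
  shows "closed_csubspace {z. star z \<in> S}"
  by (rule closed_csubspaceI)
    (auto simp: closed_csubspaceD[OF assms] star_add star_scaleC
      intro: closed_sequentially[OF closed_csubspaceD(8)[OF assms] _ tendsto_star])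

lemma closed_csubspace_Int:
  "closed_csubspace S \<Longrightarrow> closed_csubspace T \<Longrightarrow> closed_csubspace (S \<inter> T)"
  unfolding closed_csubspace_def by (simp add: complex_vector.subspace_inter closed_Int)

lemma star_subspace_prod:
  assumes "b \<in> X \<cdot> Y"
  shows "star b \<in> star ` Y \<cdot> star ` X"
proof -
  have "X \<cdot> Y \<subseteq> {z. star z \<in> star ` Y \<cdot> star ` X}"
    by (rule subspace_prod_least) (auto simp: closed_csubspace_vimage_star star_mult intro: subspace_prodI)
  then show ?thesis
    using assms by blast
qed

lemma cstar_subalgebraD:
  assumes "cstar_subalgebra J"
  shows "closed_csubspace J" "\<And>x y. x \<in> J \<Longrightarrow> y \<in> J \<Longrightarrow> x * y \<in> J" "\<And>x. x \<in> J \<Longrightarrow> star x \<in> J"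
    "star ` J = J"
  using assms unfolding cstar_subalgebra_def image_def by (auto, metis star_star)

lemma cstar_subalgebra_UNIV [simp]: "cstar_subalgebra (UNIV :: 'a::cstar_algebra set)"
  by (simp add: cstar_subalgebra_def)

text \<open>Substitute for the Neumann series: \<open>1 - T\<close> is inverted inside the closed
  subspace \<open>X\<close>. All inverses below, in formal unitisations and of operators on a
  subspace, are obtained in this way.\<close>

lemma contraction_solve:
  assumes X: "closed_csubspace X" and x: "x \<in> X" and T: "\<And>z. z \<in> X \<Longrightarrow> T z \<in> X"
    and lip: "\<And>y z. y \<in> X \<Longrightarrow> z \<in> X \<Longrightarrow> norm (T y - T z) \<le> r * norm (y - z)"
    and r: "0 \<le> r" "r < 1"
  shows "\<exists>z\<in>X. z = x + T z"
proof -
  have "complete X"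
    using closed_csubspaceD(8)[OF X] by (simp add: complete_eq_closed)
  moreover have "(\<lambda>z. x + T z) ` X \<subseteq> X"
    using closed_csubspaceD(2)[OF X] x T by auto
  ultimately have "\<exists>!z. z \<in> X \<and> x + T z = z"
    using x r lip by (intro Banach_fix[where c = r]) (auto simp: dist_norm)
  then show ?thesis
    by metis
qed


section \<open>Approximate units\<close>

text \<open>With \<open>k = \<i> h\<close>, the solution \<open>w\<close> satisfies \<open>1 + w = (1 - k)\<^sup>-\<^sup>1\<close>, so that \<open>1 + 2 w\<close> is the Cayley
  transform of \<open>h\<close>. It is unitary; the unit is only formal.\<close>

lemma cayley_element:
  fixes k :: "'a::cstar_algebra"
  assumes J: "closed_csubspace J" "\<And>x y. x \<in> J \<Longrightarrow> y \<in> J \<Longrightarrow> x * y \<in> J"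
    and k: "k \<in> J" "star k = - k" "norm k < 1"
  obtains w where "w \<in> J" "w = k + k * w" "w = k + w * k" "w + star w + (w * star w + w * star w) = 0"
proof -
  obtain w where w: "w \<in> J" "w = k + k * w"
    using contraction_solve[OF J(1) k(1), of "\<lambda>z. k * z" "norm k"] J(2) k
    by (auto simp: norm_mult_ineq simp flip: right_diff_distrib)
  obtain w' where w': "w' \<in> J" "w' = k + w' * k"
    using contraction_solve[OF J(1) k(1), of "\<lambda>z. z * k" "norm k"] J(2) k
    by (auto simp: norm_mult_ineq mult.commute[of "norm k"] simp flip: left_diff_distrib)
  \<comment> \<open>Both sides equal \<open>w' * w\<close>, with one or the other factor expanded;
    thus left and right quasi-inverses agree.\<close>
  have "k * w + w' * k * w = w' * k + w' * k * w"
    by (metis distrib_left distrib_right mult.assoc w(2) w'(2))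
  then have "w = k + w' * k"
    using w(2) by simp
  then have wk: "w = k + w * k"
    using w' by simp
  have "star w = - k - star w * k"
    by (subst w(2)) (simp add: star_add star_mult k(2))
  moreover have sk: "star w = - k - k * star w"
    by (subst wk) (simp add: star_add star_mult k(2))
  moreover have "w * star w = k * star w + w * (k * star w)"
    by (subst wk) (simp add: distrib_right mult.assoc)
  moreover have "k * star w = - k - star w"
    by (subst (2) sk) simp
  ultimately have "w * star w = - k - star w + w * (- k - star w)"
    by simp
  then have "w + star w + (w * star w + w * star w) = w - (k + w * k)"
    by (simp add: algebra_simps)
  then show ?thesis
    using that[of w] w wk by simp
qed

text \<open>Mean ergodic argument. With 1 + v the Cayley transform of h, 1 - e is the mean of the
  first n powers of 1 + v. These act isometrically from the right, so 1 - e is contractive; since k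
  annihilates the vectors fixed by 1 + v, its product with the mean is of order 1/n.\<close>

lemma approximate_unit_selfadjoint:
  fixes h :: "'a::cstar_algebra"
  assumes J: "closed_csubspace J" "\<And>x y. x \<in> J \<Longrightarrow> y \<in> J \<Longrightarrow> x * y \<in> J"
    and h: "h \<in> J" "star h = h" "norm h < 1" and \<epsilon>: "\<epsilon> > 0"
  shows "\<exists>e\<in>J. norm (h - h * e) < \<epsilon> \<and> (\<forall>b. norm (b - b * e) \<le> norm b)"
proof -
  note J' = closed_csubspaceD[OF J(1)]
  define k where "k = \<i> *\<^sub>C h"
  have k: "k \<in> J" "star k = - k" "norm k < 1"
    using J' h by (auto simp: k_def star_scaleC norm_scaleC)
  obtain w where w: "w \<in> J" "w = k + k * w" "w = k + w * k"
      "w + star w + (w * star w + w * star w) = 0"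
    using cayley_element[OF J k] by metis
  define v where "v = w + w"
  have v: "v \<in> J"
    using w J' by (simp add: v_def)
  have v_unitary: "v + star v + v * star v = 0"
  proof -
    have "v + star v + v * star v = (w + star w + (w * star w + w * star w)) + (w + star w + (w * star w + w * star w))"
      by (simp add: v_def star_add algebra_simps)
    then show ?thesis
      using w(4) by simp
  qed
  have kv: "k + k = v - k * v"
  proof -
    have "k * w = w - k"
      using w(2) by (metis add_diff_cancel_left')
    then show ?thesis
      by (simp add: v_def distrib_left)
  qed
  have isom: "norm (b + b * v) = norm b" for b
  proof -
    have "(b + b * v) * star (b + b * v) = b * star b + b * (v + star v + v * star v) * star b"
      by (simp add: star_add star_mult algebra_simps)
    also have "\<dots> = b * star b"
      by (simp only: v_unitary) simp
    finally show ?thesis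
      using cstar_identity'[of "b + b * v"] cstar_identity'[of b] by simp
  qed
  \<comment> \<open>Formally 1 + u n = (1 + v)^n.\<close>
  define u where "u = rec_nat 0 (\<lambda>_ z. z + v + z * v)"
  have u0: "u 0 = 0" and uS: "u (Suc n) = u n + v + u n * v" for n
    by (simp_all add: u_def)
  have uJ: "u n \<in> J" for n
    by (induction n) (auto simp: u0 uS J' J(2) v)
  have ucomm: "u n * v = v * u n" for n
    by (induction n) (simp_all add: u0 uS algebra_simps)
  have uisom: "norm (b + b * u n) = norm b" for b n
  proof (induction n)
    case (Suc n)
    have "b + b * u (Suc n) = (b + b * u n) + (b + b * u n) * v"
      by (simp add: uS algebra_simps)
    then show ?case
      using Suc by (simp only: isom)
  qed (simp add: u0)
  \<comment> \<open>The unit being formal, the bound is read off from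
    \<open>star (u n) * (1 + u n)\<close>, which has the same norm as \<open>u n\<close>.\<close>
  have u2: "norm (u n) \<le> 2" for n
  proof -
    have "norm (star (u n) * u n) \<le> norm (star (u n) + star (u n) * u n) + norm (star (u n))"
      by (metis add_diff_cancel_left' norm_triangle_ineq4 add.commute)
    then have "norm (u n) * norm (u n) \<le> 2 * norm (u n)"
      by (simp add: uisom cstar_identity power2_eq_square)
    then show ?thesis
      by (cases "norm (u n) = 0") auto
  qed
  \<comment> \<open>From 2 k = (1 - k) v: multiplied by 2 k, a power of 1 + v becomes a difference
    of consecutive powers, and the sum telescopes.\<close>
  have step: "(k + k) + (k + k) * u n = (u (Suc n) - u n) - k * (u (Suc n) - u n)" for n
    unfolding kv uS ucomm by (simp add: algebra_simps)
  have sums: "(\<Sum>j<n. (k + k) + (k + k) * u j) = u n - k * u n" for n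
  proof (induction n)
    case (Suc n)
    show ?case
      unfolding sum.lessThan_Suc Suc.IH unfolding step by (simp add: algebra_simps)
  qed (simp add: u0)
  obtain n :: nat where n: "2 / \<epsilon> < real n" "n > 0"
    by (metis gr0I gr_implies_not0 of_nat_0_less_iff reals_Archimedean2 divide_pos_pos \<epsilon> less_trans zero_less_numeral)
  define e where "e = - ((1 / real n) *\<^sub>R (\<Sum>j<n. u j))"
  have avg: "b - b * e = (1 / real n) *\<^sub>R (\<Sum>j<n. b + b * u j)" for b
    using n by (simp add: e_def sum.distrib scaleR_right_distrib sum_distrib_left sum_constant_scaleR)
  have contr: "norm (b - b * e) \<le> norm b" for b
  proof -
    have "norm (\<Sum>j<n. b + b * u j) \<le> (\<Sum>j<n. norm b)"
      by (rule sum_norm_le) (simp add: uisom)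
    then show ?thesis
      unfolding avg using n by (simp add: field_simps)
  qed
  have "2 * norm (k - k * e) = norm ((k + k) - (k + k) * e)"
    using norm_scaleR[of 2 "k - k * e"] by (simp add: scaleR_2 algebra_simps)
  also have "\<dots> = norm (u n - k * u n) / n"
    unfolding avg sums by simp
  also have "\<dots> \<le> 4 / n"
  proof (rule divide_right_mono)
    have "norm (k * u n) \<le> 1 * 2"
      by (rule order.trans[OF norm_mult_ineq mult_mono]) (use k u2 in auto)
    then show "norm (u n - k * u n) \<le> 4"
      using u2[of n] norm_triangle_ineq4[of "u n" "k * u n"] by simp
  qed simp
  finally have "norm (k - k * e) \<le> 2 / n"
    by simp
  also have "\<dots> < \<epsilon>"
    using n \<epsilon> by (simp add: field_simps)
  finally have "norm (h - h * e) < \<epsilon>"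
    using norm_scaleC[of \<i> "h - h * e"]
    by (simp add: k_def mult_scaleC_left complex_vector.scale_right_diff_distrib)
  moreover have "e \<in> J"
    unfolding e_def by (intro J'(5,6,7) uJ)
  ultimately show ?thesis
    using contr by blast
qed

text \<open>With y = (x - x e)^* x, the C*-identity and contractivity give |x - x e|^2 = |y - y e|
  \<le> |y|, and y^* = x^* x - x^* x e is small by the self-adjoint case. Placing the condition on
  \<open>star x * x\<close> lets the lemma serve for ideals before they are known to be
  self-adjoint.\<close>

lemma approximate_unit_element:
  fixes x :: "'a::cstar_algebra"
  assumes J: "closed_csubspace J" "\<And>x y. x \<in> J \<Longrightarrow> y \<in> J \<Longrightarrow> x * y \<in> J"
    and x: "star x * x \<in> J" and \<epsilon>: "\<epsilon> > 0"
  shows "\<exists>e\<in>J. norm (x - x * e) < \<epsilon> \<and> (\<forall>b. norm (b - b * e) \<le> norm b)"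
proof -
  define r where "r = 1 / (norm (star x * x) + 1)"
  have r: "r > 0" "r * norm (star x * x) < 1"
    by (auto simp: r_def divide_simps add_nonneg_pos)
  have "\<exists>e\<in>J. norm (r *\<^sub>R (star x * x) - r *\<^sub>R (star x * x) * e) < r * \<epsilon>\<^sup>2
      \<and> (\<forall>b. norm (b - b * e) \<le> norm b)"
    using r \<epsilon> x closed_csubspaceD[OF J(1)]
    by (intro approximate_unit_selfadjoint[OF J]) (auto simp: star_scaleR star_mult star_star)
  then obtain e where e: "e \<in> J" "\<And>b. norm (b - b * e) \<le> norm b"
    and "norm (r *\<^sub>R (star x * x) - r *\<^sub>R (star x * x) * e) < r * \<epsilon>\<^sup>2"
    by blast
  moreover have "norm (r *\<^sub>R (star x * x) - r *\<^sub>R (star x * x) * e) = r * norm (star x * x - star x * x * e)"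
    using r norm_scaleR[of r "star x * x - star x * x * e"] by (simp add: scaleR_right_diff_distrib)
  ultimately have close: "norm (star x * x - star x * x * e) < \<epsilon>\<^sup>2"
    using r by simp
  define y where "y = star (x - x * e) * x"
  have "(norm (x - x * e))\<^sup>2 = norm (y - y * e)"
    by (simp add: y_def right_diff_distrib mult.assoc flip: cstar_identity)
  also have "\<dots> \<le> norm (star y)"
    using e by simp
  also have "star y = star x * x - star x * x * e"
    by (simp add: y_def star_mult star_star right_diff_distrib mult.assoc)
  finally have "(norm (x - x * e))\<^sup>2 < \<epsilon>\<^sup>2"
    using close by simp
  then have "norm (x - x * e) < \<epsilon>"
    using \<epsilon> power2_less_imp_less by fastforce
  then show ?thesis
    using e by blast
qed


text \<open>This norm condition on 1 - e stands in for positivity and norm at most 1; it survives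
  the formal product (1 - e)(1 - f).\<close>

definition contractive_unit :: "'a::cstar_algebra \<Rightarrow> bool" where
  "contractive_unit e \<longleftrightarrow> (\<forall>b. norm (b - b * e) \<le> norm b)"

lemma contractive_unitD: "contractive_unit e \<Longrightarrow> norm (b - b * e) \<le> norm b"
  by (simp add: contractive_unit_def)

lemma norm_contractive_unit:
  assumes "contractive_unit e"
  shows "norm e \<le> 2"
proof (cases "e = 0")
  case False
  have "norm (star e * e) \<le> norm (star e) + norm (star e - star e * e)"
    using norm_triangle_ineq4[of "star e" "star e - star e * e"] by simp
  then have "norm e * norm e \<le> 2 * norm e"
    using contractive_unitD[OF assms, of "star e"] by (simp add: cstar_identity power2_eq_square)
  then show ?thesis
    using False by simp
qed simp

text \<open>A filter in place of a net, so that the limit calculus applies directly. The elements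
  act from the right; limits on the left use \<open>star e\<close>.\<close>

definition approx_unit :: "'a::cstar_algebra set \<Rightarrow> 'a filter" where
  "approx_unit J = (INF (x, \<epsilon>)\<in>J \<times> {0<..}.
     principal {e\<in>J. contractive_unit e \<and> norm (x - x * e) < \<epsilon>})"

text \<open>Since 1 - (e + f - e f) = (1 - e)(1 - f), one chooses f for the remainder x - x e of the
  new element; contractivity of 1 - f keeps the estimates already reached on
  \<open>F\<close>.\<close>

lemma approximate_unit_finite:
  assumes J: "cstar_subalgebra J" and \<epsilon>: "\<epsilon> > 0" and F: "finite F" "F \<subseteq> J"
  shows "\<exists>e\<in>J. contractive_unit e \<and> (\<forall>x\<in>F. norm (x - x * e) < \<epsilon>)"
  using F
proof (induction F)
  case empty
  show ?case
    using cstar_subalgebraD(1)[OF J] by (intro bexI[of _ 0]) (auto simp: contractive_unit_def closed_csubspaceD)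
next
  case (insert x F)
  note J' = cstar_subalgebraD[OF J] closed_csubspaceD[OF cstar_subalgebraD(1)[OF J]]
  obtain e where e: "e \<in> J" "contractive_unit e" "\<And>z. z \<in> F \<Longrightarrow> norm (z - z * e) < \<epsilon>"
    using insert by auto
  have y: "x - x * e \<in> J"
    using insert e J' by simp
  then obtain f where f: "f \<in> J" "contractive_unit f" "norm ((x - x * e) - (x - x * e) * f) < \<epsilon>"
    using approximate_unit_element[OF J'(1,2), of "x - x * e" \<epsilon>] J'(2,3) \<epsilon>
    unfolding contractive_unit_def by blast
  have eq: "z - z * (e + f - e * f) = (z - z * e) - (z - z * e) * f" for z
    by (simp add: algebra_simps)
  have "contractive_unit (e + f - e * f)"
    unfolding contractive_unit_def eq
    using contractive_unitD[OF f(2)] contractive_unitD[OF e(2)] order.trans by blast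
  moreover have "norm (z - z * (e + f - e * f)) < \<epsilon>" if "z \<in> insert x F" for z
    unfolding eq using that f(3) e(3)[of z] contractive_unitD[OF f(2), of "z - z * e"] by fastforce
  moreover have "e + f - e * f \<in> J"
    using e f J' by simp
  ultimately show ?case
    by blast
qed

lemma approx_unit_not_bot:
  assumes J: "cstar_subalgebra J"
  shows "approx_unit J \<noteq> bot"
  unfolding approx_unit_def
proof (rule INF_filter_not_bot)
  fix X assume X: "X \<subseteq> J \<times> {0<..}" "finite (X :: ('a \<times> real) set)"
  define \<epsilon> where "\<epsilon> = Min (insert 1 (snd ` X))"
  have "\<epsilon> > 0"
    using X by (auto simp: \<epsilon>_def)
  moreover have "\<epsilon> \<le> snd p" if "p \<in> X" for p
    using X that by (auto simp: \<epsilon>_def)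
  moreover have "finite (fst ` X)" "fst ` X \<subseteq> J"
    using X by auto
  then obtain e where "e \<in> J" "contractive_unit e" "\<forall>x\<in>fst ` X. norm (x - x * e) < \<epsilon>"
    using approximate_unit_finite[OF J \<open>\<epsilon> > 0\<close>] by blast
  ultimately have "e \<in> (\<Inter>p\<in>X. {e\<in>J. contractive_unit e \<and> norm (fst p - fst p * e) < snd p})"
    by fastforce
  then show "(INF p\<in>X. case p of (x, \<epsilon>) \<Rightarrow>
      principal {e\<in>J. contractive_unit e \<and> norm (x - x * e) < \<epsilon>}) \<noteq> bot"
    using X(2) by (auto simp: case_prod_beta INF_principal_finite principal_eq_bot_iff)
qed

lemma eventually_approx_unit:
  assumes "x \<in> J" "\<epsilon> > 0"
  shows "eventually (\<lambda>e. e \<in> J \<and> contractive_unit e \<and> norm (x - x * e) < \<epsilon>) (approx_unit J)"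
  unfolding approx_unit_def
  by (rule eventually_INF1[of "(x, \<epsilon>)"]) (use assms in \<open>auto simp: eventually_principal\<close>)

lemma eventually_approx_unit_mem:
  assumes "cstar_subalgebra J"
  shows "eventually (\<lambda>e. e \<in> J \<and> contractive_unit e) (approx_unit J)"
  using eventually_approx_unit[of 0 J 1] closed_csubspaceD(1)[OF cstar_subalgebraD(1)[OF assms]]
  by (simp add: eventually_mono)

text \<open>Convergence is clear on products c j. Contractivity is uniform in e, so the elements for
  which it holds form a closed subspace.\<close>

lemma tendsto_approx_unit:
  assumes J: "cstar_subalgebra J" and b: "b \<in> UNIV \<cdot> J"
  shows "((\<lambda>e. b * e) \<longlongrightarrow> b) (approx_unit J)"
proof -
  let ?S = "{b. ((\<lambda>e. b - b * e) \<longlongrightarrow> 0) (approx_unit J)}"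
  have tends: "((\<lambda>e. b - b * e) \<longlongrightarrow> 0) (approx_unit J) \<longleftrightarrow>
      (\<forall>\<epsilon>>0. eventually (\<lambda>e. norm (b - b * e) < \<epsilon>) (approx_unit J))" for b :: 'a
    by (simp add: tendsto_iff dist_norm)
  have "closed_csubspace ?S"
  proof (rule closed_csubspaceI)
    fix s l assume s: "\<And>n::nat. s n \<in> ?S" "s \<longlonglongrightarrow> l"
    have "eventually (\<lambda>e. norm (l - l * e) < \<epsilon>) (approx_unit J)" if \<epsilon>: "\<epsilon> > 0" for \<epsilon>
    proof -
      obtain n where n: "norm (l - s n) < \<epsilon> / 2"
        using s(2) half_gt_zero[OF \<epsilon>]
        by (metis LIMSEQ_iff norm_minus_commute order_refl)
      have "eventually (\<lambda>e. norm (s n - s n * e) < \<epsilon> / 2) (approx_unit J)"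
        using s(1)[of n] half_gt_zero[OF \<epsilon>] unfolding mem_Collect_eq tends by blast
      then show ?thesis
        using eventually_approx_unit_mem[OF J]
      proof eventually_elim
        case (elim e)
        have "norm (l - l * e) \<le> norm ((l - s n) - (l - s n) * e) + norm (s n - s n * e)"
          by (rule order.trans[OF _ norm_triangle_ineq]) (simp add: algebra_simps)
        moreover have "norm ((l - s n) - (l - s n) * e) \<le> norm (l - s n)"
          using elim contractive_unitD by blast
        ultimately show ?case
          using elim n by simp
      qed
    qed
    then show "l \<in> ?S"
      using tends by simp
  next
    fix x y assume "x \<in> ?S" "y \<in> ?S"
    then show "x + y \<in> ?S"
      using tendsto_add_zero[of "\<lambda>e. x - x * e" _ "\<lambda>e. y - y * e"] by (simp add: algebra_simps)
  next
    fix c x assume "x \<in> ?S"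
    then show "c *\<^sub>C x \<in> ?S"
      using tendsto_scaleC[of "\<lambda>e. x - x * e" 0 _ c]
      by (simp add: complex_vector.scale_right_diff_distrib mult_scaleC_left)
  qed simp
  moreover have "c * j \<in> ?S" if "j \<in> J" for c j
  proof -
    have "((\<lambda>e. j - j * e) \<longlongrightarrow> 0) (approx_unit J)"
      unfolding tends
    proof (intro allI impI)
      fix \<epsilon> :: real assume "\<epsilon> > 0"
      from eventually_approx_unit[OF that this]
      show "eventually (\<lambda>e. norm (j - j * e) < \<epsilon>) (approx_unit J)"
        by (rule eventually_mono) blast
    qed
    then show ?thesis
      using tendsto_mult_right_zero[of "\<lambda>e. j - j * e" _ c] by (simp add: algebra_simps)
  qed
  ultimately have "UNIV \<cdot> J \<subseteq> ?S"
    by (rule subspace_prod_least)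
  then have "((\<lambda>e. b - b * e) \<longlongrightarrow> 0) (approx_unit J)"
    using b by blast
  from tendsto_diff[OF tendsto_const[of b] this] show ?thesis
    by simp
qed

lemma tendsto_approx_unit_left:
  assumes J: "cstar_subalgebra J" and b: "b \<in> J \<cdot> UNIV"
  shows "((\<lambda>e. star e * b) \<longlongrightarrow> b) (approx_unit J)"
proof -
  have "star b \<in> UNIV \<cdot> J"
    using star_subspace_prod[OF b] cstar_subalgebraD(4)[OF J] by (simp add: cstar_subalgebraD(4))
  from tendsto_star[OF tendsto_approx_unit[OF J this]] show ?thesis
    by (simp add: star_mult star_star)
qed

text \<open>x is a limit of products x e. For a slice M with M^* M = I this places M inside B I,
  where the approximate unit of I acts.\<close>

lemma mem_subspace_prod_UNIV:
  fixes x :: "'a::cstar_algebra"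
  assumes J: "closed_csubspace J" "\<And>x y. x \<in> J \<Longrightarrow> y \<in> J \<Longrightarrow> x * y \<in> J" and x: "star x * x \<in> J"
  shows "x \<in> UNIV \<cdot> J"
proof -
  have "\<exists>y\<in>UNIV \<cdot> J. dist y x < \<epsilon>" if "\<epsilon> > 0" for \<epsilon>
    using approximate_unit_element[OF J x that] subspace_prodI[of x UNIV _ J]
    by (auto simp: dist_norm norm_minus_commute)
  then show ?thesis
    using closed_csubspaceD(8)[OF closed_csubspace_prod] closed_approachable by blast
qed

lemma cstar_subalgebra_UNIV_prod:
  assumes "cstar_subalgebra J" "star x * x \<in> J"
  shows "x \<in> UNIV \<cdot> J"
  using assms mem_subspace_prod_UNIV cstar_subalgebraD by blast

lemma eq_0_if_mult_right:
  assumes J: "cstar_subalgebra J" and y: "y \<in> UNIV \<cdot> J" "\<And>e. e \<in> J \<Longrightarrow> y * e = 0"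
  shows "y = 0"
proof -
  have "((\<lambda>e. y * e) \<longlongrightarrow> 0) (approx_unit J)"
    by (rule tendsto_eventually)
      (use eventually_approx_unit_mem[OF J] y(2) in \<open>auto elim: eventually_mono\<close>)
  then show ?thesis
    using tendsto_unique[OF approx_unit_not_bot[OF J] tendsto_approx_unit[OF J y(1)]] by blast
qed

lemma eq_0_if_mult_left:
  assumes J: "cstar_subalgebra J" and y: "y \<in> J \<cdot> UNIV" "\<And>e. e \<in> J \<Longrightarrow> e * y = 0"
  shows "y = 0"
proof -
  have "star y \<in> UNIV \<cdot> J"
    using star_subspace_prod[OF y(1)] cstar_subalgebraD(4)[OF J] by (simp add: cstar_subalgebraD(4))
  moreover have "star y * e = 0" if "e \<in> J" for e
    using y(2)[of "star e"] that cstar_subalgebraD(3)[OF J] by (metis star_mult star_star star_zero)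
  ultimately have "star y = 0"
    using eq_0_if_mult_right[OF J] by blast
  then show ?thesis
    by (simp add: star_eq_iff)
qed

text \<open>The classical fact that closed ideals are self-adjoint. The approximate unit is taken
  from \<open>J\<close>, the intersection of I and I^*, which contains x^* x for every x in
  I.\<close>

lemma closed_ideal_subalgebra:
  assumes A: "cstar_subalgebra A" and I: "closed_ideal A I"
  shows "cstar_subalgebra I"
proof -
  have I': "closed_csubspace I" "I \<subseteq> A" "\<And>a x. a \<in> A \<Longrightarrow> x \<in> I \<Longrightarrow> a * x \<in> I"
      "\<And>a x. a \<in> A \<Longrightarrow> x \<in> I \<Longrightarrow> x * a \<in> I"
    using I by (auto simp: closed_ideal_def)
  note A' = cstar_subalgebraD[OF A]
  define J where "J = I \<inter> {z. star z \<in> I}"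
  have J: "closed_csubspace J" "\<And>x y. x \<in> J \<Longrightarrow> y \<in> J \<Longrightarrow> x * y \<in> J"
    using I' by (auto simp: J_def star_mult intro!: closed_csubspace_Int closed_csubspace_vimage_star)
  have "star x \<in> I" if x: "x \<in> I" for x
  proof -
    have xx: "star x * x \<in> J"
      using x I' A' by (auto simp: J_def star_mult star_star)
    have "\<exists>y\<in>I. dist y (star x) < \<epsilon>" if \<epsilon>: "\<epsilon> > 0" for \<epsilon>
    proof -
      obtain e where e: "e \<in> J" "norm (x - x * e) < \<epsilon>"
        using approximate_unit_element[OF J xx \<epsilon>] by blast
      \<comment> \<open>Here \<open>star e\<close> is in I because e is in \<open>J\<close>, while
        \<open>star x\<close> is so far only known to be in A.\<close>
      have "star e * star x \<in> I"
        using e x I' A' by (auto simp: J_def)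
      moreover have "dist (star e * star x) (star x) = norm (x - x * e)"
        by (metis dist_norm norm_minus_commute norm_star star_diff star_mult)
      ultimately show ?thesis
        using e(2) by (intro bexI[of _ "star e * star x"]) auto
    qed
    then show ?thesis
      using closed_csubspaceD(8)[OF I'(1)] closed_approachable by blast
  qed
  then show ?thesis
    using I' by (auto simp: cstar_subalgebra_def)
qed


section \<open>Cohen factorisation\<close>

text \<open>The factor \<open>a\<close> is the limit of the invertible elements \<open>2\<^sup>-\<^sup>k + c\<^sub>k = 1 - (\<Sum>j\<le>k. 2\<^sup>-\<^sup>j (1 - e\<^sub>j))\<close>
  of the unitisation, with \<open>e\<^sub>j\<close> taken from the approximate unit.\<close>

definition cohen_state :: "'a::cstar_algebra set \<Rightarrow> (nat \<Rightarrow> 'a) \<Rightarrow> nat \<Rightarrow> 'a \<Rightarrow> (nat \<Rightarrow> 'a) \<Rightarrow> bool" where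
  "cohen_state J x k c z \<longleftrightarrow> c \<in> J \<and> (\<forall>n. z n \<in> J) \<and> z \<longlonglongrightarrow> 0 \<and>
     (\<forall>n. x n = (1/2)^k *\<^sub>R z n + z n * c) \<and>
     (\<forall>b. norm (b - ((1/2)^k *\<^sub>R b + b * c)) \<le> (1 - (1/2)^k) * norm b)"

text \<open>Write a for the current approximant 2^-k + c and a' = a - t (1 - e) for the next one. As
  1 - a has norm at most 1 - 2 t as a right multiplication, 1 - a' has norm at most 1 - t, so a' can
  be inverted and z' = x a'^-1 exists.\<close>

lemma cohen_step:
  fixes c :: "'a::cstar_algebra"
  assumes J: "cstar_subalgebra J" and x: "x \<longlonglongrightarrow> 0" "\<And>n. x n \<in> J"
    and state: "cohen_state J x k c z"
  shows "\<exists>c' z'. cohen_state J x (Suc k) c' z' \<and> norm (c' - c) \<le> 2 * (1/2)^k \<and>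
    (\<forall>n. norm (z' n - z n) \<le> (1/2)^k)"
proof -
  note J' = cstar_subalgebraD[OF J] closed_csubspaceD[OF cstar_subalgebraD(1)[OF J]]
  define t :: real where "t = (1/2)^Suc k"
  have t: "0 < t" "t \<le> 1/2" "(1/2)^k = t + t"
    by (simp_all add: t_def power_le_one)
  have s: "c \<in> J" "\<And>n. z n \<in> J" "z \<longlonglongrightarrow> 0" "\<And>n. x n = (t + t) *\<^sub>R z n + z n * c"
      "\<And>b. norm (b - ((t + t) *\<^sub>R b + b * c)) \<le> (1 - (t + t)) * norm b"
    using state t(3) unfolding cohen_state_def by auto
  obtain N where N: "\<And>n. n \<ge> N \<Longrightarrow> norm (z n) \<le> t + t"
    using s(3) t unfolding LIMSEQ_iff by (metis add_pos_pos diff_zero less_imp_le)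
  \<comment> \<open>Finitely many terms are handled by the choice of e and the remaining ones, being
    small, by contractivity; one e thus serves the whole sequence.\<close>
  obtain e where e: "e \<in> J" "contractive_unit e" "\<forall>y\<in>z ` {..<N}. norm (y - y * e) < t + t"
    using approximate_unit_finite[OF J, of "t + t" "z ` {..<N}"] s(2) t by auto
  have ze: "norm (z n - z n * e) \<le> t + t" for n
    using e(3) N[of n] contractive_unitD[OF e(2), of "z n"] by (cases "n < N") (auto intro: less_imp_le)
  define c' where "c' = c + t *\<^sub>R e"
  have c': "c' \<in> J"
    using s e J' by (simp add: c'_def)
  \<comment> \<open>Right multiplication by 1 - a'; a fixed point of z = x + T z solves z a' =
    x.\<close>
  define T where "T b = b - (t *\<^sub>R b + b * c')" for b
  have T_diff: "T b - T d = T (b - d)" for b d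
    by (simp add: T_def algebra_simps)
  have T_eq: "T b = (b - ((t + t) *\<^sub>R b + b * c)) + t *\<^sub>R (b - b * e)" for b
    unfolding T_def c'_def scaleR_add_left by (simp add: algebra_simps)
  have T_norm: "norm (T b) \<le> (1 - t) * norm b" for b
  proof -
    have "norm (T b) \<le> (1 - (t + t)) * norm b + t * norm b"
      unfolding T_eq using t(1)
      by (intro order.trans[OF norm_triangle_ineq add_mono[OF s(5)]]) (simp add: contractive_unitD[OF e(2)])
    then show ?thesis
      by (simp add: algebra_simps)
  qed
  have "\<exists>y\<in>J. y = x n + T y" for n
  proof (rule contraction_solve[where r = "1 - t"])
    show "T b \<in> J" if "b \<in> J" for b
      using that c' J' by (simp add: T_def)
  qed (use T_norm t x(2) J'(1) in \<open>auto simp: T_diff\<close>)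
  then obtain z' where z': "\<And>n. z' n \<in> J" "\<And>n. z' n = x n + T (z' n)"
    by metis
  have inv: "t * norm b \<le> norm (b - T b)" for b
    using T_norm[of b] norm_triangle_ineq2[of b "T b"] by (simp add: algebra_simps)
  have "norm (z' n - z n) \<le> t + t" for n
  proof -
    \<comment> \<open>The left side is (z' - z) a' = z a - z a' because z' a' = x = z a, and a - a'
      = t (1 - e).\<close>
    have "(z' n - z n) - T (z' n - z n) = t *\<^sub>R (z n - z n * e)"
    proof -
      have "(z' n - z n) - T (z' n - z n) = (z' n - T (z' n)) - (z n - T (z n))"
        by (simp flip: T_diff)
      also have "z' n - T (z' n) = (t + t) *\<^sub>R z n + z n * c"
        using z'(2)[of n] s(4)[of n] by (metis add_diff_cancel_right')
      finally show ?thesis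
        by (simp add: T_eq)
    qed
    then have "t * norm (z' n - z n) \<le> t * (t + t)"
      using inv[of "z' n - z n"] ze[of n] t(1) by (auto elim!: order.trans)
    then show ?thesis
      using t(1) by simp
  qed
  moreover have "norm (c' - c) \<le> 2 * (t + t)"
    using norm_contractive_unit[OF e(2)] t(1) by (simp add: c'_def)
  moreover have "z' \<longlonglongrightarrow> 0"
  proof (rule Lim_null_comparison)
    show "eventually (\<lambda>n. norm (z' n) \<le> (1 / t) * norm (x n)) sequentially"
      using inv[of "z' _"] z'(2) t(1) by (intro always_eventually) (simp add: field_simps, metis add_diff_cancel_right')
    show "(\<lambda>n. (1 / t) * norm (x n)) \<longlonglongrightarrow> 0"
      by (rule tendsto_mult_right_zero[OF tendsto_norm_zero[OF x(1)]])
  qed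
  moreover have "x n = t *\<^sub>R z' n + z' n * c'" for n
    using z'(2)[of n] unfolding T_def by (simp add: algebra_simps)
  ultimately have "cohen_state J x (Suc k) c' z'"
    unfolding cohen_state_def t_def[symmetric] using c' z'(1) T_norm[unfolded T_def] by blast
  then show ?thesis
    using \<open>norm (c' - c) \<le> 2 * (t + t)\<close> \<open>\<And>n. norm (z' n - z n) \<le> t + t\<close> unfolding t(3) by blast
qed

lemma Cauchy_geometric_steps:
  fixes s :: "nat \<Rightarrow> 'a::banach"
  assumes "\<And>k. norm (s (Suc k) - s k) \<le> C * (1/2)^k"
  shows "convergent s" "norm (lim s - s 0) \<le> 2 * C"
proof -
  have sumC: "summable (\<lambda>k. C * (1/2::real)^k)" "suminf (\<lambda>k. C * (1/2::real)^k) = 2 * C"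
    by (simp_all add: suminf_mult suminf_geometric summable_geometric)
  have summ: "summable (\<lambda>k. s (Suc k) - s k)"
    by (rule summable_comparison_test'[OF sumC(1)]) (use assms in auto)
  have tel: "(\<Sum>k<n. s (Suc k) - s k) = s n - s 0" for n
    by (rule sum_lessThan_telescope)
  have "(\<lambda>n. s n - s 0) \<longlonglongrightarrow> suminf (\<lambda>k. s (Suc k) - s k)"
    using summable_LIMSEQ[OF summ] unfolding tel .
  then have lim: "s \<longlonglongrightarrow> suminf (\<lambda>k. s (Suc k) - s k) + s 0"
    using tendsto_add[OF _ tendsto_const[of "s 0"]] by fastforce
  then show "convergent s"
    by (auto simp: convergent_def)
  have "norm (suminf (\<lambda>k. s (Suc k) - s k)) \<le> suminf (\<lambda>k. C * (1/2::real)^k)"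
    by (rule norm_suminf_le[OF assms sumC(1)])
  then show "norm (lim s - s 0) \<le> 2 * C"
    using limI[OF lim] sumC(2) by simp
qed

text \<open>The steps are summable, so c and z converge while the scalar part 2^-k dies out. One
  factor \<open>a\<close> for a whole null sequence, with bounded cofactors, is what makes virtual
  commutants automatically continuous.\<close>

theorem cohen_factorisation:
  fixes x :: "nat \<Rightarrow> 'a::cstar_algebra"
  assumes J: "cstar_subalgebra J" and x: "x \<longlonglongrightarrow> 0" "\<And>n. x n \<in> J"
  shows "\<exists>a y. a \<in> J \<and> (\<forall>n. y n \<in> J \<and> x n = y n * a) \<and> (\<exists>K. \<forall>n. norm (y n) \<le> K)"
proof -
  note J' = cstar_subalgebraD[OF J] closed_csubspaceD[OF cstar_subalgebraD(1)[OF J]]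
  have "\<exists>f. \<forall>k. cohen_state J x k (fst (f k)) (snd (f k)) \<and>
      (norm (fst (f (Suc k)) - fst (f k)) \<le> 2 * (1/2)^k \<and>
       (\<forall>n. norm (snd (f (Suc k)) n - snd (f k) n) \<le> (1/2)^k))"
  proof (rule dependent_nat_choice)
    have "cohen_state J x 0 0 x"
      using x J' by (simp add: cohen_state_def)
    then show "\<exists>p. cohen_state J x 0 (fst p) (snd p)"
      by (metis fst_conv snd_conv)
  next
    fix p k assume "cohen_state J x k (fst p) (snd p)"
    from cohen_step[OF J x this]
    show "\<exists>q. cohen_state J x (Suc k) (fst q) (snd q) \<and> (norm (fst q - fst p) \<le> 2 * (1/2)^k \<and>
        (\<forall>n. norm (snd q n - snd p n) \<le> (1/2)^k))"
      by (metis fst_conv snd_conv)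
  qed
  then obtain f where f: "\<And>k. cohen_state J x k (fst (f k)) (snd (f k))"
      "\<And>k. norm (fst (f (Suc k)) - fst (f k)) \<le> 2 * (1/2)^k"
      "\<And>k n. norm (snd (f (Suc k)) n - snd (f k) n) \<le> (1/2)^k"
    by blast
  define a where "a = lim (\<lambda>k. fst (f k))"
  have a: "(\<lambda>k. fst (f k)) \<longlonglongrightarrow> a"
    unfolding a_def by (rule convergent_LIMSEQ_iff[THEN iffD1, OF Cauchy_geometric_steps(1)[OF f(2)]])
  define y where "y n = lim (\<lambda>k. snd (f k) n)" for n
  have step1: "norm (snd (f (Suc k)) n - snd (f k) n) \<le> 1 * (1/2)^k" for k n
    using f(3) by simp
  have y: "(\<lambda>k. snd (f k) n) \<longlonglongrightarrow> y n" for n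
    unfolding y_def
    by (rule convergent_LIMSEQ_iff[THEN iffD1, OF Cauchy_geometric_steps(1)[OF step1]])
  have yb: "norm (y n - snd (f 0) n) \<le> 2" for n
    using Cauchy_geometric_steps(2)[of "\<lambda>k. snd (f k) n", OF step1] unfolding y_def by simp
  have "a \<in> J"
    by (rule closed_sequentially[OF J'(12) _ a]) (use f(1) in \<open>simp add: cohen_state_def\<close>)
  moreover have "y n \<in> J" for n
    by (rule closed_sequentially[OF J'(12) _ y]) (use f(1) in \<open>simp add: cohen_state_def\<close>)
  moreover have "x n = y n * a" for n
  proof -
    have "(\<lambda>k. (1/2)^k *\<^sub>R snd (f k) n + snd (f k) n * fst (f k)) \<longlonglongrightarrow> 0 *\<^sub>R y n + y n * a"
      by (intro tendsto_intros y a) (simp add: LIMSEQ_power_zero)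
    moreover have "(1/2)^k *\<^sub>R snd (f k) n + snd (f k) n * fst (f k) = x n" for k
      using f(1)[of k] unfolding cohen_state_def by metis
    ultimately show ?thesis
      by (simp add: LIMSEQ_const_iff)
  qed
  moreover have "snd (f 0) \<longlonglongrightarrow> 0"
    using f(1)[of 0] by (simp add: cohen_state_def)
  then have "Bseq (snd (f 0))"
    by (rule convergent_imp_Bseq[OF convergentI])
  then obtain K where K: "\<And>n. norm (snd (f 0) n) \<le> K"
    by (rule BseqE) blast
  then have "norm (y n) \<le> 2 + K" for n
    using yb[of n] norm_triangle_sub[of "y n" "snd (f 0) n"] K[of n] by linarith
  ultimately show ?thesis
    by blast
qed

lemma cohen_factor:
  assumes J: "cstar_subalgebra J" and x: "x \<in> J"
  obtains y a where "y \<in> J" "a \<in> J" "x = y * a"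
proof -
  have "(\<lambda>n. if n = 0 then x else 0) \<longlonglongrightarrow> 0"
    by (rule tendsto_eventually) (auto simp: eventually_sequentially intro!: exI[of _ 1])
  moreover have "\<And>n. (if n = 0 then x else 0) \<in> J"
    using x closed_csubspaceD(1)[OF cstar_subalgebraD(1)[OF J]] by simp
  ultimately obtain a y where "a \<in> J" "\<forall>n::nat. y n \<in> J \<and> (if n = 0 then x else 0) = y n * a"
    using cohen_factorisation[OF J, of "\<lambda>n. if n = 0 then x else 0"] by blast
  then show ?thesis
    using that[of "y 0" a] by (metis (full_types))
qed


section \<open>Isomorphisms of Hilbert bimodules\<close>

text \<open>The record carries no axioms. Inverting an isomorphism requires the results of the
  operations to stay in the carrier, where the inverse map undoes it.\<close>

definition hilbert_bimod_closed :: "'a set \<Rightarrow> ('a, 'e) hilbert_bimod \<Rightarrow> bool" where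
  "hilbert_bimod_closed A E \<longleftrightarrow>
     (\<forall>x\<in>hcarrier E. \<forall>y\<in>hcarrier E. hadd E x y \<in> hcarrier E) \<and>
     (\<forall>c. \<forall>x\<in>hcarrier E. hscale E c x \<in> hcarrier E) \<and>
     (\<forall>a\<in>A. \<forall>x\<in>hcarrier E. lact E a x \<in> hcarrier E \<and> ract E x a \<in> hcarrier E)"

lemma hilbert_bimod_iso_trans:
  assumes "hilbert_bimod_iso A E F" "hilbert_bimod_iso A F G"
  shows "hilbert_bimod_iso A E G"
proof -
  obtain U where U: "bij_betw U (hcarrier E) (hcarrier F)"
    "\<And>x y. x \<in> hcarrier E \<Longrightarrow> y \<in> hcarrier E \<Longrightarrow> U (hadd E x y) = hadd F (U x) (U y)"
    "\<And>c x. x \<in> hcarrier E \<Longrightarrow> U (hscale E c x) = hscale F c (U x)"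
    "\<And>a x. a \<in> A \<Longrightarrow> x \<in> hcarrier E \<Longrightarrow> U (lact E a x) = lact F a (U x) \<and> U (ract E x a) = ract F (U x) a"
    "\<And>x y. x \<in> hcarrier E \<Longrightarrow> y \<in> hcarrier E \<Longrightarrow>
       lip F (U x) (U y) = lip E x y \<and> rip F (U x) (U y) = rip E x y"
    using assms(1) unfolding hilbert_bimod_iso_def by blast
  obtain V where V: "bij_betw V (hcarrier F) (hcarrier G)"
    "\<And>x y. x \<in> hcarrier F \<Longrightarrow> y \<in> hcarrier F \<Longrightarrow> V (hadd F x y) = hadd G (V x) (V y)"
    "\<And>c x. x \<in> hcarrier F \<Longrightarrow> V (hscale F c x) = hscale G c (V x)"
    "\<And>a x. a \<in> A \<Longrightarrow> x \<in> hcarrier F \<Longrightarrow> V (lact F a x) = lact G a (V x) \<and> V (ract F x a) = ract G (V x) a"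
    "\<And>x y. x \<in> hcarrier F \<Longrightarrow> y \<in> hcarrier F \<Longrightarrow>
       lip G (V x) (V y) = lip F x y \<and> rip G (V x) (V y) = rip F x y"
    using assms(2) unfolding hilbert_bimod_iso_def by blast
  have UF: "U x \<in> hcarrier F" if "x \<in> hcarrier E" for x
    using U(1) that bij_betwE by blast
  have "bij_betw (V \<circ> U) (hcarrier E) (hcarrier G)"
    using U(1) V(1) by (rule bij_betw_trans)
  then show ?thesis
    unfolding hilbert_bimod_iso_def
    by (intro exI[of _ "V \<circ> U"]) (simp add: U(2-5) V(2-5) UF)
qed

lemma hilbert_bimod_iso_sym:
  assumes "hilbert_bimod_iso A E F" "hilbert_bimod_closed A E"
  shows "hilbert_bimod_iso A F E"
proof -
  obtain U where U: "bij_betw U (hcarrier E) (hcarrier F)"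
    "\<And>x y. x \<in> hcarrier E \<Longrightarrow> y \<in> hcarrier E \<Longrightarrow> U (hadd E x y) = hadd F (U x) (U y)"
    "\<And>c x. x \<in> hcarrier E \<Longrightarrow> U (hscale E c x) = hscale F c (U x)"
    "\<And>a x. a \<in> A \<Longrightarrow> x \<in> hcarrier E \<Longrightarrow> U (lact E a x) = lact F a (U x) \<and> U (ract E x a) = ract F (U x) a"
    "\<And>x y. x \<in> hcarrier E \<Longrightarrow> y \<in> hcarrier E \<Longrightarrow>
       lip F (U x) (U y) = lip E x y \<and> rip F (U x) (U y) = rip E x y"
    using assms(1) unfolding hilbert_bimod_iso_def by blast
  define W where "W = inv_into (hcarrier E) U"
  have W: "bij_betw W (hcarrier F) (hcarrier E)"
    unfolding W_def using U(1) by (rule bij_betw_inv_into)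
  have WE: "W p \<in> hcarrier E" and UW: "U (W p) = p" if "p \<in> hcarrier F" for p
    using that W bij_betwE U(1) by (blast, simp add: W_def bij_betw_inv_into_right)
  have WU: "W (U x) = x" if "x \<in> hcarrier E" for x
    using that U(1) by (simp add: W_def bij_betw_inv_into_left)
  have cl: "\<And>x y. x \<in> hcarrier E \<Longrightarrow> y \<in> hcarrier E \<Longrightarrow> hadd E x y \<in> hcarrier E"
     "\<And>c x. x \<in> hcarrier E \<Longrightarrow> hscale E c x \<in> hcarrier E"
     "\<And>a x. a \<in> A \<Longrightarrow> x \<in> hcarrier E \<Longrightarrow> lact E a x \<in> hcarrier E"
     "\<And>a x. a \<in> A \<Longrightarrow> x \<in> hcarrier E \<Longrightarrow> ract E x a \<in> hcarrier E"
    using assms(2) by (auto simp: hilbert_bimod_closed_def)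
  have "W (hadd F p q) = hadd E (W p) (W q)" if "p \<in> hcarrier F" "q \<in> hcarrier F" for p q
    using WU[OF cl(1)[OF WE[OF that(1)] WE[OF that(2)]]] that by (simp add: U WE UW)
  moreover have "W (hscale F c p) = hscale E c (W p)" if "p \<in> hcarrier F" for p c
    using WU[OF cl(2)[OF WE[OF that(1)]]] that by (simp add: U WE UW)
  moreover have "W (lact F a p) = lact E a (W p)" "W (ract F p a) = ract E (W p) a"
    if "p \<in> hcarrier F" "a \<in> A" for p a
    using WU[OF cl(3)[OF that(2) WE[OF that(1)]]] WU[OF cl(4)[OF that(2) WE[OF that(1)]]] that
    by (simp_all add: U WE UW)
  moreover have "lip E (W p) (W q) = lip F p q" "rip E (W p) (W q) = rip F p q"
    if "p \<in> hcarrier F" "q \<in> hcarrier F" for p q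
    using U(5)[OF WE[OF that(1)] WE[OF that(2)]] that by (simp_all add: UW)
  ultimately show ?thesis
    unfolding hilbert_bimod_iso_def using W by blast
qed

lemma slice_bimod_simps [simp]:
  "hcarrier (slice_bimod M) = M" "hadd (slice_bimod M) = (+)" "hscale (slice_bimod M) = scaleC"
  "lact (slice_bimod M) = (*)" "ract (slice_bimod M) = (*)"
  "lip (slice_bimod M) = (\<lambda>x y. x * star y)" "rip (slice_bimod M) = (\<lambda>x y. star x * y)"
  by (simp_all add: slice_bimod_def)

lemma hilbert_bimod_closed_slice:
  assumes "closed_csubspace M" "\<And>a x. a \<in> A \<Longrightarrow> x \<in> M \<Longrightarrow> a * x \<in> M \<and> x * a \<in> M"
  shows "hilbert_bimod_closed A (slice_bimod M)"
  using assms by (auto simp: hilbert_bimod_closed_def closed_csubspaceD)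

lemma slice_bimod_isoE:
  assumes "hilbert_bimod_iso A (slice_bimod M) (slice_bimod N)"
  obtains U where "bij_betw U M N"
    "\<And>x y. x \<in> M \<Longrightarrow> y \<in> M \<Longrightarrow> U (x + y) = U x + U y" "\<And>c x. x \<in> M \<Longrightarrow> U (c *\<^sub>C x) = c *\<^sub>C U x"
    "\<And>a x. a \<in> A \<Longrightarrow> x \<in> M \<Longrightarrow> U (a * x) = a * U x"
    "\<And>a x. a \<in> A \<Longrightarrow> x \<in> M \<Longrightarrow> U (x * a) = U x * a"
    "\<And>x y. x \<in> M \<Longrightarrow> y \<in> M \<Longrightarrow> U x * star (U y) = x * star y"
    "\<And>x y. x \<in> M \<Longrightarrow> y \<in> M \<Longrightarrow> star (U x) * U y = star x * y"
proof -
  obtain U where "bij_betw U M N" "\<forall>x\<in>M. \<forall>y\<in>M. U (x + y) = U x + U y"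
    "\<forall>c. \<forall>x\<in>M. U (c *\<^sub>C x) = c *\<^sub>C U x"
    "\<forall>a\<in>A. \<forall>x\<in>M. U (a * x) = a * U x \<and> U (x * a) = U x * a"
    "\<forall>x\<in>M. \<forall>y\<in>M. U x * star (U y) = x * star y \<and> star (U x) * U y = star x * y"
    using assms unfolding hilbert_bimod_iso_def slice_bimod_simps by blast
  then show ?thesis
    by (intro that[of U]) auto
qed

lemma slice_bimod_isoI:
  assumes "bij_betw U M N"
    "\<And>x y. x \<in> M \<Longrightarrow> y \<in> M \<Longrightarrow> U (x + y) = U x + U y" "\<And>c x. x \<in> M \<Longrightarrow> U (c *\<^sub>C x) = c *\<^sub>C U x"
    "\<And>a x. a \<in> A \<Longrightarrow> x \<in> M \<Longrightarrow> U (a * x) = a * U x"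
    "\<And>a x. a \<in> A \<Longrightarrow> x \<in> M \<Longrightarrow> U (x * a) = U x * a"
    "\<And>x y. x \<in> M \<Longrightarrow> y \<in> M \<Longrightarrow> U x * star (U y) = x * star y"
    "\<And>x y. x \<in> M \<Longrightarrow> y \<in> M \<Longrightarrow> star (U x) * U y = star x * y"
  shows "hilbert_bimod_iso A (slice_bimod M) (slice_bimod N)"
  unfolding hilbert_bimod_iso_def slice_bimod_simps using assms by blast

section \<open>Realising the tensor product\<close>

text \<open>Products of values of \<open>m\<close> in B reproduce both inner products of elementary
  tensors, which makes evaluation isometric. The instances are multiplication in B, multiplication
  after an isomorphism in the second factor, and a multiplication transported from I.\<close>

locale balanced_pairing =
  fixes A :: "'b::cstar_algebra set"
    and E :: "('b, 'e) hilbert_bimod" and F :: "('b, 'f) hilbert_bimod" and m :: "'e \<Rightarrow> 'f \<Rightarrow> 'b"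
  assumes rip_pairing: "\<And>x y x' y'. \<lbrakk>x \<in> hcarrier E; y \<in> hcarrier F; x' \<in> hcarrier E; y' \<in> hcarrier F\<rbrakk>
      \<Longrightarrow> rip F y (lact F (rip E x x') y') = star (m x y) * m x' y'"
    and lip_pairing: "\<And>x y x' y'. \<lbrakk>x \<in> hcarrier E; y \<in> hcarrier F; x' \<in> hcarrier E; y' \<in> hcarrier F\<rbrakk>
      \<Longrightarrow> lip E (ract E x (lip F y y')) x' = m x y * star (m x' y')"
    and lact_pairing: "\<And>a x y. \<lbrakk>a \<in> A; x \<in> hcarrier E; y \<in> hcarrier F\<rbrakk>
      \<Longrightarrow> m (lact E a x) y = a * m x y"
    and ract_pairing: "\<And>a x y. \<lbrakk>a \<in> A; x \<in> hcarrier E; y \<in> hcarrier F\<rbrakk>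
      \<Longrightarrow> m x (ract F y a) = m x y * a"
    and lact_closed: "\<And>a x. a \<in> A \<Longrightarrow> x \<in> hcarrier E \<Longrightarrow> lact E a x \<in> hcarrier E"
    and ract_closed: "\<And>a y. a \<in> A \<Longrightarrow> y \<in> hcarrier F \<Longrightarrow> ract F y a \<in> hcarrier F"
begin

abbreviation "FT \<equiv> formal_tensors E F"
abbreviation "TC \<equiv> tensor_Cauchy E F"
abbreviation "TR \<equiv> tensor_rel E F"

section \<open>Evaluation of formal tensors in B\<close>

definition ev :: "('e, 'f) formal_tensor \<Rightarrow> 'b" where
  "ev s = (\<Sum>p\<in>Poly_Mapping.keys s. Poly_Mapping.lookup s p *\<^sub>C m (fst p) (snd p))"

lemma ev_superset:
  assumes "finite S" "Poly_Mapping.keys s \<subseteq> S"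
  shows "ev s = (\<Sum>p\<in>S. Poly_Mapping.lookup s p *\<^sub>C m (fst p) (snd p))"
  unfolding ev_def using assms
  by (intro sum.mono_neutral_left) (auto simp: in_keys_iff)

lemma ev_add: "ev (s + t) = ev s + ev t"
proof -
  let ?S = "Poly_Mapping.keys s \<union> Poly_Mapping.keys t \<union> Poly_Mapping.keys (s + t)"
  have fin: "finite ?S"
    by simp
  show ?thesis
    by (subst (1 2 3) ev_superset[OF fin]) (auto simp: lookup_add scaleC_add_left sum.distrib)
qed

lemma ev_diff: "ev (s - t) = ev s - ev t"
  using ev_add[of "s - t" t] by simp

lemma ev_zero [simp]: "ev 0 = 0"
  by (simp add: ev_def)

lemma ev_scale: "ev (formal_scale c s) = c *\<^sub>C ev s"
proof -
  let ?S = "Poly_Mapping.keys s \<union> Poly_Mapping.keys (formal_scale c s)"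
  have fin: "finite ?S"
    by simp
  have "Poly_Mapping.lookup (formal_scale c s) p = c * Poly_Mapping.lookup s p" for p
    by (simp add: formal_scale_def Poly_Mapping.map.rep_eq when_def)
  then show ?thesis
    by (subst (1 2) ev_superset[OF fin]) (auto simp: complex_vector.scale_sum_right scaleC_scaleC)
qed

lemma ev_single: "ev (Poly_Mapping.single p c) = c *\<^sub>C m (fst p) (snd p)"
  by (simp add: ev_def)

lemma ev_sum: "ev (sum f S) = (\<Sum>i\<in>S. ev (f i))"
  by (induction S rule: infinite_finite_induct) (auto simp: ev_add)

lemma FT_add: "s \<in> FT \<Longrightarrow> t \<in> FT \<Longrightarrow> s + t \<in> FT"
  unfolding formal_tensors_def using Poly_Mapping.keys_add[of s t] by blast

lemma FT_zero: "0 \<in> FT"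
  by (simp add: formal_tensors_def)

lemma FT_sum: "(\<And>i. i \<in> S \<Longrightarrow> f i \<in> FT) \<Longrightarrow> sum f S \<in> FT"
  by (induction S rule: infinite_finite_induct) (auto simp: FT_add FT_zero)

lemma FT_single: "p \<in> hcarrier E \<times> hcarrier F \<Longrightarrow> Poly_Mapping.single p c \<in> FT"
  by (simp add: formal_tensors_def)

lemma FT_scale: "s \<in> FT \<Longrightarrow> formal_scale c s \<in> FT"
  unfolding formal_tensors_def formal_scale_def
  by (auto simp: in_keys_iff Poly_Mapping.map.rep_eq when_def split: if_splits)

lemma FT_keys: "s \<in> FT \<Longrightarrow> p \<in> Poly_Mapping.keys s \<Longrightarrow> fst p \<in> hcarrier E \<and> snd p \<in> hcarrier F"
  unfolding formal_tensors_def by auto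

lemma lact_FT:
  assumes "a \<in> A" "s \<in> FT"
  shows "formal_lact E a s \<in> FT" "ev (formal_lact E a s) = a * ev s"
proof -
  show "formal_lact E a s \<in> FT"
    unfolding formal_lact_def case_prod_beta
    by (intro FT_sum FT_single) (use assms FT_keys lact_closed in auto)
  show "ev (formal_lact E a s) = a * ev s"
    unfolding formal_lact_def case_prod_beta ev_sum ev_single
    unfolding ev_def sum_distrib_left
    by (intro sum.cong refl) (simp add: mult_scaleC_right lact_pairing assms FT_keys[OF assms(2)])
qed

lemma ract_FT:
  assumes "a \<in> A" "s \<in> FT"
  shows "formal_ract F s a \<in> FT" "ev (formal_ract F s a) = ev s * a"
proof -
  show "formal_ract F s a \<in> FT"
    unfolding formal_ract_def case_prod_beta
    by (intro FT_sum FT_single) (use assms FT_keys ract_closed in auto)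
  show "ev (formal_ract F s a) = ev s * a"
    unfolding formal_ract_def case_prod_beta ev_sum ev_single
    unfolding ev_def sum_distrib_right
    by (intro sum.cong refl) (simp add: mult_scaleC_left ract_pairing assms FT_keys[OF assms(2)])
qed

lemma formal_rip_ev:
  assumes "s \<in> FT" "t \<in> FT"
  shows "formal_rip E F s t = star (ev s) * ev t"
  unfolding formal_rip_def case_prod_beta ev_def star_sum sum_product
  by (intro sum.cong refl)
    (simp add: rip_pairing FT_keys[OF assms(1)] FT_keys[OF assms(2)]
      star_scaleC mult_scaleC_left mult_scaleC_right scaleC_scaleC mult.commute)

lemma formal_lip_ev:
  assumes "s \<in> FT" "t \<in> FT"
  shows "formal_lip E F s t = ev s * star (ev t)"
  unfolding formal_lip_def case_prod_beta ev_def star_sum sum_product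
  by (intro sum.cong refl)
    (simp add: lip_pairing FT_keys[OF assms(1)] FT_keys[OF assms(2)]
      star_scaleC mult_scaleC_left mult_scaleC_right scaleC_scaleC mult.commute)

lemma FT_diff: "s \<in> FT \<Longrightarrow> t \<in> FT \<Longrightarrow> s - t \<in> FT"
  unfolding formal_tensors_def
  by (auto simp: in_keys_iff lookup_minus) (metis in_keys_iff mem_Sigma_iff subsetD diff_self)+

lemma formal_seminorm_ev: "s \<in> FT \<Longrightarrow> formal_seminorm E F s = norm (ev s)"
  by (simp add: formal_seminorm_def formal_rip_ev cstar_identity)

lemma tensor_Cauchy_iff: "s \<in> TC \<longleftrightarrow> (\<forall>n. s n \<in> FT) \<and> Cauchy (\<lambda>n. ev (s n))"
  unfolding tensor_Cauchy_def Cauchy_def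
  by (auto simp: formal_seminorm_ev FT_diff ev_diff dist_norm)

lemma tensor_rel_iff: "(s, t) \<in> TR \<longleftrightarrow> s \<in> TC \<and> t \<in> TC \<and> (\<lambda>n. ev (s n) - ev (t n)) \<longlonglongrightarrow> 0"
proof -
  have "formal_seminorm E F (s n - t n) = norm (ev (s n) - ev (t n))" if "s \<in> TC" "t \<in> TC" for n
    using that by (simp add: tensor_Cauchy_iff formal_seminorm_ev FT_diff ev_diff)
  then have "(\<lambda>n. formal_seminorm E F (s n - t n)) = (\<lambda>n. norm (ev (s n) - ev (t n)))"
    if "s \<in> TC" "t \<in> TC"
    using that by auto
  then show ?thesis
    unfolding tensor_rel_def by (auto simp: tendsto_norm_zero_iff)
qed

lemma equiv_tensor_rel: "equiv TC TR"
proof (rule equivI)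
  show "sym TR"
  proof (rule symI)
    fix s t assume "(s, t) \<in> TR"
    then show "(t, s) \<in> TR"
      unfolding tensor_rel_iff using tendsto_minus[of "\<lambda>n. ev (s n) - ev (t n)" 0] by simp
  qed
  show "trans TR"
  proof (rule transI)
    fix s t r assume "(s, t) \<in> TR" "(t, r) \<in> TR"
    then show "(s, r) \<in> TR"
      unfolding tensor_rel_iff
      using tendsto_add[of "\<lambda>n. ev (s n) - ev (t n)" 0 _ "\<lambda>n. ev (t n) - ev (r n)" 0] by simp
  qed
qed (auto simp: refl_on_def tensor_rel_iff)

section \<open>Classes of Cauchy sequences and their limits in B\<close>

definition val :: "(nat \<Rightarrow> ('e, 'f) formal_tensor) set \<Rightarrow> 'b" where
  "val X = lim (\<lambda>n. ev (tensor_rep X n))"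

lemma rep_class:
  assumes "X \<in> TC // TR"
  shows "tensor_rep X \<in> TC" "X = TR `` {tensor_rep X}" "(\<lambda>n. ev (tensor_rep X n)) \<longlonglongrightarrow> val X"
    "tensor_rep X n \<in> FT"
proof -
  obtain s where s: "s \<in> TC" "X = TR `` {s}"
    using assms by (rule quotientE)
  have "s \<in> X"
    using s equiv_class_self[OF equiv_tensor_rel] by blast
  then have "tensor_rep X \<in> X"
    unfolding tensor_rep_def by (rule someI[of "\<lambda>s. s \<in> X"])
  then have rel: "(s, tensor_rep X) \<in> TR"
    using s by simp
  then show TC: "tensor_rep X \<in> TC"
    by (simp add: tensor_rel_iff)
  show "X = TR `` {tensor_rep X}"
    using rel s equiv_class_eq[OF equiv_tensor_rel] by blast
  show "(\<lambda>n. ev (tensor_rep X n)) \<longlonglongrightarrow> val X"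
    unfolding val_def using TC by (simp add: tensor_Cauchy_iff Cauchy_convergent_iff convergent_LIMSEQ_iff)
  show "tensor_rep X n \<in> FT"
    using TC by (simp add: tensor_Cauchy_iff)
qed

text \<open>Independence of the choice made by \<open>tensor_rep\<close>: equivalent sequences have
  the same limit under \<open>ev\<close>. Each operation is then computed on any convenient
  sequence.\<close>

lemma class_val:
  assumes "\<And>n. s n \<in> FT" "(\<lambda>n. ev (s n)) \<longlonglongrightarrow> z"
  shows "TR `` {s} \<in> TC // TR" "val (TR `` {s}) = z"
proof -
  have s: "s \<in> TC"
    using assms by (auto simp: tensor_Cauchy_iff intro: LIMSEQ_imp_Cauchy)
  then show X: "TR `` {s} \<in> TC // TR"
    by (rule quotientI)
  have "tensor_rep (TR `` {s}) \<in> TR `` {s}"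
    unfolding tensor_rep_def by (rule someI[of _ s]) (rule equiv_class_self[OF equiv_tensor_rel s])
  then have "(\<lambda>n. ev (s n) - ev (tensor_rep (TR `` {s}) n)) \<longlonglongrightarrow> 0"
    by (simp add: tensor_rel_iff)
  then have "(\<lambda>n. ev (tensor_rep (TR `` {s}) n)) \<longlonglongrightarrow> z"
    using tendsto_diff[OF assms(2)] by fastforce
  then show "val (TR `` {s}) = z"
    using rep_class(3)[OF X] LIMSEQ_unique by blast
qed

lemma val_inj: "inj_on val (TC // TR)"
proof (rule inj_onI)
  fix X Y assume X: "X \<in> TC // TR" and Y: "Y \<in> TC // TR" and eq: "val X = val Y"
  have "(\<lambda>n. ev (tensor_rep X n) - ev (tensor_rep Y n)) \<longlonglongrightarrow> 0"
    using tendsto_diff[OF rep_class(3)[OF X] rep_class(3)[OF Y]] eq by simp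
  then have "(tensor_rep X, tensor_rep Y) \<in> TR"
    using rep_class(1) X Y by (simp add: tensor_rel_iff)
  then show "X = Y"
    using rep_class(2) X Y equiv_class_eq[OF equiv_tensor_rel] by metis
qed

definition pairing_range :: "'b set" where
  "pairing_range = closed_cspan {m x y |x y. x \<in> hcarrier E \<and> y \<in> hcarrier F}"

lemma cspan_pairing:
  "cspan {m x y |x y. x \<in> hcarrier E \<and> y \<in> hcarrier F} = ev ` FT"
proof
  have "csubspace (ev ` FT)"
    unfolding complex_vector.subspace_def
  proof (intro conjI ballI allI)
    show "0 \<in> ev ` FT"
      using FT_zero ev_zero by force
  qed (auto simp flip: ev_add ev_scale simp: FT_add FT_scale)
  moreover have "m x y \<in> ev ` FT" if "x \<in> hcarrier E" "y \<in> hcarrier F" for x y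
    using ev_single[of "(x, y)" 1] FT_single[of "(x, y)" 1] that by (metis (no_types, lifting)
      complex_vector.scale_one fst_conv image_eqI mem_Sigma_iff snd_conv)
  ultimately show "cspan {m x y |x y. x \<in> hcarrier E \<and> y \<in> hcarrier F} \<subseteq> ev ` FT"
    by (intro complex_vector.span_minimal) auto
  show "ev ` FT \<subseteq> cspan {m x y |x y. x \<in> hcarrier E \<and> y \<in> hcarrier F}"
  proof (rule image_subsetI)
    fix s assume "s \<in> FT"
    then show "ev s \<in> cspan {m x y |x y. x \<in> hcarrier E \<and> y \<in> hcarrier F}"
      unfolding ev_def using FT_keys
      by (intro complex_vector.span_sum complex_vector.span_scale complex_vector.span_base) blast
  qed
qed

text \<open>Evaluations of a Cauchy sequence converge as B is complete; conversely a sequence of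
  evaluations converging in B is Cauchy and comes from a class.\<close>

lemma bij_val: "bij_betw val (TC // TR) pairing_range"
proof (rule bij_betw_imageI[OF val_inj])
  have "val X \<in> closure (ev ` FT)" if "X \<in> TC // TR" for X
    unfolding closure_sequential
    by (intro exI[of _ "\<lambda>n. ev (tensor_rep X n)"] conjI allI imageI rep_class(3,4)[OF that])
  moreover have "z \<in> val ` (TC // TR)" if z: "z \<in> closure (ev ` FT)" for z
  proof -
    obtain y where y: "(\<forall>n. y n \<in> ev ` FT) \<and> y \<longlonglongrightarrow> z"
      using z unfolding closure_sequential by (rule exE)
    then have "\<forall>n. \<exists>s. s \<in> FT \<and> y n = ev s"
      by auto
    then obtain s where s: "\<And>n. s n \<in> FT" "\<And>n. y n = ev (s n)"
      by metis
    have lim: "(\<lambda>n. ev (s n)) \<longlonglongrightarrow> z"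
      unfolding s(2)[symmetric] using y by blast
    show ?thesis
      by (rule image_eqI[where x = "TR `` {s}"]) (simp_all only: class_val[OF s(1) lim])
  qed
  ultimately show "val ` (TC // TR) = pairing_range"
    unfolding pairing_range_def closed_cspan_def cspan_pairing by blast
qed

lemma tensor_bimod_simps:
  "hcarrier (tensor_bimod E F) = TC // TR"
  "hadd (tensor_bimod E F) X Y = TR `` {\<lambda>n. tensor_rep X n + tensor_rep Y n}"
  "hscale (tensor_bimod E F) c X = TR `` {\<lambda>n. formal_scale c (tensor_rep X n)}"
  "lact (tensor_bimod E F) a X = TR `` {\<lambda>n. formal_lact E a (tensor_rep X n)}"
  "ract (tensor_bimod E F) X a = TR `` {\<lambda>n. formal_ract F (tensor_rep X n) a}"
  "lip (tensor_bimod E F) X Y = lim (\<lambda>n. formal_lip E F (tensor_rep X n) (tensor_rep Y n))"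
  "rip (tensor_bimod E F) X Y = lim (\<lambda>n. formal_rip E F (tensor_rep X n) (tensor_rep Y n))"
  by (simp_all add: tensor_bimod_def)

lemma tensor_operations:
  assumes X: "X \<in> TC // TR"
  shows "hscale (tensor_bimod E F) c X \<in> TC // TR" "val (hscale (tensor_bimod E F) c X) = c *\<^sub>C val X"
    and "a \<in> A \<Longrightarrow> lact (tensor_bimod E F) a X \<in> TC // TR"
    and "a \<in> A \<Longrightarrow> val (lact (tensor_bimod E F) a X) = a * val X"
    and "a \<in> A \<Longrightarrow> ract (tensor_bimod E F) X a \<in> TC // TR"
    and "a \<in> A \<Longrightarrow> val (ract (tensor_bimod E F) X a) = val X * a"
proof -
  note X' = rep_class(3,4)[OF X]
  have "(\<lambda>n. ev (formal_scale c (tensor_rep X n))) \<longlonglongrightarrow> c *\<^sub>C val X"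
    unfolding ev_scale by (intro tendsto_scaleC X')
  from class_val[OF FT_scale[OF X'(2)] this]
  show "hscale (tensor_bimod E F) c X \<in> TC // TR" "val (hscale (tensor_bimod E F) c X) = c *\<^sub>C val X"
    by (simp_all add: tensor_bimod_simps)
  assume a: "a \<in> A"
  have "(\<lambda>n. ev (formal_lact E a (tensor_rep X n))) \<longlonglongrightarrow> a * val X"
    unfolding lact_FT(2)[OF a X'(2)] by (intro tendsto_mult_left X')
  from class_val[OF lact_FT(1)[OF a X'(2)] this]
  show "lact (tensor_bimod E F) a X \<in> TC // TR" "val (lact (tensor_bimod E F) a X) = a * val X"
    by (simp_all add: tensor_bimod_simps)
  have "(\<lambda>n. ev (formal_ract F (tensor_rep X n) a)) \<longlonglongrightarrow> val X * a"
    unfolding ract_FT(2)[OF a X'(2)] by (intro tendsto_mult_right X')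
  from class_val[OF ract_FT(1)[OF a X'(2)] this]
  show "ract (tensor_bimod E F) X a \<in> TC // TR" "val (ract (tensor_bimod E F) X a) = val X * a"
    by (simp_all add: tensor_bimod_simps)
qed

lemma tensor_binary_operations:
  assumes X: "X \<in> TC // TR" and Y: "Y \<in> TC // TR"
  shows "hadd (tensor_bimod E F) X Y \<in> TC // TR" "val (hadd (tensor_bimod E F) X Y) = val X + val Y"
    and "lip (tensor_bimod E F) X Y = val X * star (val Y)"
    and "rip (tensor_bimod E F) X Y = star (val X) * val Y"
proof -
  note X' = rep_class(3,4)[OF X] and Y' = rep_class(3,4)[OF Y]
  have "(\<lambda>n. ev (tensor_rep X n + tensor_rep Y n)) \<longlonglongrightarrow> val X + val Y"
    unfolding ev_add by (intro tendsto_add X' Y')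
  from class_val[OF FT_add[OF X'(2) Y'(2)] this]
  show "hadd (tensor_bimod E F) X Y \<in> TC // TR" "val (hadd (tensor_bimod E F) X Y) = val X + val Y"
    by (simp_all add: tensor_bimod_simps)
  show "lip (tensor_bimod E F) X Y = val X * star (val Y)"
    unfolding tensor_bimod_simps formal_lip_ev[OF X'(2) Y'(2)]
    by (intro limI tendsto_mult tendsto_star X' Y')
  show "rip (tensor_bimod E F) X Y = star (val X) * val Y"
    unfolding tensor_bimod_simps formal_rip_ev[OF X'(2) Y'(2)]
    by (intro limI tendsto_mult tendsto_star X' Y')
qed

theorem tensor_bimod_iso: "hilbert_bimod_iso A (tensor_bimod E F) (slice_bimod pairing_range)"
  unfolding hilbert_bimod_iso_def
proof (intro exI[of _ val] conjI ballI allI, unfold tensor_bimod_simps(1) slice_bimod_simps)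
  show "bij_betw val (TC // TR) pairing_range"
    by (rule bij_val)
qed (simp_all only: tensor_operations tensor_binary_operations)

lemma tensor_bimod_closed: "hilbert_bimod_closed A (tensor_bimod E F)"
  unfolding hilbert_bimod_closed_def tensor_bimod_simps(1)
  by (intro conjI ballI allI) (simp_all only: tensor_operations tensor_binary_operations)

end


section \<open>Central maps and their multipliers\<close>

lemma clinear_onD:
  assumes "clinear_on X f"
  shows "\<And>x y. x \<in> X \<Longrightarrow> y \<in> X \<Longrightarrow> f (x + y) = f x + f y" "\<And>c x. x \<in> X \<Longrightarrow> f (c *\<^sub>C x) = c *\<^sub>C f x"
  using assms by (auto simp: clinear_on_def)

lemma clinear_on_diff:
  assumes "clinear_on X f" "closed_csubspace X" "x \<in> X" "y \<in> X"
  shows "f (x - y) = f x - f y"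
proof -
  have "f x = f ((x - y) + y)"
    by simp
  also have "\<dots> = f (x - y) + f y"
    using assms by (intro clinear_onD(1)[OF assms(1)]) (auto simp: closed_csubspaceD)
  finally show ?thesis
    by simp
qed

lemma clinear_on_zero:
  assumes "clinear_on X f" "closed_csubspace X"
  shows "f 0 = 0"
  using clinear_on_diff[OF assms, of 0 0] closed_csubspaceD(1)[OF assms(2)] by simp

locale ideal_inclusion =
  fixes A I :: "'b::cstar_algebra set"
  assumes A_nondegenerate: "nondegenerate_inclusion A" and I_ideal: "closed_ideal A I"
begin

section \<open>The algebra I B I and the action of I on it\<close>

definition D where "D = I \<cdot> UNIV \<cdot> I"

lemma A_sub: "cstar_subalgebra A"
  using A_nondegenerate by (simp add: nondegenerate_inclusion_def)

lemma I_sub: "cstar_subalgebra I"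
  using A_sub I_ideal by (rule closed_ideal_subalgebra)

lemmas A_simps = cstar_subalgebraD(2,3)[OF A_sub] closed_csubspaceD[OF cstar_subalgebraD(1)[OF A_sub]]
lemmas I_csub = cstar_subalgebraD(1)[OF I_sub]
lemmas I_simps = cstar_subalgebraD(2,3)[OF I_sub] closed_csubspaceD[OF I_csub]

lemma I_mem_A: "x \<in> I \<Longrightarrow> x \<in> A"
  and I_mult_left: "a \<in> A \<Longrightarrow> x \<in> I \<Longrightarrow> a * x \<in> I"
  and I_mult_right: "a \<in> A \<Longrightarrow> x \<in> I \<Longrightarrow> x * a \<in> I"
  using I_ideal by (auto simp: closed_ideal_def)

lemma D_csub: "closed_csubspace D"
  by (simp add: D_def)

lemmas D_simps = closed_csubspaceD[OF D_csub]

lemma D_base: "x \<in> I \<Longrightarrow> y \<in> I \<Longrightarrow> x * b * y \<in> D"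
  unfolding D_def by (intro subspace_prodI) auto

lemma D_least:
  assumes S: "closed_csubspace S" and base: "\<And>x b y. x \<in> I \<Longrightarrow> y \<in> I \<Longrightarrow> x * b * y \<in> S"
  shows "D \<subseteq> S"
proof -
  have "z * y \<in> S" if "z \<in> I \<cdot> UNIV" "y \<in> I" for z y
  proof -
    have "I \<cdot> UNIV \<subseteq> {z. z * y \<in> S}"
      using base that(2)
      by (intro subspace_prod_least closed_csubspace_vimage_mult_right S) auto
    then show ?thesis
      using that by blast
  qed
  then show ?thesis
    unfolding D_def by (intro subspace_prod_least S) auto
qed

lemma I_D: "x \<in> I \<Longrightarrow> x \<in> D"
  by (metis cohen_factor[OF I_sub] D_base)

lemma D_left: "d \<in> D \<Longrightarrow> d \<in> I \<cdot> UNIV"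
  using D_least[of "I \<cdot> UNIV"] subspace_prodI[of _ I _ UNIV] by (auto simp: mult.assoc)

lemma D_right: "d \<in> D \<Longrightarrow> d \<in> UNIV \<cdot> I"
  using D_least[of "UNIV \<cdot> I"] subspace_prodI[of _ UNIV _ I] by auto

lemma D_mult_right: "d \<in> D \<Longrightarrow> y \<in> I \<Longrightarrow> d * b * y \<in> D"
proof -
  assume y: "y \<in> I" and d: "d \<in> D"
  have "D \<subseteq> {d. d * (b * y) \<in> D}"
  proof (rule D_least)
    fix p c q assume "p \<in> I" "q \<in> I"
    then show "p * c * q \<in> {d. d * (b * y) \<in> D}"
      using D_base[of p y "c * q * b"] y by (simp add: mult.assoc)
  qed (rule closed_csubspace_vimage_mult_right[OF D_csub])
  then show ?thesis
    using d by (auto simp: mult.assoc)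
qed

lemma D_mult:
  assumes d: "d \<in> D" and "d' \<in> D"
  shows "d * d' \<in> D"
proof -
  have "D \<subseteq> {d'. d * d' \<in> D}"
  proof (rule D_least)
    fix p c q assume "p \<in> I" "q \<in> I"
    then show "p * c * q \<in> {d'. d * d' \<in> D}"
      using D_mult_right[OF d, of q "p * c"] by (simp add: mult.assoc)
  qed (rule closed_csubspace_vimage_mult_left[OF D_csub])
  then show ?thesis
    using assms by auto
qed

lemma D_star: "d \<in> D \<Longrightarrow> star d \<in> D"
proof -
  have "D \<subseteq> {d. star d \<in> D}"
  proof (rule D_least)
    fix p c q assume "p \<in> I" "q \<in> I"
    then show "p * c * q \<in> {d. star d \<in> D}"
      using D_base[of "star q" "star p" "star c"] by (simp add: star_mult mult.assoc I_simps)
  qed (rule closed_csubspace_vimage_star[OF D_csub])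
  then show "d \<in> D \<Longrightarrow> star d \<in> D"
    by auto
qed

lemma A_mult_D:
  assumes a: "a \<in> A" and "d \<in> D"
  shows "a * d \<in> D"
proof -
  have "D \<subseteq> {d. a * d \<in> D}"
  proof (rule D_least)
    fix p c q assume "p \<in> I" "q \<in> I"
    then show "p * c * q \<in> {d. a * d \<in> D}"
      using D_base[of "a * p" q c] a by (simp add: I_mult_left mult.assoc)
  qed (rule closed_csubspace_vimage_mult_left[OF D_csub])
  then show ?thesis
    using assms by auto
qed

lemma D_mult_A: "a \<in> A \<Longrightarrow> d \<in> D \<Longrightarrow> d * a \<in> D"
  using D_star[OF A_mult_D[of "star a" "star d"]] by (simp add: A_simps D_star star_mult star_star)

text \<open>Elements of \<open>D\<close> are limits of their products with the approximate unit of
  I, so I acts faithfully. This is the uniqueness behind \<open>left_ext\<close>.\<close>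

lemma eq_if_left:
  assumes "y \<in> D" "z \<in> D" "\<And>e. e \<in> I \<Longrightarrow> e * y = e * z"
  shows "y = z"
proof -
  have "y - z = 0"
    by (rule eq_0_if_mult_left[OF I_sub D_left]) (use assms in \<open>auto simp: D_simps right_diff_distrib\<close>)
  then show ?thesis
    by simp
qed

lemma eq_if_right:
  assumes "y \<in> D" "z \<in> D" "\<And>e. e \<in> I \<Longrightarrow> y * e = z * e"
  shows "y = z"
proof -
  have "y - z = 0"
    by (rule eq_0_if_mult_right[OF I_sub D_right]) (use assms in \<open>auto simp: D_simps left_diff_distrib\<close>)
  then show ?thesis
    by simp
qed

text \<open>A virtual commutant with its consequences made explicit. The bound is a parameter
  because the Cayley transform needs a numerical one; linearity over A is recovered from linearity
  over I by factorisation.\<close>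

definition central_map :: "real \<Rightarrow> ('b \<Rightarrow> 'b) \<Rightarrow> bool" where
  "central_map K \<phi> \<longleftrightarrow> clinear_on I \<phi> \<and> 0 \<le> K \<and>
     (\<forall>x\<in>I. \<phi> x \<in> D \<and> norm (\<phi> x) \<le> K * norm x) \<and>
     (\<forall>x\<in>I. \<forall>y\<in>I. \<phi> (x * y) = x * \<phi> y \<and> \<phi> (x * y) = \<phi> x * y)"

text \<open>Automatic continuity: otherwise there is a null sequence with unbounded images.
  Factorising it as y_n a with bounded y_n gives images y_n \<phi>(a), which are bounded.\<close>

lemma virtual_commutant_bounded:
  assumes \<phi>: "virtual_commutant A I \<phi>"
  obtains K where "0 \<le> K" "\<And>x. x \<in> I \<Longrightarrow> norm (\<phi> x) \<le> K * norm x"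
proof -
  have lin: "clinear_on I \<phi>" and mod: "\<And>a x. a \<in> A \<Longrightarrow> x \<in> I \<Longrightarrow> \<phi> (a * x) = a * \<phi> x"
    using \<phi> by (auto simp: virtual_commutant_def)
  have "\<exists>K\<ge>0. \<forall>x\<in>I. norm (\<phi> x) \<le> K * norm x"
  proof (rule ccontr)
    assume unbounded: "\<not> (\<exists>K\<ge>0. \<forall>x\<in>I. norm (\<phi> x) \<le> K * norm x)"
    have "\<exists>x\<in>I. norm x \<le> 1 / Suc n \<and> norm (\<phi> x) > n" for n :: nat
    proof -
      \<comment> \<open>Of the two factors \<open>Suc n\<close>, one is spent on scaling x to norm 1
        / \<open>Suc n\<close>; the other keeps the image large.\<close>
      obtain x where x: "x \<in> I" "norm (\<phi> x) > real (Suc n) * real (Suc n) * norm x"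
        using unbounded by (meson not_le of_nat_0_le_iff mult_nonneg_nonneg)
      have "x \<noteq> 0"
        using x clinear_on_zero[OF lin I_csub] by auto
      define r where "r = 1 / (Suc n * norm x)"
      have r: "r > 0"
        using \<open>x \<noteq> 0\<close> by (simp add: r_def)
      have "\<phi> (r *\<^sub>R x) = r *\<^sub>R \<phi> x"
        using clinear_onD(2)[OF lin x(1), of "complex_of_real r"] by (simp add: scaleC_of_real)
      moreover have "r * norm (\<phi> x) > n"
      proof -
        have "real n < real (Suc n)"
          by simp
        also have "\<dots> = r * (real (Suc n) * real (Suc n) * norm x)"
          using \<open>x \<noteq> 0\<close> by (simp add: r_def del: of_nat_Suc)
        also have "\<dots> < r * norm (\<phi> x)"
          using x(2) r by (rule mult_strict_left_mono)
        finally show ?thesis .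
      qed
      moreover have "r * norm x = 1 / Suc n"
        using \<open>x \<noteq> 0\<close> by (simp add: r_def)
      ultimately have "norm (r *\<^sub>R x) \<le> 1 / Suc n" "norm (\<phi> (r *\<^sub>R x)) > n"
        using r by simp_all
      then show ?thesis
        using x(1) by (intro bexI[of _ "r *\<^sub>R x"]) (auto simp: I_simps)
    qed
    then obtain x where x: "\<And>n. x n \<in> I" "\<And>n::nat. norm (x n) \<le> 1 / Suc n" "\<And>n. norm (\<phi> (x n)) > n"
      by metis
    have "x \<longlonglongrightarrow> 0"
      using x(2) LIMSEQ_inverse_real_of_nat
      by (intro Lim_null_comparison[of x "\<lambda>n. inverse (real (Suc n))"]) (auto simp: inverse_eq_divide)
    from cohen_factorisation[OF I_sub this x(1)]
    obtain a y K where ay: "a \<in> I" "\<And>n. y n \<in> I" "\<And>n. x n = y n * a" "\<And>n. norm (y n) \<le> K"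
      by metis
    have "norm (\<phi> (x n)) \<le> K * norm (\<phi> a)" for n
      unfolding ay(3) mod[OF I_mem_A[OF ay(2)] ay(1)]
      using norm_mult_ineq ay(4) by (meson mult_right_mono norm_ge_zero order_trans)
    then show False
      using x(3) reals_Archimedean2[of "K * norm (\<phi> a)"] by (meson less_le_not_le order_trans less_imp_le)
  qed
  then show ?thesis
    using that by blast
qed

text \<open>Factor x = p q a; then \<phi>(x) = p \<phi>(q) a.\<close>

lemma virtual_commutant_range:
  assumes \<phi>: "virtual_commutant A I \<phi>" and x: "x \<in> I"
  shows "\<phi> x \<in> D"
proof -
  obtain y a where ya: "y \<in> I" "a \<in> I" "x = y * a"
    using cohen_factor[OF I_sub x] by metis
  obtain p q where pq: "p \<in> I" "q \<in> I" "y = p * q"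
    using cohen_factor[OF I_sub ya(1)] by metis
  have "\<phi> (y * a) = \<phi> y * a" "\<phi> (p * q) = p * \<phi> q"
    using \<phi> ya(1,2) pq(1,2) I_mem_A unfolding virtual_commutant_def by blast+
  then have "\<phi> x = p * \<phi> q * a"
    using ya pq by simp
  then show ?thesis
    using D_base pq ya by simp
qed

lemma virtual_commutant_central_map:
  assumes "virtual_commutant A I \<phi>"
  shows "\<exists>K. central_map K \<phi>"
proof -
  obtain K where "0 \<le> K" "\<And>x. x \<in> I \<Longrightarrow> norm (\<phi> x) \<le> K * norm x"
    using virtual_commutant_bounded[OF assms] by metis
  then have "central_map K \<phi>"
    using assms virtual_commutant_range[OF assms]
    unfolding central_map_def virtual_commutant_def by (metis I_mem_A)
  then show ?thesis ..
qed

text \<open>Left multiplication by the multiplier of \<open>D\<close> that extends \<open>\<phi>\<close>.\<close>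

definition left_ext :: "('b \<Rightarrow> 'b) \<Rightarrow> 'b \<Rightarrow> 'b" where
  "left_ext \<phi> d = (THE y. y \<in> D \<and> (\<forall>e\<in>I. e * y = \<phi> e * d))"

definition adj :: "('b \<Rightarrow> 'b) \<Rightarrow> 'b \<Rightarrow> 'b" where
  "adj \<phi> x = star (\<phi> (star x))"

definition right_ext :: "('b \<Rightarrow> 'b) \<Rightarrow> 'b \<Rightarrow> 'b" where
  "right_ext \<phi> d = star (left_ext (adj \<phi>) (star d))"

section \<open>Extension of a central map to a multiplier of I B I\<close>

context
  fixes K \<phi> assumes \<phi>: "central_map K \<phi>"
begin

lemma central_mapD:
  shows "clinear_on I \<phi>" "0 \<le> K" "\<And>x. x \<in> I \<Longrightarrow> \<phi> x \<in> D" "\<And>x. x \<in> I \<Longrightarrow> norm (\<phi> x) \<le> K * norm x"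
    "\<And>x y. x \<in> I \<Longrightarrow> y \<in> I \<Longrightarrow> \<phi> (x * y) = x * \<phi> y" "\<And>x y. x \<in> I \<Longrightarrow> y \<in> I \<Longrightarrow> \<phi> (x * y) = \<phi> x * y"
  using \<phi> unfolding central_map_def by blast+

lemma central_map_A:
  assumes "e \<in> I" "a \<in> A"
  shows "\<phi> (e * a) = \<phi> e * a" "\<phi> (a * e) = a * \<phi> e"
proof -
  obtain p q where pq: "p \<in> I" "q \<in> I" "e = p * q"
    using cohen_factor[OF I_sub assms(1)] by metis
  show "\<phi> (e * a) = \<phi> e * a"
    using central_mapD(6)[of p "q * a"] central_mapD(6)[of p q] pq assms
    by (simp add: mult.assoc I_mult_right)
  show "\<phi> (a * e) = a * \<phi> e"
    using central_mapD(5)[of "a * p" q] central_mapD(5)[of p q] pq assms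
    by (simp add: mult.assoc I_mult_left)
qed

lemma left_ext_bound_aux:
  assumes d: "d \<in> D" and y: "y \<in> D" "\<And>e. e \<in> I \<Longrightarrow> e * y = \<phi> e * d"
  shows "norm y \<le> 2 * K * norm d"
proof (rule tendsto_upperbound)
  show "((\<lambda>e. norm (star e * y)) \<longlongrightarrow> norm y) (approx_unit I)"
    by (intro tendsto_norm tendsto_approx_unit_left[OF I_sub] D_left y)
  show "eventually (\<lambda>e. norm (star e * y) \<le> 2 * K * norm d) (approx_unit I)"
    using eventually_approx_unit_mem[OF I_sub]
  proof eventually_elim
    case (elim e)
    have "norm (star e * y) = norm (\<phi> (star e) * d)"
      using elim by (simp add: y I_simps)
    also have "\<dots> \<le> norm (\<phi> (star e)) * norm d"
      by (rule norm_mult_ineq)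
    also have "\<dots> \<le> (K * norm (star e)) * norm d"
      using elim by (intro mult_right_mono central_mapD) (auto simp: I_simps)
    also have "\<dots> \<le> (K * 2) * norm d"
      using elim norm_contractive_unit[of e] central_mapD(2) by (intro mult_right_mono mult_left_mono) auto
    finally show ?case
      by (simp add: mult.commute)
  qed
qed (rule approx_unit_not_bot[OF I_sub])

lemma left_ext_eqI:
  assumes "y \<in> D" "\<And>e. e \<in> I \<Longrightarrow> e * y = \<phi> e * d"
  shows "left_ext \<phi> d = y"
  unfolding left_ext_def using assms by (intro the_equality) (auto intro: eq_if_left)

text \<open>For d = p c q the solution is \<phi>(p) c q, by e \<phi>(p) = \<phi>(e p) = \<phi>(e) p.
  The a priori estimate turns convergent d into Cauchy solutions, so the solvable d form a closed
  subspace.\<close>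

lemma left_ext_exists:
  assumes "d \<in> D"
  shows "\<exists>y\<in>D. \<forall>e\<in>I. e * y = \<phi> e * d"
proof -
  let ?S = "{d\<in>D. \<exists>y\<in>D. \<forall>e\<in>I. e * y = \<phi> e * d}"
  have "closed_csubspace ?S"
  proof (rule closed_csubspaceI)
    show "0 \<in> ?S"
      using D_simps by (auto intro!: bexI[of _ 0])
  next
    fix d d' assume "d \<in> ?S" "d' \<in> ?S"
    then obtain y y' where "d \<in> D" "d' \<in> D" "y \<in> D" "y' \<in> D" "\<forall>e\<in>I. e * y = \<phi> e * d" "\<forall>e\<in>I. e * y' = \<phi> e * d'"
      by blast
    then show "d + d' \<in> ?S"
      by (auto simp: distrib_left D_simps intro!: bexI[of _ "y + y'"])
  next
    fix c d assume "d \<in> ?S"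
    then obtain y where "d \<in> D" "y \<in> D" "\<forall>e\<in>I. e * y = \<phi> e * d"
      by blast
    then show "c *\<^sub>C d \<in> ?S"
      by (auto simp: mult_scaleC_right D_simps intro!: bexI[of _ "c *\<^sub>C y"])
  next
    fix s l assume s: "\<And>n::nat. s n \<in> ?S" "s \<longlonglongrightarrow> l"
    then have l: "l \<in> D"
      using closed_sequentially[OF D_simps(8)] by blast
    obtain y where y: "\<And>n. y n \<in> D" "\<And>n e. e \<in> I \<Longrightarrow> e * y n = \<phi> e * s n"
      using s(1) by simp metis
    have diff: "norm (y m - y n) \<le> 2 * K * norm (s m - s n)" for m n
      using s(1) y by (intro left_ext_bound_aux) (auto simp: D_simps right_diff_distrib)
    have "Cauchy y"
    proof (rule metric_CauchyI)
      fix \<epsilon> :: real assume "\<epsilon> > 0"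
      \<comment> \<open>The summand 1 guards against K = 0.\<close>
      then have "\<epsilon> / (2 * K + 1) > 0"
        using central_mapD(2) by simp
      then obtain N where N: "\<forall>m\<ge>N. \<forall>n\<ge>N. norm (s m - s n) < \<epsilon> / (2 * K + 1)"
        using LIMSEQ_imp_Cauchy[OF s(2)] unfolding Cauchy_iff by blast
      have "dist (y m) (y n) < \<epsilon>" if "m \<ge> N" "n \<ge> N" for m n
      proof -
        have "norm (y m - y n) \<le> (2 * K + 1) * norm (s m - s n)"
          using diff[of m n] by (simp add: distrib_right add_increasing2)
        also have "\<dots> < (2 * K + 1) * (\<epsilon> / (2 * K + 1))"
          using N that central_mapD(2) by (intro mult_strict_left_mono) auto
        also have "\<dots> = \<epsilon>"
          using central_mapD(2) by simp
        finally show ?thesis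
          by (simp add: dist_norm)
      qed
      then show "\<exists>N. \<forall>m\<ge>N. \<forall>n\<ge>N. dist (y m) (y n) < \<epsilon>"
        by blast
    qed
    then obtain z where z: "y \<longlonglongrightarrow> z"
      using Cauchy_convergent convergent_def by blast
    have "z \<in> D"
      using y(1) z by (rule closed_sequentially[OF D_simps(8)])
    moreover have "e * z = \<phi> e * l" if "e \<in> I" for e
    proof (rule LIMSEQ_unique)
      show "(\<lambda>n. e * y n) \<longlonglongrightarrow> e * z"
        by (intro tendsto_mult_left z)
      show "(\<lambda>n. e * y n) \<longlonglongrightarrow> \<phi> e * l"
        unfolding y(2)[OF that] by (intro tendsto_mult_left s)
    qed
    ultimately show "l \<in> ?S"
      using l by blast
  qed
  moreover have "p * c * q \<in> ?S" if "p \<in> I" "q \<in> I" for p c q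
  proof -
    have "e * (\<phi> p * c * q) = \<phi> e * (p * c * q)" if "e \<in> I" for e
      using central_mapD(5)[OF that \<open>p \<in> I\<close>] central_mapD(6)[OF that \<open>p \<in> I\<close>]
      by (metis mult.assoc)
    then show ?thesis
      using that D_base D_mult_right[OF central_mapD(3)] by blast
  qed
  ultimately have "D \<subseteq> ?S"
    by (rule D_least)
  then show ?thesis
    using assms by blast
qed

lemma left_ext_D: "d \<in> D \<Longrightarrow> left_ext \<phi> d \<in> D"
  and left_ext_mult: "d \<in> D \<Longrightarrow> e \<in> I \<Longrightarrow> e * left_ext \<phi> d = \<phi> e * d"
  using left_ext_exists[of d] left_ext_eqI[of _ d] by blast+

lemma left_ext_bound: "d \<in> D \<Longrightarrow> norm (left_ext \<phi> d) \<le> 2 * K * norm d"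
  by (intro left_ext_bound_aux left_ext_D left_ext_mult)

lemma left_ext_add: "d \<in> D \<Longrightarrow> d' \<in> D \<Longrightarrow> left_ext \<phi> (d + d') = left_ext \<phi> d + left_ext \<phi> d'"
  by (rule left_ext_eqI) (simp_all add: D_simps left_ext_D left_ext_mult distrib_left)

lemma left_ext_diff: "d \<in> D \<Longrightarrow> d' \<in> D \<Longrightarrow> left_ext \<phi> (d - d') = left_ext \<phi> d - left_ext \<phi> d'"
  by (rule left_ext_eqI) (simp_all add: D_simps left_ext_D left_ext_mult right_diff_distrib)

lemma left_ext_scaleC: "d \<in> D \<Longrightarrow> left_ext \<phi> (c *\<^sub>C d) = c *\<^sub>C left_ext \<phi> d"
  by (rule left_ext_eqI) (simp_all add: D_simps left_ext_D left_ext_mult mult_scaleC_right)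

lemma left_ext_mult_right: "d \<in> D \<Longrightarrow> left_ext \<phi> d * b \<in> D \<Longrightarrow> left_ext \<phi> (d * b) = left_ext \<phi> d * b"
  by (rule left_ext_eqI) (simp_all add: left_ext_mult flip: mult.assoc)

text \<open>The commutation with I is contained here: e a lies in I, hence e a T(d) = \<phi>(e a) d
  = \<phi>(e) a d.\<close>

lemma left_ext_mult_left: "a \<in> A \<Longrightarrow> d \<in> D \<Longrightarrow> left_ext \<phi> (a * d) = a * left_ext \<phi> d"
  by (rule left_ext_eqI)
    (simp_all add: left_ext_mult A_mult_D left_ext_D I_mult_right central_map_A flip: mult.assoc)

lemma left_ext_I: "x \<in> I \<Longrightarrow> left_ext \<phi> x = \<phi> x"
  by (rule left_ext_eqI) (simp_all add: central_mapD(3), metis central_mapD(5,6))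

lemma central_map_adj: "central_map K (adj \<phi>)"
proof -
  have "adj \<phi> (x * y) = x * adj \<phi> y \<and> adj \<phi> (x * y) = adj \<phi> x * y" if "x \<in> I" "y \<in> I" for x y
    using central_mapD(5,6)[of "star y" "star x"] that
    by (metis I_simps(2) adj_def star_mult star_star)
  moreover have "norm (adj \<phi> x) \<le> K * norm x" if "x \<in> I" for x
    using central_mapD(4)[of "star x"] that by (simp add: adj_def I_simps)
  moreover have "clinear_on I (adj \<phi>)"
    by (simp add: clinear_on_def adj_def I_simps star_add star_scaleC clinear_onD[OF central_mapD(1)])
  moreover have "adj \<phi> x \<in> D" if "x \<in> I" for x
    using central_mapD(3) that by (simp add: adj_def D_star I_simps)
  ultimately show ?thesis
    unfolding central_map_def using central_mapD(2) by blast
qed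

end

context
  fixes K \<phi> assumes \<phi>: "central_map K \<phi>"
begin

lemmas adj_central = central_map_adj[OF \<phi>]

lemma right_ext_D: "d \<in> D \<Longrightarrow> right_ext \<phi> d \<in> D"
  unfolding right_ext_def by (intro D_star left_ext_D[OF adj_central])

lemma right_ext_mult: "d \<in> D \<Longrightarrow> e \<in> I \<Longrightarrow> right_ext \<phi> d * e = d * \<phi> e"
  using left_ext_mult[OF adj_central, of "star d" "star e"]
  by (metis (no_types, lifting) right_ext_def D_star I_simps(2) adj_def star_mult star_star)

lemma ext_swap:
  assumes "d \<in> D" "d' \<in> D"
  shows "right_ext \<phi> d * d' = d * left_ext \<phi> d'"
proof (rule tendsto_unique[OF approx_unit_not_bot[OF I_sub]])
  show "((\<lambda>e. right_ext \<phi> d * (star e * d')) \<longlongrightarrow> right_ext \<phi> d * d') (approx_unit I)"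
    by (intro tendsto_mult_left tendsto_approx_unit_left[OF I_sub] D_left assms)
  have "((\<lambda>e. d * (star e * left_ext \<phi> d')) \<longlongrightarrow> d * left_ext \<phi> d') (approx_unit I)"
    by (intro tendsto_mult_left tendsto_approx_unit_left[OF I_sub] D_left left_ext_D[OF \<phi>] assms)
  moreover have "eventually (\<lambda>e. d * (star e * left_ext \<phi> d') = right_ext \<phi> d * (star e * d')) (approx_unit I)"
    using eventually_approx_unit_mem[OF I_sub]
  proof eventually_elim
    case (elim e)
    then show ?case
      using assms by (simp add: left_ext_mult[OF \<phi>] right_ext_mult I_simps flip: mult.assoc)
  qed
  ultimately show "((\<lambda>e. right_ext \<phi> d * (star e * d')) \<longlongrightarrow> d * left_ext \<phi> d') (approx_unit I)"
    by (rule Lim_transform_eventually)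
qed

lemma left_ext_mult_D: "d \<in> D \<Longrightarrow> d' \<in> D \<Longrightarrow> left_ext \<phi> (d * d') = left_ext \<phi> d * d'"
  by (intro left_ext_mult_right[OF \<phi>] D_mult left_ext_D[OF \<phi>])

end

definition ext_multiplier :: "('b \<Rightarrow> 'b) \<Rightarrow> 'b multiplier" where
  "ext_multiplier \<phi> = (restrict (left_ext \<phi>) D, restrict (right_ext \<phi>) D)"

lemma ext_multiplier:
  assumes \<phi>: "central_map K \<phi>"
  shows "ext_multiplier \<phi> \<in> mult_commutant D I"
    and "x \<in> I \<Longrightarrow> d \<in> D \<Longrightarrow> fst (ext_multiplier \<phi>) (x * d) = \<phi> x * d"
    and "x \<in> I \<Longrightarrow> d \<in> D \<Longrightarrow> snd (ext_multiplier \<phi>) (d * x) = d * \<phi> x"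
proof -
  note adj = central_map_adj[OF \<phi>]
  have lin: "bounded_clinear_on D (restrict (left_ext \<phi>) D)" if "central_map K \<phi>" for \<phi>
    unfolding bounded_clinear_on_def clinear_on_def
    by (intro conjI exI[of _ "2 * K"] ballI allI)
      (auto simp: D_simps left_ext_add[OF that] left_ext_scaleC[OF that] left_ext_bound[OF that, simplified])
  have lin': "bounded_clinear_on D (restrict (right_ext \<phi>) D)"
    unfolding bounded_clinear_on_def clinear_on_def right_ext_def
    by (intro conjI exI[of _ "2 * K"] ballI allI)
      (auto simp: D_simps D_star star_add star_scaleC left_ext_add[OF adj] left_ext_scaleC[OF adj]
        intro: order.trans[OF left_ext_bound[OF adj]])
  have right_mult: "right_ext \<phi> (d * d') = d * right_ext \<phi> d'" if "d \<in> D" "d' \<in> D" for d d'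
    using left_ext_mult_D[OF adj, of "star d'" "star d"] that
    by (simp add: right_ext_def star_mult D_star star_star)
  have right_mult_A: "right_ext \<phi> (d * x) = right_ext \<phi> d * x" if "d \<in> D" "x \<in> I" for d x
    using left_ext_mult_left[OF adj, of "star x" "star d"] that
    by (simp add: right_ext_def star_mult D_star star_star I_mem_A I_simps)
  have mult: "ext_multiplier \<phi> \<in> multipliers D"
    unfolding ext_multiplier_def multipliers_def
    using lin[OF \<phi>] lin' by (auto simp: D_mult left_ext_D[OF \<phi>] right_ext_D[OF \<phi>]
        left_ext_mult_D[OF \<phi>] right_mult ext_swap[OF \<phi>])
  show "ext_multiplier \<phi> \<in> mult_commutant D I"
    unfolding mult_commutant_def
    using mult by (auto simp: mult_comp_def mult_of_def ext_multiplier_def compose_def restrict_def fun_eq_iff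
        I_D D_mult I_mem_A left_ext_mult_left[OF \<phi>] right_mult_A left_ext_D[OF \<phi>] right_ext_D[OF \<phi>])
  show "fst (ext_multiplier \<phi>) (x * d) = \<phi> x * d" if "x \<in> I" "d \<in> D"
    using that by (simp add: ext_multiplier_def D_mult I_D left_ext_mult_left[OF \<phi>] I_mem_A left_ext_mult[OF \<phi>])
  show "snd (ext_multiplier \<phi>) (d * x) = d * \<phi> x" if "x \<in> I" "d \<in> D"
    using that by (simp add: ext_multiplier_def D_mult I_D right_mult_A right_ext_mult[OF \<phi>])
qed

section \<open>Central multipliers of I and multipliers of I B I commuting with I\<close>

lemma multipliersD:
  assumes "T \<in> multipliers X"
  shows "fst T \<in> X \<rightarrow>\<^sub>E X" "snd T \<in> X \<rightarrow>\<^sub>E X" "bounded_clinear_on X (fst T)" "bounded_clinear_on X (snd T)"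
    "\<And>x y. x \<in> X \<Longrightarrow> y \<in> X \<Longrightarrow> fst T (x * y) = fst T x * y"
    "\<And>x y. x \<in> X \<Longrightarrow> y \<in> X \<Longrightarrow> snd T (x * y) = x * snd T y"
    "\<And>x y. x \<in> X \<Longrightarrow> y \<in> X \<Longrightarrow> snd T x * y = x * fst T y"
    "\<And>x. x \<in> X \<Longrightarrow> fst T x \<in> X" "\<And>x. x \<in> X \<Longrightarrow> snd T x \<in> X"
  using assms by (auto simp: multipliers_def)

text \<open>Factorisation gives agreement on I. The identity relating the two halves of a multiplier
  carries this over to \<open>D\<close>, on which I acts faithfully.\<close>

lemma multipliers_eqI:
  assumes T: "T \<in> multipliers D" and T': "T' \<in> multipliers D"
    and eq: "\<And>x y. x \<in> I \<Longrightarrow> y \<in> I \<Longrightarrow> fst T (x * y) = fst T' (x * y)"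
      "\<And>x y. x \<in> I \<Longrightarrow> y \<in> I \<Longrightarrow> snd T (y * x) = snd T' (y * x)"
  shows "T = T'"
proof -
  have eqI: "fst T e = fst T' e" "snd T e = snd T' e" if "e \<in> I" for e
    using cohen_factor[OF I_sub that] eq by metis+
  have "fst T d = fst T' d" if d: "d \<in> D" for d
    by (rule eq_if_left)
      (use d in \<open>simp_all add: multipliersD[OF T] multipliersD[OF T'] I_D eqI
        flip: multipliersD(7)[OF T] multipliersD(7)[OF T']\<close>)
  moreover have "snd T d = snd T' d" if d: "d \<in> D" for d
    by (rule eq_if_right)
      (use d in \<open>simp_all add: multipliersD(7-9)[OF T] multipliersD(7-9)[OF T'] I_D eqI\<close>)
  ultimately show ?thesis
    using multipliersD(1,2)[OF T] multipliersD(1,2)[OF T'] by (intro prod_eqI PiE_ext) auto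
qed

text \<open>Resolves the definite description in \<open>mult_incl\<close>: the extension of the
  common left and right action on I is the required multiplier.\<close>

lemma mult_incl_eqI:
  assumes "central_map K \<phi>" and S: "\<And>x. x \<in> I \<Longrightarrow> fst S x = \<phi> x" "\<And>x. x \<in> I \<Longrightarrow> snd S x = \<phi> x"
  shows "mult_incl I D S = ext_multiplier \<phi>"
  unfolding mult_incl_def
proof (rule the_equality)
  have mult: "ext_multiplier \<phi> \<in> multipliers D"
    using ext_multiplier(1)[OF assms(1)] by (simp add: mult_commutant_def)
  then show "ext_multiplier \<phi> \<in> multipliers D \<and> (\<forall>x\<in>I. \<forall>d\<in>D.
      fst (ext_multiplier \<phi>) (x * d) = fst S x * d \<and> snd (ext_multiplier \<phi>) (d * x) = d * snd S x)"
    using S ext_multiplier(2,3)[OF assms(1)] by simp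
  fix T assume "T \<in> multipliers D \<and> (\<forall>x\<in>I. \<forall>d\<in>D. fst T (x * d) = fst S x * d \<and> snd T (d * x) = d * snd S x)"
  then show "T = ext_multiplier \<phi>"
    using S ext_multiplier(2,3)[OF assms(1)] mult by (intro multipliers_eqI) (auto simp: I_D)
qed

lemma mult_of_mem: "x \<in> I \<Longrightarrow> mult_of I x \<in> multipliers I"
  unfolding multipliers_def mult_of_def bounded_clinear_on_def clinear_on_def
  using norm_mult_ineq[of x] norm_mult_ineq[of _ x]
  by (auto simp: I_simps mult.assoc distrib_left distrib_right mult_scaleC_left mult_scaleC_right
      intro!: exI[of _ "norm x"] simp: mult.commute[of "norm x"])

text \<open>Commuting with multiplication by elements of I makes the left half of \<open>S\<close> a
  bimodule map, and then \<open>snd S x * e\<close> = \<open>x * fst S e\<close> =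
  \<open>fst S x * e\<close> for e in I.\<close>

lemma mult_centreE:
  assumes "S \<in> mult_centre I"
  obtains K where "central_map K (fst S)" "\<And>x. x \<in> I \<Longrightarrow> snd S x = fst S x" "\<And>x. x \<in> I \<Longrightarrow> fst S x \<in> I"
proof -
  have S: "S \<in> multipliers I" and comm: "\<And>T. T \<in> multipliers I \<Longrightarrow> mult_comp I S T = mult_comp I T S"
    using assms by (auto simp: mult_centre_def)
  note S' = multipliersD[OF S]
  have left: "fst S (x * y) = x * fst S y" if "x \<in> I" "y \<in> I" for x y
    using comm[OF mult_of_mem[OF that(1)]] that S'
    by (auto simp: mult_comp_def mult_of_def compose_def restrict_def fun_eq_iff split: if_splits)
  obtain K where K: "clinear_on I (fst S)" "\<And>x. x \<in> I \<Longrightarrow> norm (fst S x) \<le> K * norm x"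
    using S'(3) unfolding bounded_clinear_on_def by blast
  \<comment> \<open>The constant in \<open>bounded_clinear_on\<close> may be negative if I =
    0.\<close>
  have "norm (fst S x) \<le> max K 0 * norm x" if "x \<in> I" for x
    by (rule order.trans[OF K(2)[OF that]]) (simp add: mult_right_mono)
  then have "central_map (max K 0) (fst S)"
    using K(1) left S' unfolding central_map_def by (auto simp: I_D)
  moreover have "snd S x = fst S x" if "x \<in> I" for x
  proof (rule eq_if_right)
    fix e assume "e \<in> I"
    then show "snd S x * e = fst S x * e"
      using that S'(7)[of x e] S'(5)[of x e] left[of x e] by simp
  qed (use that S' I_D in auto)
  ultimately show ?thesis
    using that S' by blast
qed

text \<open>For a multiplier T of I and x = p q one has \<phi>(T x) = T(p) \<phi>(q) = T(p
  \<phi>(q)) = T(\<phi>(x)); the middle equality needs \<phi>(q) in I.\<close>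

lemma central_map_mult_centre:
  assumes \<phi>: "central_map K \<phi>" and I: "\<And>x. x \<in> I \<Longrightarrow> \<phi> x \<in> I"
  shows "(restrict \<phi> I, restrict \<phi> I) \<in> mult_centre I"
proof -
  note \<phi>' = central_mapD[OF \<phi>]
  have "(restrict \<phi> I, restrict \<phi> I) \<in> multipliers I"
  proof -
    have "bounded_clinear_on I (restrict \<phi> I)"
      unfolding bounded_clinear_on_def clinear_on_def
      by (intro conjI exI[of _ K]) (auto simp: I_simps clinear_onD[OF \<phi>'(1)] \<phi>'(4))
    moreover have "\<phi> x * y = x * \<phi> y" if "x \<in> I" "y \<in> I" for x y
      using \<phi>'(5,6) that by metis
    ultimately show ?thesis
      unfolding multipliers_def by (auto simp: I_simps I \<phi>'(6))
  qed
  moreover have "\<phi> (fst T x) = fst T (\<phi> x)" "\<phi> (snd T x) = snd T (\<phi> x)" if T: "T \<in> multipliers I" and x: "x \<in> I" for T x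
  proof -
    note T' = multipliersD[OF T]
    obtain p q where pq: "p \<in> I" "q \<in> I" "x = p * q"
      using cohen_factor[OF I_sub x] by metis
    have "\<phi> (fst T x) = fst T p * \<phi> q"
      using pq T' \<phi>'(5) by simp
    also have "\<dots> = fst T (p * \<phi> q)"
      using pq T' I by simp
    finally show "\<phi> (fst T x) = fst T (\<phi> x)"
      using pq \<phi>'(5) by simp
    have "\<phi> (snd T x) = \<phi> p * snd T q"
      using pq T' \<phi>'(6) by simp
    also have "\<dots> = snd T (\<phi> p * q)"
      using pq T' I by simp
    finally show "\<phi> (snd T x) = snd T (\<phi> x)"
      using pq \<phi>'(6) by simp
  qed
  ultimately show ?thesis
    unfolding mult_centre_def using I
    by (auto simp: mult_comp_def compose_def restrict_def fun_eq_iff multipliersD)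
qed

text \<open>For x = p q in I both halves of T yield p T(q). Right linearity over A is then read off
  from \<open>fst T\<close> and left linearity from \<open>snd T\<close>, each after
  factorisation.\<close>

lemma mult_commutant_virtual_commutant:
  assumes "T \<in> mult_commutant D I"
  shows "virtual_commutant A I (fst T)" "\<And>x. x \<in> I \<Longrightarrow> snd T x = fst T x"
proof -
  have T: "T \<in> multipliers D" and comm: "\<And>x. x \<in> I \<Longrightarrow> mult_comp D T (mult_of D x) = mult_comp D (mult_of D x) T"
    using assms by (auto simp: mult_commutant_def)
  note T' = multipliersD[OF T]
  have left: "fst T (x * d) = x * fst T d" and right: "snd T (d * x) = snd T d * x" if "x \<in> I" "d \<in> D" for x d
    using comm[OF that(1)] that T' D_mult I_D
    by (auto simp: mult_comp_def mult_of_def compose_def restrict_def fun_eq_iff split: if_splits)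
  show eq: "snd T x = fst T x" if x: "x \<in> I" for x
  proof -
    obtain p q where pq: "p \<in> I" "q \<in> I" "x = p * q"
      using cohen_factor[OF I_sub x] by metis
    then show ?thesis
      using left[of p q] right[of q p] T'(7)[of p q] by (simp add: I_D)
  qed
  have "fst T (x * a) = fst T x * a" "snd T (a * x) = a * snd T x" if "x \<in> I" "a \<in> A" for x a
  proof -
    obtain p q where pq: "p \<in> I" "q \<in> I" "x = p * q"
      using cohen_factor[OF I_sub \<open>x \<in> I\<close>] by metis
    show "fst T (x * a) = fst T x * a"
      using pq T'(5)[of p "q * a"] T'(5)[of p q] that by (simp add: I_D I_mult_right mult.assoc)
    show "snd T (a * x) = a * snd T x"
      using pq T'(6)[of "a * p" q] T'(6)[of p q] that by (simp add: I_D I_mult_left mult.assoc)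
  qed
  moreover have "clinear_on I (fst T)"
    using T'(3) I_D by (auto simp: bounded_clinear_on_def clinear_on_def)
  ultimately show "virtual_commutant A I (fst T)"
    unfolding virtual_commutant_def by (metis eq I_mult_left)
qed

theorem virtual_commutants_iff_multipliers:
  "(\<forall>\<phi>. virtual_commutant A I \<phi> \<longrightarrow> \<phi> ` I \<subseteq> A) \<longleftrightarrow> mult_commutant D I = mult_incl I D ` mult_centre I"
proof
  assume range: "\<forall>\<phi>. virtual_commutant A I \<phi> \<longrightarrow> \<phi> ` I \<subseteq> A"
  show "mult_commutant D I = mult_incl I D ` mult_centre I"
  proof (intro equalityI subsetI)
    fix T assume T: "T \<in> mult_commutant D I"
    note vc = mult_commutant_virtual_commutant[OF T]
    have TD: "T \<in> multipliers D"
      using T by (simp add: mult_commutant_def)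
    obtain K where K: "central_map K (fst T)"
      using virtual_commutant_central_map[OF vc(1)] by blast
    \<comment> \<open>Values in A already lie in I, since \<phi>(p q) = \<phi>(p) q.\<close>
    have "fst T x \<in> I" if x: "x \<in> I" for x
    proof -
      obtain p q where pq: "p \<in> I" "q \<in> I" "x = p * q"
        using cohen_factor[OF I_sub x] by metis
      moreover have "fst T p \<in> A"
        using range vc(1) pq(1) by blast
      ultimately show ?thesis
        using central_mapD(6)[OF K] by (simp add: I_mult_left)
    qed
    from central_map_mult_centre[OF K this]
    have "(restrict (fst T) I, restrict (fst T) I) \<in> mult_centre I" .
    moreover have "mult_incl I D (restrict (fst T) I, restrict (fst T) I) = ext_multiplier (fst T)"
      by (rule mult_incl_eqI[OF K]) auto
    moreover have "ext_multiplier (fst T) = T"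
      using ext_multiplier[OF K] TD vc(2) I_D
      by (intro multipliers_eqI) (auto simp: mult_commutant_def multipliersD[OF TD])
    ultimately show "T \<in> mult_incl I D ` mult_centre I"
      by (metis imageI)
  next
    fix T assume "T \<in> mult_incl I D ` mult_centre I"
    then obtain S where S: "S \<in> mult_centre I" "T = mult_incl I D S"
      by blast
    obtain K where K: "central_map K (fst S)" "\<And>x. x \<in> I \<Longrightarrow> snd S x = fst S x"
      using mult_centreE[OF S(1)] by metis
    then show "T \<in> mult_commutant D I"
      using mult_incl_eqI[OF K(1), of S] ext_multiplier(1)[OF K(1)] S(2) by simp
  qed
next
  assume eq: "mult_commutant D I = mult_incl I D ` mult_centre I"
  show "\<forall>\<phi>. virtual_commutant A I \<phi> \<longrightarrow> \<phi> ` I \<subseteq> A"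
  proof (intro allI impI image_subsetI)
    fix \<phi> x assume "virtual_commutant A I \<phi>" and x: "x \<in> I"
    then obtain K where K: "central_map K \<phi>"
      using virtual_commutant_central_map by blast
    obtain S where S: "S \<in> mult_centre I" "ext_multiplier \<phi> = mult_incl I D S"
      using ext_multiplier(1)[OF K] eq by blast
    obtain K' where S': "central_map K' (fst S)" "\<And>x. x \<in> I \<Longrightarrow> snd S x = fst S x" "\<And>x. x \<in> I \<Longrightarrow> fst S x \<in> I"
      using mult_centreE[OF S(1)] by metis
    have "ext_multiplier \<phi> = ext_multiplier (fst S)"
      using S(2) mult_incl_eqI[OF S'(1), of S] S'(2) by simp
    then have "\<phi> x * d = fst S x * d" if "d \<in> I" for d
      using ext_multiplier(2)[OF K x, of d] ext_multiplier(2)[OF S'(1) x, of d] that I_D by simp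
    then have "\<phi> x = fst S x"
      by (rule eq_if_right[OF central_mapD(3)[OF K x] central_mapD(3)[OF S'(1) x]])
    then show "\<phi> x \<in> A"
      using S'(3)[OF x] I_mem_A by simp
  qed
qed

end


section \<open>Slices\<close>

lemma csubspace_isometric_image:
  fixes u :: "'a::cstar_algebra \<Rightarrow> 'a"
  assumes X: "closed_csubspace X" and lin: "clinear_on X u" and isom: "\<And>x. x \<in> X \<Longrightarrow> norm (u x) = norm x"
  shows "closed_csubspace (u ` X)"
proof (rule closed_csubspaceI)
  note X' = closed_csubspaceD[OF X]
  show "0 \<in> u ` X"
    using clinear_on_zero[OF lin X] X' by force
  show "x + y \<in> u ` X" if xy: "x \<in> u ` X" "y \<in> u ` X" for x y
  proof -
    obtain a b where "a \<in> X" "b \<in> X" "x = u a" "y = u b"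
      using xy by blast
    then show ?thesis
      using clinear_onD(1)[OF lin, of a b] X'(2)[of a b] by (metis imageI)
  qed
  show "c *\<^sub>C x \<in> u ` X" if x: "x \<in> u ` X" for c x
  proof -
    obtain a where "a \<in> X" "x = u a"
      using x by blast
    then show ?thesis
      using clinear_onD(2)[OF lin, of a c] X'(3)[of a c] by (metis imageI)
  qed
  fix s l assume s: "\<And>n::nat. s n \<in> u ` X" "s \<longlonglongrightarrow> l"
  have "\<forall>n. \<exists>x. x \<in> X \<and> s n = u x"
    using s(1) by auto
  then obtain x where x: "\<And>n. x n \<in> X" "\<And>n. s n = u (x n)"
    by metis
  have dist: "norm (u y - u z) = norm (y - z)" if "y \<in> X" "z \<in> X" for y z
    using that isom[of "y - z"] X' by (simp add: clinear_on_diff[OF lin X])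
  have "Cauchy x"
    using LIMSEQ_imp_Cauchy[OF s(2)] x by (simp add: Cauchy_def dist_norm dist)
  then obtain z where z: "x \<longlonglongrightarrow> z"
    using Cauchy_convergent convergent_def by blast
  have "z \<in> X"
    using x(1) z by (rule closed_sequentially[OF X'(8)])
  moreover have "(\<lambda>n. s n - u z) \<longlonglongrightarrow> 0"
    by (rule Lim_null_comparison[where g = "\<lambda>n. norm (x n - z)"])
      (use x \<open>z \<in> X\<close> z in \<open>auto simp: dist tendsto_norm_zero_iff LIM_zero_iff\<close>)
  then have "s \<longlonglongrightarrow> u z"
    by (simp add: LIM_zero_iff)
  ultimately show "l \<in> u ` X"
    using LIMSEQ_unique[OF s(2)] by blast
qed

section \<open>Slices and their inner products\<close>

context ideal_inclusion
begin

text \<open>The normaliser condition follows from V(x) a V(x)^* = V(x a) V(x)^* = x a x^*, and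
  likewise on the other side.\<close>

lemma slice_of_isometry:
  assumes N: "closed_csubspace N" and V: "V ` I = N"
    and left: "\<And>a x. a \<in> A \<Longrightarrow> x \<in> I \<Longrightarrow> V (a * x) = a * V x"
    and right: "\<And>a x. a \<in> A \<Longrightarrow> x \<in> I \<Longrightarrow> V (x * a) = V x * a"
    and lip: "\<And>x y. x \<in> I \<Longrightarrow> y \<in> I \<Longrightarrow> V x * star (V y) = x * star y"
    and rip: "\<And>x y. x \<in> I \<Longrightarrow> y \<in> I \<Longrightarrow> star (V x) * V y = star x * y"
  shows "slice A N"
proof -
  have "V x \<in> normalisers A" if x: "x \<in> I" for x
  proof -
    have "V x * a * star (V x) = x * a * star x" "star (V x) * a * V x = star x * (a * x)" if "a \<in> A" for a
      using lip[of "x * a" x] rip[of x "a * x"] left[OF that x] right[OF that x] that x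
      by (simp_all add: I_mult_left I_mult_right mult.assoc)
    then show ?thesis
      using x by (auto simp: normalisers_def A_simps I_mem_A)
  qed
  moreover have "A \<cdot> N \<subseteq> N" "N \<cdot> A \<subseteq> N"
  proof -
    have "a * n \<in> N \<and> n * a \<in> N" if a: "a \<in> A" and n: "n \<in> N" for a n
    proof -
      obtain x where "x \<in> I" "n = V x"
        using n V by blast
      then show ?thesis
        using left[OF a] right[OF a] V a I_mult_left I_mult_right by (metis imageI)
    qed
    then show "A \<cdot> N \<subseteq> N" "N \<cdot> A \<subseteq> N"
      by (auto intro!: subspace_prod_least[OF N])
  qed
  ultimately show ?thesis
    using N V by (auto simp: slice_def)
qed

lemma sliceD:
  assumes "slice A M"
  shows "closed_csubspace M" "\<And>a x. a \<in> A \<Longrightarrow> x \<in> M \<Longrightarrow> a * x \<in> M" "\<And>a x. a \<in> A \<Longrightarrow> x \<in> M \<Longrightarrow> x * a \<in> M"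
  using assms subspace_prodI[of _ A _ M] subspace_prodI[of _ M _ A] by (auto simp: slice_def)

text \<open>Normalisers only give z^* a z in A. Letting a run through an approximate unit of A
  yields z^* z, and this is where A B = B enters; polarisation does the rest.\<close>

lemma slice_inner_products:
  assumes M: "slice A M" and x: "x \<in> M" and y: "y \<in> M"
  shows "star x * y \<in> A" "x * star y \<in> A"
proof -
  note A_csub = cstar_subalgebraD(1)[OF A_sub]
  note M' = closed_csubspaceD[OF sliceD(1)[OF M]]
  have norm_M: "z * a * star z \<in> A" "star z * a * z \<in> A" if "z \<in> M" "a \<in> A" for z a
    using M that by (auto simp: slice_def normalisers_def)
  have nd: "b \<in> A \<cdot> UNIV" for b
    using A_nondegenerate by (simp add: nondegenerate_inclusion_def)
  have sq: "star z * z \<in> A" "z * star z \<in> A" if z: "z \<in> M" for z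
  proof -
    have "((\<lambda>e. star z * (star e * z)) \<longlongrightarrow> star z * z) (approx_unit A)"
      by (intro tendsto_mult_left tendsto_approx_unit_left[OF A_sub] nd)
    moreover have "eventually (\<lambda>e. star z * (star e * z) \<in> A) (approx_unit A)"
      using eventually_approx_unit_mem[OF A_sub]
      by eventually_elim (use norm_M(2)[OF z] in \<open>auto simp: A_simps simp flip: mult.assoc\<close>)
    ultimately show "star z * z \<in> A"
      by (rule closed_csubspace_lim[OF A_csub _ approx_unit_not_bot[OF A_sub]])
    have "((\<lambda>e. z * (star e * star z)) \<longlongrightarrow> z * star z) (approx_unit A)"
      by (intro tendsto_mult_left tendsto_approx_unit_left[OF A_sub] nd)
    moreover have "eventually (\<lambda>e. z * (star e * star z) \<in> A) (approx_unit A)"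
      using eventually_approx_unit_mem[OF A_sub]
      by eventually_elim (use norm_M(1)[OF z] in \<open>auto simp: A_simps simp flip: mult.assoc\<close>)
    ultimately show "z * star z \<in> A"
      by (rule closed_csubspace_lim[OF A_csub _ approx_unit_not_bot[OF A_sub]])
  qed
  have half: "z \<in> A" if "z + z \<in> A" for z
    using A_simps(8)[OF that, of "1/2"] by (simp flip: scaleR_2)
  let ?z = "x + \<i> *\<^sub>C y"
  have mem: "x + y \<in> M" "?z \<in> M"
    using x y M' by auto
  \<comment> \<open>Two terms of the polarisation identity suffice, the squares of x and y being in
    A already.\<close>
  have "star x * y + star x * y = star (x + y) * (x + y) - star x * x - star y * y
      - \<i> *\<^sub>C (star ?z * ?z - star x * x - star y * y)"
    by (simp add: star_add star_scaleC mult_scaleC_left mult_scaleC_right algebra_simps scaleC_scaleC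
        complex_vector.scale_right_diff_distrib complex_vector.scale_right_distrib)
  also have "\<dots> \<in> A"
    by (intro A_simps sq mem x y)
  finally show "star x * y \<in> A"
    by (rule half)
  have "x * star y + x * star y = (x + y) * star (x + y) - x * star x - y * star y
      + \<i> *\<^sub>C (?z * star ?z - x * star x - y * star y)"
    by (simp add: star_add star_scaleC mult_scaleC_left mult_scaleC_right algebra_simps scaleC_scaleC
        complex_vector.scale_right_diff_distrib complex_vector.scale_right_distrib)
  also have "\<dots> \<in> A"
    by (intro A_simps sq mem x y)
  finally show "x * star y \<in> A"
    by (rule half)
qed

lemma hilbert_bimod_closed_slice_A: "slice A M \<Longrightarrow> hilbert_bimod_closed A (slice_bimod M)"
  by (intro hilbert_bimod_closed_slice) (auto simp: sliceD)

lemma slice_isoE: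
  assumes M: "slice A M" and iso: "hilbert_bimod_iso A (slice_bimod M) (slice_bimod I)"
  obtains V where "bij_betw V I M" "virtual_commutant A I V"
    "\<And>x y. x \<in> I \<Longrightarrow> y \<in> I \<Longrightarrow> V x * star (V y) = x * star y"
    "\<And>x y. x \<in> I \<Longrightarrow> y \<in> I \<Longrightarrow> star (V x) * V y = star x * y"
proof -
  have "hilbert_bimod_iso A (slice_bimod I) (slice_bimod M)"
    by (rule hilbert_bimod_iso_sym[OF iso hilbert_bimod_closed_slice_A[OF M]])
  then show ?thesis
  proof (rule slice_bimod_isoE)
    fix V assume "bij_betw V I M"
    "\<And>x y. x \<in> I \<Longrightarrow> y \<in> I \<Longrightarrow> V (x + y) = V x + V y" "\<And>c x. x \<in> I \<Longrightarrow> V (c *\<^sub>C x) = c *\<^sub>C V x"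
    "\<And>a x. a \<in> A \<Longrightarrow> x \<in> I \<Longrightarrow> V (a * x) = a * V x"
    "\<And>a x. a \<in> A \<Longrightarrow> x \<in> I \<Longrightarrow> V (x * a) = V x * a"
    "\<And>x y. x \<in> I \<Longrightarrow> y \<in> I \<Longrightarrow> V x * star (V y) = x * star y"
    "\<And>x y. x \<in> I \<Longrightarrow> y \<in> I \<Longrightarrow> star (V x) * V y = star x * y"
    then show ?thesis
      by (intro that[of V]) (auto simp: virtual_commutant_def clinear_on_def)
  qed
qed

lemma ideal_star_factor:
  assumes "x \<in> I"
  obtains y z where "y \<in> I" "z \<in> I" "x = star y * z"
  using cohen_factor[OF I_sub assms] by (metis I_simps(2) star_star)

text \<open>V(p q) = V(p) q puts M inside I. Conversely y^* z = V(y)^* V(z) lies in I M, hence in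
  M.\<close>

lemma slice_eq_if_virtual_commutants:
  assumes range: "\<forall>\<phi>. virtual_commutant A I \<phi> \<longrightarrow> \<phi> ` I \<subseteq> A"
    and M: "slice A M" and iso: "hilbert_bimod_iso A (slice_bimod M) (slice_bimod I)"
  shows "M = I"
proof -
  obtain V where V: "bij_betw V I M" "virtual_commutant A I V"
    "\<And>x y. x \<in> I \<Longrightarrow> y \<in> I \<Longrightarrow> star (V x) * V y = star x * y"
    using slice_isoE[OF M iso] by metis
  have VM: "V x \<in> M" if "x \<in> I" for x
    using that V(1) bij_betwE by blast
  have VI: "V x \<in> I" if x: "x \<in> I" for x
  proof -
    obtain p q where pq: "p \<in> I" "q \<in> I" "x = p * q"
      using cohen_factor[OF I_sub x] by metis
    have "V p \<in> A"
      using range V(2) pq(1) by blast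
    moreover have "V (p * q) = V p * q"
      using V(2) pq(1,2) I_mem_A unfolding virtual_commutant_def by blast
    ultimately show ?thesis
      using pq I_mult_left by simp
  qed
  have "x \<in> M" if x: "x \<in> I" for x
  proof -
    obtain y z where yz: "y \<in> I" "z \<in> I" "x = star y * z"
      using ideal_star_factor[OF x] by metis
    then have "x = star (V y) * V z"
      using V(3) by simp
    then show ?thesis
      using yz VI VM sliceD(2)[OF M] I_mem_A I_simps(2) by simp
  qed
  moreover have "M \<subseteq> I"
    using V(1) VI unfolding bij_betw_def by blast
  ultimately show ?thesis
    by blast
qed


section \<open>The Cayley transform of a central map\<close>

context
  fixes \<phi> assumes \<phi>: "central_map (1/6) \<phi>" and selfadj: "adj \<phi> = \<phi>"
begin

abbreviation L where "L \<equiv> left_ext \<phi>"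

text \<open>The extension doubles 1/6 to 1/3. If |L| \<le> 1/3, then 1 - \<i> L and 1 + \<i> L are
  invertible, and the resolvent differs from the identity by at most 1/2.\<close>

lemma L_bound: "d \<in> D \<Longrightarrow> norm (L d) \<le> (1/3) * norm d"
  using left_ext_bound[OF \<phi>] by simp

lemma L_symmetric:
  assumes "d \<in> D" "d' \<in> D"
  shows "star (L d) * d' = star d * L d'"
  using ext_swap[OF \<phi> D_star[OF assms(1)] assms(2)] by (simp add: right_ext_def selfadj star_star)

lemma resolvent_exists:
  assumes "d \<in> D" "cmod c = 1"
  shows "\<exists>z\<in>D. z = d + c *\<^sub>C L z"
proof (rule contraction_solve[OF D_csub assms(1), where r = "1/3"])
  show "c *\<^sub>C L z \<in> D" if "z \<in> D" for z
    using that by (simp add: D_simps left_ext_D[OF \<phi>])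
  show "norm (c *\<^sub>C L y - c *\<^sub>C L z) \<le> 1 / 3 * norm (y - z)" if "y \<in> D" "z \<in> D" for y z
    using L_bound[of "y - z"] that assms(2)
    by (simp add: D_simps left_ext_diff[OF \<phi>] norm_scaleC flip: complex_vector.scale_right_diff_distrib)
qed auto

text \<open>The resolvent (1 - \<i> L)^-1 on \<open>D\<close>.\<close>

definition G where "G d = (SOME z. z \<in> D \<and> z = d + \<i> *\<^sub>C L z)"

lemma G: assumes "d \<in> D" shows "G d \<in> D" "G d = d + \<i> *\<^sub>C L (G d)"
proof -
  have "\<exists>z. z \<in> D \<and> z = d + \<i> *\<^sub>C L z"
    using resolvent_exists[OF assms, of \<i>] by auto
  then have "G d \<in> D \<and> G d = d + \<i> *\<^sub>C L (G d)"
    unfolding G_def by (rule someI_ex)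
  then show "G d \<in> D" "G d = d + \<i> *\<^sub>C L (G d)"
    by blast+
qed

lemma G_eqI:
  assumes d: "d \<in> D" and z: "z \<in> D" "z = d + \<i> *\<^sub>C L z"
  shows "G d = z"
proof -
  have "G d - z = \<i> *\<^sub>C L (G d - z)"
  proof -
    have "G d - z = (d + \<i> *\<^sub>C L (G d)) - (d + \<i> *\<^sub>C L z)"
      using G(2)[OF d] z(2) by simp
    also have "\<dots> = \<i> *\<^sub>C L (G d - z)"
      using G(1)[OF d] z(1) by (simp add: left_ext_diff[OF \<phi>] complex_vector.scale_right_diff_distrib)
    finally show ?thesis .
  qed
  then have "norm (G d - z) = norm (L (G d - z))"
    using norm_scaleC[of \<i> "L (G d - z)"] by simp
  then have "norm (G d - z) \<le> (1/3) * norm (G d - z)"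
    using L_bound[of "G d - z"] G(1)[OF d] z(1) by (simp add: D_simps)
  then show ?thesis
    by simp
qed

lemma L_G: "d \<in> D \<Longrightarrow> \<i> *\<^sub>C L (G d) = G d - d"
  using G(2) by (metis add_diff_cancel_left')

lemma G_add: "d \<in> D \<Longrightarrow> d' \<in> D \<Longrightarrow> G (d + d') = G d + G d'"
  by (rule G_eqI) (simp_all add: D_simps G(1) left_ext_add[OF \<phi>] scaleC_add_right L_G)

lemma G_scaleC: "d \<in> D \<Longrightarrow> G (c *\<^sub>C d) = c *\<^sub>C G d"
proof (rule G_eqI)
  assume d: "d \<in> D"
  have "\<i> *\<^sub>C L (c *\<^sub>C G d) = c *\<^sub>C \<i> *\<^sub>C L (G d)"
    using d by (simp add: left_ext_scaleC[OF \<phi>] G(1) scaleC_scaleC mult.commute)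
  then show "c *\<^sub>C G d = c *\<^sub>C d + \<i> *\<^sub>C L (c *\<^sub>C G d)"
    using d by (simp add: L_G complex_vector.scale_right_diff_distrib)
qed (auto simp: D_simps G(1))

lemma G_mult_left: "a \<in> A \<Longrightarrow> d \<in> D \<Longrightarrow> G (a * d) = a * G d"
proof (rule G_eqI)
  assume a: "a \<in> A" and d: "d \<in> D"
  have "\<i> *\<^sub>C L (a * G d) = a * (\<i> *\<^sub>C L (G d))"
    using a d by (simp add: left_ext_mult_left[OF \<phi>] G(1) mult_scaleC_right)
  then show "a * G d = a * d + \<i> *\<^sub>C L (a * G d)"
    using d by (simp add: L_G right_diff_distrib)
qed (auto simp: A_mult_D G(1))

lemma G_mult_right:
  assumes d: "d \<in> D" and b: "\<And>d. d \<in> D \<Longrightarrow> d * b \<in> D"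
  shows "G (d * b) = G d * b"
proof (rule G_eqI)
  have "\<i> *\<^sub>C L (G d * b) = \<i> *\<^sub>C L (G d) * b"
    using assms by (simp add: left_ext_mult_right[OF \<phi>] left_ext_D[OF \<phi>] G(1) mult_scaleC_left)
  then show "G d * b = d * b + \<i> *\<^sub>C L (G d * b)"
    using d by (simp add: L_G left_diff_distrib)
qed (use assms in \<open>auto simp: G(1)\<close>)

text \<open>The Cayley transform (1 + \<i> L)(1 - \<i> L)^-1, also equal to 2 G - 1.\<close>

definition cayley where "cayley d = G d + \<i> *\<^sub>C L (G d)"

lemma cayley_eq: "d \<in> D \<Longrightarrow> cayley d = G d + G d - d"
  by (simp add: cayley_def L_G)

lemma cayley_D: "d \<in> D \<Longrightarrow> cayley d \<in> D"
  by (simp add: cayley_eq D_simps G(1))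

lemma cayley_add: "d \<in> D \<Longrightarrow> d' \<in> D \<Longrightarrow> cayley (d + d') = cayley d + cayley d'"
  by (simp add: cayley_eq D_simps G_add)

lemma cayley_scaleC: "d \<in> D \<Longrightarrow> cayley (c *\<^sub>C d) = c *\<^sub>C cayley d"
  by (simp add: cayley_eq D_simps G_scaleC scaleC_add_right complex_vector.scale_right_diff_distrib)

lemma cayley_mult_left: "a \<in> A \<Longrightarrow> d \<in> D \<Longrightarrow> cayley (a * d) = a * cayley d"
  by (simp add: cayley_eq A_mult_D G_mult_left algebra_simps)

lemma cayley_mult_right: "d \<in> D \<Longrightarrow> (\<And>d. d \<in> D \<Longrightarrow> d * b \<in> D) \<Longrightarrow> cayley (d * b) = cayley d * b"
  by (simp add: cayley_eq G_mult_right algebra_simps)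

text \<open>In terms of z = G(d) and z' = G(d'), both sides are z^* z' + L(z)^* L(z'); the mixed
  terms cancel by symmetry of L.\<close>

lemma cayley_rip:
  assumes d: "d \<in> D" "d' \<in> D"
  shows "star (cayley d) * cayley d' = star d * d'"
proof -
  define z z' where "z = G d" and "z' = G d'"
  have z: "z \<in> D" "z' \<in> D" "d = z - \<i> *\<^sub>C L z" "d' = z' - \<i> *\<^sub>C L z'"
    using G[OF d(1)] G[OF d(2)] unfolding z_def z'_def by (auto simp: eq_diff_eq)
  have sym: "star (L z) * z' = star z * L z'"
    using z by (intro L_symmetric)
  have "star (z + \<i> *\<^sub>C L z) * (z' + \<i> *\<^sub>C L z') = star z * z' + star (L z) * L z'"
    by (simp add: star_add star_scaleC mult_scaleC_left mult_scaleC_right distrib_left distrib_right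
        scaleC_scaleC scaleC_add_right left_diff_distrib complex_vector.scale_right_diff_distrib sym)
  moreover have "star (z - \<i> *\<^sub>C L z) * (z' - \<i> *\<^sub>C L z') = star z * z' + star (L z) * L z'"
    by (simp add: star_diff star_scaleC mult_scaleC_left mult_scaleC_right left_diff_distrib right_diff_distrib
        scaleC_scaleC distrib_right scaleC_add_right complex_vector.scale_right_diff_distrib sym)
  ultimately show ?thesis
    using z(3,4) unfolding cayley_def z_def z'_def by simp
qed

lemma norm_cayley: "d \<in> D \<Longrightarrow> norm (cayley d) = norm d"
  using cayley_rip[of d d] cstar_identity[of d] cstar_identity[of "cayley d"] by simp

text \<open>Solve p = (1 + \<i> L) z and take d = (1 - \<i> L) z.\<close>

lemma cayley_surj:
  assumes p: "p \<in> D"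
  shows "\<exists>d\<in>D. cayley d = p"
proof -
  obtain z where z: "z \<in> D" "z = p + (- \<i>) *\<^sub>C L z"
    using resolvent_exists[OF p, of "- \<i>"] by auto
  define d where "d = z - \<i> *\<^sub>C L z"
  have d: "d \<in> D"
    unfolding d_def using z by (intro D_simps left_ext_D[OF \<phi>])
  have "G d = z"
    using d z(1) by (intro G_eqI) (auto simp: d_def)
  then have "cayley d = z + \<i> *\<^sub>C L z"
    by (simp add: cayley_def)
  also have "\<dots> = p"
    using z(2) by (metis add_diff_cancel_right' complex_vector.scale_minus_left diff_minus_eq_add)
  finally show ?thesis
    using d by blast
qed

text \<open>The right inner products show that u is isometric; this is the other half of unitarity
  combined with centrality. By surjectivity w^* = u f for some f, and u x (u y)^* u f = u x y^* f =
  x y^* u f, so w w^* = 0.\<close>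

lemma cayley_lip:
  assumes x: "x \<in> I" and y: "y \<in> I"
  shows "cayley x * star (cayley y) = x * star y"
proof -
  define w where "w = cayley x * star (cayley y) - x * star y"
  have "w \<in> D"
    unfolding w_def using x y by (intro D_simps D_mult cayley_D D_star I_D)
  then obtain f where f: "f \<in> D" "cayley f = star w"
    using cayley_surj[OF D_star] by metis
  have sf: "star y * f \<in> D"
    by (rule D_mult[OF D_star[OF I_D[OF y]] f(1)])
  have "cayley x * (star (cayley y) * cayley f) = cayley x * (star y * f)"
    using cayley_rip[OF I_D[OF y] f(1)] by simp
  also have "\<dots> = cayley (x * (star y * f))"
    by (rule cayley_mult_right[OF I_D[OF x] D_mult[OF _ sf], symmetric])
  also have "\<dots> = x * (star y * cayley f)"
    using x y sf f by (simp add: cayley_mult_left I_mem_A I_simps)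
  finally have "w * star w = 0"
    unfolding f(2)[symmetric] by (simp add: w_def left_diff_distrib mult.assoc)
  then show ?thesis
    by (simp add: w_def)
qed

lemma cayley_slice:
  "slice A (cayley ` I)" "hilbert_bimod_iso A (slice_bimod (cayley ` I)) (slice_bimod I)"
proof -
  have lin: "clinear_on I cayley"
    by (simp add: clinear_on_def cayley_add cayley_scaleC I_D)
  have left: "cayley (a * x) = a * cayley x" and right: "cayley (x * a) = cayley x * a"
    if "a \<in> A" "x \<in> I" for a x
    using that by (auto simp: cayley_mult_left cayley_mult_right I_D D_mult_A)
  have csub: "closed_csubspace (cayley ` I)"
    by (rule csubspace_isometric_image[OF I_csub lin]) (simp add: norm_cayley I_D)
  show "slice A (cayley ` I)"
    by (rule slice_of_isometry[OF csub refl]) (auto simp: left right cayley_lip cayley_rip I_D)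
  have "inj_on cayley I"
  proof (rule inj_onI)
    fix x y assume "x \<in> I" "y \<in> I" "cayley x = cayley y"
    then have "norm (cayley (x - y)) = 0"
      by (simp add: clinear_on_diff[OF lin I_csub])
    then show "x = y"
      using norm_cayley[of "x - y"] \<open>x \<in> I\<close> \<open>y \<in> I\<close> by (simp add: I_D I_simps)
  qed
  then have "hilbert_bimod_iso A (slice_bimod I) (slice_bimod (cayley ` I))"
    by (intro slice_bimod_isoI[of cayley])
      (auto simp: bij_betw_def clinear_onD[OF lin] left right cayley_lip cayley_rip I_D)
  then show "hilbert_bimod_iso A (slice_bimod (cayley ` I)) (slice_bimod I)"
    by (rule hilbert_bimod_iso_sym[OF _ hilbert_bimod_closed_slice[OF I_csub]])
      (simp_all add: I_mult_left I_mult_right)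
qed

text \<open>If the Cayley transform maps \<open>I\<close> onto \<open>I\<close>, then the resolvent \<open>G\<close> is a small perturbation of the
  identity on \<open>I\<close>, hence onto \<open>I\<close> as well, and \<open>\<phi>\<close> is recovered from the inverse of \<open>G\<close>.\<close>

lemma central_map_into_ideal:
  assumes eq: "cayley ` I = I" and x: "x \<in> I"
  shows "\<phi> x \<in> I"
proof -
  have GI: "G y \<in> I" if y: "y \<in> I" for y
  proof -
    have "G y + G y = cayley y + y"
      using cayley_eq[OF I_D[OF y]] by simp
    also have "\<dots> \<in> I"
      using eq y by (intro I_simps) auto
    finally have "(1/2) *\<^sub>R (G y + G y) \<in> I"
      by (rule I_simps)
    then show ?thesis
      by (simp flip: scaleR_2)
  qed
  have "\<exists>y\<in>I. y = x + (y - G y)"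
  proof (rule contraction_solve[OF I_csub x, where r = "1/2"])
    fix y z assume yz: "y \<in> I" "z \<in> I"
    define d where "d = y - z"
    have d: "d \<in> D"
      using yz by (simp add: d_def D_simps I_D)
    have "G y = G (d + z)"
      by (simp add: d_def)
    then have "(y - G y) - (z - G z) = d - G d"
      using G_add[OF d I_D[OF yz(2)]] by (simp add: d_def)
    also have "\<dots> = - (\<i> *\<^sub>C L (G d))"
      by (subst (1) G(2)[OF d]) simp
    finally have "norm ((y - G y) - (z - G z)) = norm (L (G d))"
      by (simp add: norm_scaleC)
    moreover have "norm (L (G d)) \<le> (1/3) * norm (G d)"
      by (intro L_bound G(1) d)
    moreover have "norm (G d) \<le> norm d + norm (L (G d))"
      using norm_triangle_ineq[of d "\<i> *\<^sub>C L (G d)"] G(2)[OF d] by (simp add: norm_scaleC)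
    ultimately show "norm ((y - G y) - (z - G z)) \<le> 1/2 * norm (y - z)"
      by (simp add: d_def)
  qed (auto simp: I_simps GI)
  then obtain y where y: "y \<in> I" "G y = x"
    by auto
  have "x = y + \<i> *\<^sub>C \<phi> x"
    using G(2)[OF I_D[OF y(1)]] y(2) x by (simp add: left_ext_I[OF \<phi>])
  then have "\<i> *\<^sub>C \<phi> x = x - y"
    by (metis add_diff_cancel_left')
  then have "(- \<i>) *\<^sub>C \<i> *\<^sub>C \<phi> x \<in> I"
    using x y(1) by (simp only: I_simps)
  then show ?thesis
    by (simp add: scaleC_scaleC)
qed

end

section \<open>Reduction to self-adjoint maps of small norm\<close>

lemma central_map_combination:
  assumes \<phi>: "central_map K \<phi>" and \<psi>: "central_map K \<psi>" and K': "(cmod c + cmod c') * K \<le> K'"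
  shows "central_map K' (\<lambda>x. c *\<^sub>C \<phi> x + c' *\<^sub>C \<psi> x)"
proof -
  note \<phi>' = central_mapD[OF \<phi>] and \<psi>' = central_mapD[OF \<psi>]
  have "norm (c *\<^sub>C \<phi> x + c' *\<^sub>C \<psi> x) \<le> K' * norm x" if "x \<in> I" for x
  proof -
    have "norm (c *\<^sub>C \<phi> x + c' *\<^sub>C \<psi> x) \<le> cmod c * (K * norm x) + cmod c' * (K * norm x)"
      using \<phi>'(4)[OF that] \<psi>'(4)[OF that]
      by (intro order.trans[OF norm_triangle_ineq add_mono]) (auto simp: norm_scaleC mult_left_mono)
    also have "\<dots> = (cmod c + cmod c') * K * norm x"
      by (simp add: algebra_simps)
    also have "\<dots> \<le> K' * norm x"
      using K' by (intro mult_right_mono) auto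
    finally show ?thesis .
  qed
  moreover have "clinear_on I (\<lambda>x. c *\<^sub>C \<phi> x + c' *\<^sub>C \<psi> x)"
    by (simp add: clinear_on_def clinear_onD[OF \<phi>'(1)] clinear_onD[OF \<psi>'(1)] scaleC_add_right
        scaleC_scaleC mult.commute)
  moreover have "0 \<le> K'"
    using K' \<phi>'(2) by (meson add_nonneg_nonneg mult_nonneg_nonneg norm_ge_zero order_trans)
  moreover have "c *\<^sub>C \<phi> (x * y) + c' *\<^sub>C \<psi> (x * y) = x * (c *\<^sub>C \<phi> y + c' *\<^sub>C \<psi> y)"
    if "x \<in> I" "y \<in> I" for x y
    using that by (simp add: \<phi>'(5) \<psi>'(5) distrib_left mult_scaleC_right)
  moreover have "c *\<^sub>C \<phi> (x * y) + c' *\<^sub>C \<psi> (x * y) = (c *\<^sub>C \<phi> x + c' *\<^sub>C \<psi> x) * y"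
    if "x \<in> I" "y \<in> I" for x y
    using that by (simp add: \<phi>'(6) \<psi>'(6) distrib_right mult_scaleC_left)
  ultimately show ?thesis
    unfolding central_map_def by (simp add: D_simps \<phi>'(3) \<psi>'(3))
qed

text \<open>Up to the scale r, \<open>\<psi>\<close> and \<open>\<eta>\<close> are twice the real
  part and minus twice the imaginary part of \<open>\<phi>\<close>. The Cayley transform of either
  gives a slice isomorphic to I.\<close>

lemma virtual_commutants_if_slices_eq:
  assumes slices: "\<And>M. slice A M \<Longrightarrow> hilbert_bimod_iso A (slice_bimod M) (slice_bimod I) \<Longrightarrow> M = I"
    and vc: "virtual_commutant A I \<phi>"
  shows "\<phi> ` I \<subseteq> A"
proof -
  obtain K where K: "central_map K \<phi>"
    using virtual_commutant_central_map[OF vc] by blast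
  note K' = central_map_adj[OF K]
  \<comment> \<open>Makes 2 r K at most 1/6, also for K = 0.\<close>
  define r where "r = 1 / (12 * (K + 1))"
  have "K \<ge> 0"
    using K by (simp add: central_map_def)
  then have r: "r > 0" "2 * r * K \<le> 1/6"
    by (auto simp: r_def field_simps)
  define \<psi> where "\<psi> x = complex_of_real r *\<^sub>C \<phi> x + complex_of_real r *\<^sub>C adj \<phi> x" for x
  define \<eta> where "\<eta> x = (\<i> * complex_of_real r) *\<^sub>C \<phi> x + (- \<i> * complex_of_real r) *\<^sub>C adj \<phi> x" for x
  have central: "central_map (1/6) \<psi>" "central_map (1/6) \<eta>"
    unfolding \<psi>_def \<eta>_def using r
    by (intro central_map_combination[OF K K']; simp add: norm_mult)+
  have selfadj: "adj \<psi> = \<psi>" "adj \<eta> = \<eta>"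
    by (rule ext, simp add: adj_def \<psi>_def \<eta>_def star_add star_diff star_scaleC star_star add.commute)+
  show ?thesis
  proof (rule image_subsetI)
    fix x assume x: "x \<in> I"
    have mem: "\<psi> x \<in> I" "\<eta> x \<in> I"
      using x central_map_into_ideal[OF central(1) selfadj(1)] central_map_into_ideal[OF central(2) selfadj(2)]
        slices[OF cayley_slice[OF central(1) selfadj(1)]] slices[OF cayley_slice[OF central(2) selfadj(2)]]
      by auto
    have "complex_of_real (2 * r) *\<^sub>C \<phi> x = \<psi> x + (- \<i>) *\<^sub>C \<eta> x"
    proof -
      have "\<i> * (\<i> * complex_of_real r) = - complex_of_real r"
        by (simp flip: mult.assoc)
      then have "(- \<i>) *\<^sub>C \<eta> x = complex_of_real r *\<^sub>C \<phi> x - complex_of_real r *\<^sub>C adj \<phi> x"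
        by (simp add: \<eta>_def complex_vector.scale_right_diff_distrib scaleC_scaleC)
      moreover have "complex_of_real (2 * r) = complex_of_real r + complex_of_real r"
        by simp
      ultimately show ?thesis
        by (simp only: \<psi>_def scaleC_add_left) simp
    qed
    then have "\<phi> x = complex_of_real (1 / (2 * r)) *\<^sub>C (\<psi> x + (- \<i>) *\<^sub>C \<eta> x)"
      using r by (metis complex_vector.scale_one less_numeral_extra(3) mult_eq_0_iff nonzero_eq_divide_eq
          of_real_1 of_real_mult scaleC_scaleC zero_neq_numeral)
    then show "\<phi> x \<in> A"
      using mem I_mem_A by (simp only: I_simps)
  qed
qed


section \<open>Idempotent slices\<close>

lemma slice_tensor_square:
  assumes M: "slice A M" and iso: "hilbert_bimod_iso A (slice_bimod M) (slice_bimod I)"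
  shows "star ` M \<cdot> M = I"
    and "hilbert_bimod_iso A (tensor_bimod (slice_bimod M) (slice_bimod M)) (slice_bimod M)"
    and "M \<cdot> M = M \<Longrightarrow> M = I"
proof -
  obtain V where V: "bij_betw V I M" "virtual_commutant A I V"
    "\<And>x y. x \<in> I \<Longrightarrow> y \<in> I \<Longrightarrow> V x * star (V y) = x * star y"
    "\<And>x y. x \<in> I \<Longrightarrow> y \<in> I \<Longrightarrow> star (V x) * V y = star x * y"
    using slice_isoE[OF M iso] by metis
  note M' = sliceD[OF M]
  have VM: "V x \<in> M" if "x \<in> I" for x
    using that V(1) bij_betwE by blast
  have V_left: "V (a * x) = a * V x" and V_right: "V (x * a) = V x * a" if "a \<in> A" "x \<in> I" for a x
    using V(2) that unfolding virtual_commutant_def by blast+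
  define U where "U = inv_into I V"
  have U: "U p \<in> I" "V (U p) = p" if "p \<in> M" for p
    using V(1) that unfolding U_def bij_betw_def
    by (auto simp: inv_into_into f_inv_into_f)
  have UV: "U (V x) = x" if "x \<in> I" for x
    using V(1) that unfolding U_def by (simp add: bij_betw_inv_into_left)
  have U_left: "U (a * p) = a * U p" and U_right: "U (p * a) = U p * a" if "a \<in> A" "p \<in> M" for a p
    using UV[of "a * U p"] UV[of "U p * a"] that U[OF that(2)]
    by (simp_all add: V_left V_right I_mult_left I_mult_right)
  have rip: "star p * q = star (U p) * U q" and lip: "p * star q = U p * star (U q)" if "p \<in> M" "q \<in> M" for p q
    using V(3,4)[of "U p" "U q"] U that by simp_all
  show MM: "star ` M \<cdot> M = I"
  proof
    show "star ` M \<cdot> M \<subseteq> I"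
      by (rule subspace_prod_least[OF I_csub]) (auto simp: rip U I_simps)
    show "I \<subseteq> star ` M \<cdot> M"
    proof
      fix x assume "x \<in> I"
      then obtain y z where yz: "y \<in> I" "z \<in> I" "x = star y * z"
        using ideal_star_factor by metis
      then have "x = star (V y) * V z"
        using V(4) by simp
      then show "x \<in> star ` M \<cdot> M"
        using VM yz by (auto intro: subspace_prodI)
    qed
  qed
  \<comment> \<open>The product of I carried over to M. Its values exhaust M because every element
    of I is a product.\<close>
  define m where "m p q = V (U p * U q)" for p q
  have m_rip: "star (m p q) * m p' q' = star (U q) * (star (U p) * U p') * U q'"
    and m_lip: "m p q * star (m p' q') = U p * (U q * star (U q')) * star (U p')"
    if "p \<in> M" "q \<in> M" "p' \<in> M" "q' \<in> M" for p q p' q'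
    using that U V(3,4)[of "U p * U q" "U p' * U q'"]
    by (simp_all add: m_def I_simps star_mult mult.assoc)
  interpret balanced_pairing A "slice_bimod M" "slice_bimod M" m
  proof
    fix x y x' y' assume "x \<in> hcarrier (slice_bimod M)" "y \<in> hcarrier (slice_bimod M)"
      "x' \<in> hcarrier (slice_bimod M)" "y' \<in> hcarrier (slice_bimod M)"
    then have mem: "x \<in> M" "y \<in> M" "x' \<in> M" "y' \<in> M"
      by auto
    have a: "star x * x' \<in> A" "y * star y' \<in> A"
      using mem slice_inner_products[OF M] by auto
    have "star y * ((star x * x') * y') = star (U y) * U ((star x * x') * y')"
      using mem a by (intro rip M')
    also have "\<dots> = star (U y) * (star (U x) * U x') * U y'"
      using mem a by (simp only: U_left) (simp add: rip mult.assoc)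
    finally show "rip (slice_bimod M) y (lact (slice_bimod M) (rip (slice_bimod M) x x') y') = star (m x y) * m x' y'"
      using mem by (simp add: m_rip)
    have "x * (y * star y') * star x' = U (x * (y * star y')) * star (U x')"
      using mem a by (intro lip M')
    also have "\<dots> = U x * (U y * star (U y')) * star (U x')"
      using mem a by (simp only: U_right) (simp add: lip)
    finally show "lip (slice_bimod M) (ract (slice_bimod M) x (lip (slice_bimod M) y y')) x' = m x y * star (m x' y')"
      using mem by (simp add: m_lip)
  next
    fix a x y assume "a \<in> A" "x \<in> hcarrier (slice_bimod M)" "y \<in> hcarrier (slice_bimod M)"
    then show "m (lact (slice_bimod M) a x) y = a * m x y" "m x (ract (slice_bimod M) y a) = m x y * a"
      using U by (simp_all add: m_def U_left U_right I_simps V_left V_right mult.assoc flip: V_left V_right)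
  qed (use M' in auto)
  have "pairing_range = M"
  proof
    show "pairing_range \<subseteq> M"
      unfolding pairing_range_def m_def using U VM by (intro closed_cspan_least M') (auto simp: I_simps)
    show "M \<subseteq> pairing_range"
    proof
      fix p assume p: "p \<in> M"
      obtain y z where yz: "y \<in> I" "z \<in> I" "U p = y * z"
        using cohen_factor[OF I_sub U(1)[OF p]] by metis
      then have "p = m (V y) (V z)"
        using UV U(2)[OF p] by (simp add: m_def)
      then show "p \<in> pairing_range"
        unfolding pairing_range_def using VM yz by (intro closed_cspan_base) auto
    qed
  qed
  then show "hilbert_bimod_iso A (tensor_bimod (slice_bimod M) (slice_bimod M)) (slice_bimod M)"
    using tensor_bimod_iso by simp
  assume idem: "M \<cdot> M = M"
  show "M = I"
  proof
    show "M \<subseteq> I"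
    proof
      fix p assume p: "p \<in> M"
      obtain y z where yz: "y \<in> I" "z \<in> I" "U p = star y * z"
        using ideal_star_factor[OF U(1)[OF p]] by metis
      obtain b c where bc: "b \<in> I" "c \<in> I" "z = b * c"
        using cohen_factor[OF I_sub yz(2)] by metis
      \<comment> \<open>Three factors are needed: left linearity turns this into V(y)^* (V(b) V(c)),
        whose bracket is in M M = M.\<close>
      have "p = V ((star y * b) * c)"
        using U(2)[OF p] yz bc by (simp add: mult.assoc)
      also have "\<dots> = star (V y) * V b * V c"
        using yz bc V(4) by (simp add: V_left I_mem_A I_simps)
      also have "\<dots> = star (V y) * (V b * V c)"
        by (rule mult.assoc)
      also have "\<dots> \<in> star ` M \<cdot> M"
        using subspace_prodI[of "V b" M "V c" M] yz bc VM idem by (intro subspace_prodI) auto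
      finally show "p \<in> I"
        using MM by simp
    qed
    show "I \<subseteq> M"
      unfolding MM[symmetric]
    proof (rule subspace_prod_least[OF M'(1)])
      fix p q assume "p \<in> star ` M" and q: "q \<in> M"
      then obtain p' where p: "p' \<in> M" "p = star p'"
        by blast
      have "M \<cdot> M \<subseteq> {q. p * q \<in> M}"
      proof (rule subspace_prod_least)
        fix q1 q2 assume "q1 \<in> M" "q2 \<in> M"
        then show "q1 * q2 \<in> {q. p * q \<in> M}"
          using p M'(2)[OF slice_inner_products(1)[OF M p(1), of q1], of q2] by (simp add: mult.assoc)
      qed (rule closed_csubspace_vimage_mult_left[OF M'(1)])
      then show "p * q \<in> M"
        using q idem by blast
    qed
  qed
qed

text \<open>Tensoring \<open>W: M \<cong> M M\<close> with \<open>M\<^sup>*\<close> yields \<open>I \<cong> M\<^sup>* M M\<close>.\<close>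

lemma slice_idempotent:
  assumes slices: "\<And>M. slice A M \<Longrightarrow> hilbert_bimod_iso A (slice_bimod M) (slice_bimod I) \<Longrightarrow> M = I"
    and M: "slice A M" and MM: "star ` M \<cdot> M = I"
    and iso: "hilbert_bimod_iso A (tensor_bimod (slice_bimod M) (slice_bimod M)) (slice_bimod M)"
  shows "M \<cdot> M = M"
proof -
  note M' = sliceD[OF M] and M_inner = slice_inner_products[OF M]
  \<comment> \<open>Multiplication in B realises the tensor square of M as M M.\<close>
  interpret square: balanced_pairing A "slice_bimod M" "slice_bimod M" "(*)"
    by standard (auto simp: star_mult mult.assoc M')
  have "square.pairing_range = M \<cdot> M"
    by (simp add: square.pairing_range_def subspace_prod_eq)
  then have "hilbert_bimod_iso A (slice_bimod M) (slice_bimod (M \<cdot> M))"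
    using hilbert_bimod_iso_trans[OF hilbert_bimod_iso_sym[OF iso square.tensor_bimod_closed]
        square.tensor_bimod_iso] by simp
  then obtain W where W_all: "bij_betw W M (M \<cdot> M)"
    "\<forall>a\<in>A. \<forall>x\<in>M. W (a * x) = a * W x \<and> W (x * a) = W x * a"
    "\<forall>x\<in>M. \<forall>y\<in>M. W x * star (W y) = x * star y \<and> star (W x) * W y = star x * y"
    unfolding hilbert_bimod_iso_def slice_bimod_simps by blast
  then have W: "bij_betw W M (M \<cdot> M)"
    "\<And>a x. a \<in> A \<Longrightarrow> x \<in> M \<Longrightarrow> W (a * x) = a * W x"
    "\<And>a x. a \<in> A \<Longrightarrow> x \<in> M \<Longrightarrow> W (x * a) = W x * a"
    "\<And>x y. x \<in> M \<Longrightarrow> y \<in> M \<Longrightarrow> W x * star (W y) = x * star y"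
    "\<And>x y. x \<in> M \<Longrightarrow> y \<in> M \<Longrightarrow> star (W x) * W y = star x * y"
    by auto
  have star_M: "star x \<in> M" if "x \<in> star ` M" for x
    using that by (auto simp: star_star)
  have star_M_left: "a * x \<in> star ` M" if "a \<in> A" "x \<in> star ` M" for a x
    using M'(3)[of "star a" "star x"] that star_M A_simps(2) by (metis image_eqI star_mult star_star)
  interpret p1: balanced_pairing A "slice_bimod (star ` M)" "slice_bimod M" "(*)"
    by standard (auto simp: star_mult mult.assoc M' intro: star_M_left)
  \<comment> \<open>A second realisation of the tensor product of M^* and M. Comparing its range,
    the closed span of M^* W(M), with the range I of the plain product gives the isomorphism with
    I.\<close>
  interpret p2: balanced_pairing A "slice_bimod (star ` M)" "slice_bimod M" "\<lambda>x y. x * W y"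
  proof
    fix x y x' y' assume "x \<in> hcarrier (slice_bimod (star ` M))" "y \<in> hcarrier (slice_bimod M)"
      "x' \<in> hcarrier (slice_bimod (star ` M))" "y' \<in> hcarrier (slice_bimod M)"
    then have mem: "star x \<in> M" "y \<in> M" "star x' \<in> M" "y' \<in> M"
      using star_M by auto
    have a: "star x * x' \<in> A"
      using M_inner(2)[OF mem(1,3)] by (simp add: star_star)
    have "star (W y) * ((star x * x') * W y') = star (W y) * W ((star x * x') * y')"
      using W(2)[OF a mem(4)] by simp
    also have "\<dots> = star y * ((star x * x') * y')"
      using mem a by (intro W(5) M')
    finally show "rip (slice_bimod M) y (lact (slice_bimod M) (rip (slice_bimod (star ` M)) x x') y') =
        star (x * W y) * (x' * W y')"
      by (simp add: star_mult mult.assoc)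
    have "x * W y * star (x' * W y') = x * (W y * star (W y')) * star x'"
      by (simp add: star_mult mult.assoc)
    also have "W y * star (W y') = y * star y'"
      using mem by (intro W(4))
    finally show "lip (slice_bimod (star ` M)) (ract (slice_bimod (star ` M)) x (lip (slice_bimod M) y y')) x' =
        x * W y * star (x' * W y')"
      by simp
  qed (auto simp: M' W(2,3) mult.assoc intro: star_M_left)
  define K where "K = p2.pairing_range"
  have "p1.pairing_range = I"
    using MM by (simp add: p1.pairing_range_def subspace_prod_eq)
  then have KI: "hilbert_bimod_iso A (slice_bimod K) (slice_bimod I)"
    unfolding K_def
    using hilbert_bimod_iso_trans[OF hilbert_bimod_iso_sym[OF p2.tensor_bimod_iso p2.tensor_bimod_closed]
        p1.tensor_bimod_iso] by simp
  have IK: "hilbert_bimod_iso A (slice_bimod I) (slice_bimod K)"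
    using \<open>p1.pairing_range = I\<close> unfolding K_def
    using hilbert_bimod_iso_trans[OF hilbert_bimod_iso_sym[OF p1.tensor_bimod_iso p1.tensor_bimod_closed]
        p2.tensor_bimod_iso] by simp
  have "slice A K"
  proof (rule slice_bimod_isoE[OF IK])
    fix V assume V: "bij_betw V I K"
      "\<And>a x. a \<in> A \<Longrightarrow> x \<in> I \<Longrightarrow> V (a * x) = a * V x"
      "\<And>a x. a \<in> A \<Longrightarrow> x \<in> I \<Longrightarrow> V (x * a) = V x * a"
      "\<And>x y. x \<in> I \<Longrightarrow> y \<in> I \<Longrightarrow> V x * star (V y) = x * star y"
      "\<And>x y. x \<in> I \<Longrightarrow> y \<in> I \<Longrightarrow> star (V x) * V y = star x * y"
    have "closed_csubspace K"
      by (simp add: K_def p2.pairing_range_def)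
    then show ?thesis
      by (rule slice_of_isometry[OF _ bij_betw_imp_surj_on[OF V(1)] V(2-5)])
  qed
  then have K: "K = I"
    using KI by (rule slices)
  have K_mem: "x * W y \<in> I" if "x \<in> star ` M" "y \<in> M" for x y
    unfolding K[symmetric] K_def p2.pairing_range_def using that by (intro closed_cspan_base) auto
  \<comment> \<open>M lies in B I because x^* x is in M^* M = I.\<close>
  have unit: "((\<lambda>e. x * e) \<longlongrightarrow> x) (approx_unit I)" if "x \<in> M" for x
    using that MM subspace_prodI[of "star x" "star ` M" x M]
    by (intro tendsto_approx_unit[OF I_sub] cstar_subalgebra_UNIV_prod[OF I_sub]) auto
  show ?thesis
  proof
    show "M \<cdot> M \<subseteq> M"
    proof (rule subspace_prod_least[OF M'(1)])
      fix x y assume x: "x \<in> M" and y: "y \<in> M"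
      \<comment> \<open>For p in M^* and q in M the product q y is in M M = W(M), so p q y belongs
        to K = I. Thus I y is contained in I.\<close>
      have "star ` M \<cdot> M \<subseteq> {e. e * y \<in> I}"
      proof (rule subspace_prod_least)
        fix p q assume pq: "p \<in> star ` M" "q \<in> M"
        have "q * y \<in> W ` M"
          using subspace_prodI[OF pq(2) y] W(1) by (simp add: bij_betw_def)
        then show "p * q \<in> {e. e * y \<in> I}"
          using K_mem pq(1) by (auto simp: mult.assoc)
      qed (rule closed_csubspace_vimage_mult_right[OF I_csub])
      then have Iy: "e * y \<in> I" if "e \<in> I" for e
        using MM that by blast
      have "((\<lambda>e. x * e * y) \<longlongrightarrow> x * y) (approx_unit I)"
        by (intro tendsto_mult_right unit x)
      moreover have "eventually (\<lambda>e. x * e * y \<in> M) (approx_unit I)"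
        using eventually_approx_unit_mem[OF I_sub]
        by eventually_elim (auto simp: mult.assoc intro: M' x I_mem_A Iy)
      ultimately show "x * y \<in> M"
        by (intro closed_csubspace_lim[OF M'(1) _ approx_unit_not_bot[OF I_sub]])
    qed
    show "M \<subseteq> M \<cdot> M"
    proof
      fix x assume x: "x \<in> M"
      \<comment> \<open>x p is in M M^*, hence in A, and A maps M M into itself. As K = I, all x e
        with e in I are in M M, and x is their limit.\<close>
      have "K \<subseteq> {e. x * e \<in> M \<cdot> M}"
        unfolding K_def p2.pairing_range_def
      proof (rule closed_cspan_least)
        show "closed_csubspace {e. x * e \<in> M \<cdot> M}"
          by (rule closed_csubspace_vimage_mult_left) simp
        have "x * (p * W z) \<in> M \<cdot> M" if p: "p \<in> star ` M" and z: "z \<in> M" for p z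
        proof -
          have xp: "x * p \<in> A"
            using M_inner(2)[OF x star_M[OF p]] by (simp add: star_star)
          have "M \<cdot> M \<subseteq> {w. x * p * w \<in> M \<cdot> M}"
          proof (rule subspace_prod_least)
            fix w1 w2 assume "w1 \<in> M" "w2 \<in> M"
            then show "w1 * w2 \<in> {w. x * p * w \<in> M \<cdot> M}"
              using subspace_prodI[OF M'(2)[OF xp, of w1], of w2 M] by (simp add: mult.assoc)
          qed (simp add: closed_csubspace_vimage_mult_left)
          moreover have "W z \<in> M \<cdot> M"
            using W(1) z bij_betwE by blast
          ultimately show ?thesis
            by (auto simp: mult.assoc)
        qed
        then show "{x * W y |x y. x \<in> hcarrier (slice_bimod (star ` M)) \<and> y \<in> hcarrier (slice_bimod M)}
            \<subseteq> {e. x * e \<in> M \<cdot> M}"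
          by auto
      qed
      then have "x * e \<in> M \<cdot> M" if "e \<in> I" for e
        using K that by blast
      then show "x \<in> M \<cdot> M"
        by (intro closed_csubspace_lim[OF closed_csubspace_prod unit[OF x] approx_unit_not_bot[OF I_sub]]
            eventually_mono[OF eventually_approx_unit_mem[OF I_sub]]) blast
    qed
  qed
qed

end

section \<open>The four conditions together\<close>

theorem proposition4p5:
  fixes A I :: "'b::cstar_algebra set"
  assumes "nondegenerate_inclusion A"
    and "closed_ideal A I"
  shows "let
      D = I \<cdot> UNIV \<cdot> I;
      cond1 = (\<forall>\<phi>. virtual_commutant A I \<phi> \<longrightarrow> \<phi> ` I \<subseteq> A);
      cond2 = (mult_commutant D I = mult_incl I D ` mult_centre I);
      cond3 = (\<forall>M. slice A M \<and> hilbert_bimod_iso A (slice_bimod M) (slice_bimod I) \<longrightarrow> M = I);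
      cond4 = (\<forall>M. slice A M \<and> star ` M \<cdot> M = I \<and>
        hilbert_bimod_iso A (tensor_bimod (slice_bimod M) (slice_bimod M)) (slice_bimod M)
        \<longrightarrow> M \<cdot> M = M)
    in (cond1 \<longleftrightarrow> cond2) \<and> (cond2 \<longleftrightarrow> cond3) \<and> (cond3 \<longleftrightarrow> cond4)"
proof -
  interpret ideal_inclusion A I
    using assms by unfold_locales
  have 12: "(\<forall>\<phi>. virtual_commutant A I \<phi> \<longrightarrow> \<phi> ` I \<subseteq> A) \<longleftrightarrow>
      mult_commutant (I \<cdot> UNIV \<cdot> I) I = mult_incl I (I \<cdot> UNIV \<cdot> I) ` mult_centre I"
    using virtual_commutants_iff_multipliers unfolding D_def .
  have 13: "(\<forall>\<phi>. virtual_commutant A I \<phi> \<longrightarrow> \<phi> ` I \<subseteq> A) \<longleftrightarrow>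
      (\<forall>M. slice A M \<and> hilbert_bimod_iso A (slice_bimod M) (slice_bimod I) \<longrightarrow> M = I)"
    using slice_eq_if_virtual_commutants virtual_commutants_if_slices_eq by blast
  have 34: "(\<forall>M. slice A M \<and> hilbert_bimod_iso A (slice_bimod M) (slice_bimod I) \<longrightarrow> M = I) \<longleftrightarrow>
      (\<forall>M. slice A M \<and> star ` M \<cdot> M = I \<and>
        hilbert_bimod_iso A (tensor_bimod (slice_bimod M) (slice_bimod M)) (slice_bimod M)
        \<longrightarrow> M \<cdot> M = M)"
    (is "?slices \<longleftrightarrow> ?idempotents")
  proof
    assume ?slices
    then show ?idempotents
      by (intro allI impI slice_idempotent) auto
  next
    assume idem: ?idempotents
    show ?slices
    proof (intro allI impI)
      fix M assume M: "slice A M \<and> hilbert_bimod_iso A (slice_bimod M) (slice_bimod I)"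
      note square = slice_tensor_square[OF conjunct1[OF M] conjunct2[OF M]]
      have "M \<cdot> M = M"
        using idem M square(1,2) by simp
      then show "M = I"
        by (rule square(3))
    qed
  qed
  show ?thesis
    unfolding Let_def by (intro conjI 12 34 trans[OF 12[symmetric] 13])
qed

end
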